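(* Let $T>0$, $\mathcal{J}=[0,T]$, $\alpha\in(0,1]$, $\beta_1\in(0,1)$, $\beta_2\in(0,\tfrac12)$, and let $y_0$ be an $\mathcal{F}_0$-measurable $\mathbb{R}^d$-valued random variable with $\mathbb{E}[|y_0|^p]<+\infty$ for some integer $p\ge 2$. Let $f_0:\mathcal{J}\times\mathbb{R}^d\to\mathbb{R}^d$, $f_1:\mathcal{J}\times\mathcal{J}\times\mathbb{R}^d\to\mathbb{R}^d$, $f_2:\mathcal{J}\times\mathcal{J}\times\mathbb{R}^d\to\mathbb{R}^{d\times r}$ be Borel measurable and satisfy: (1) there is $L_1>0$ with $|f_i(t_1,s,y)-f_i(t_2,s,y)|\le L_1(1+|y|)|t_1-t_2|$ for all $t_1,t_2,s\in\mathcal{J}$, $y\in\mathbb{R}^d$, $i=1,2$; (2) (local Lipschitz) for each integer $m\ge1$ there is $K_m>0$ with $|f_0(s,y_1)-f_0(s,y_2)|\vee|f_i(t,s,y_1)-f_i(t,s,y_2)|\le K_m|y_1-y_2|$ for all $t,s\in\mathcal{J}$, all $y_1,y_2\in\mathbb{R}^d$ with $|y_1|\vee|y_2|\le m$, $i=1,2$; (3) (linear growth) there is $L>0$ with $|f_0(s,y)|\vee|f_i(t,s,y)|\le L(1+|y|)$ for all $t,s\in\mathcal{J}$, $y\in\mathbb{R}^d$, $i=1,2$. Then the solution $y$ of $$D^{\alpha}y(t)=f_0(t,y(t))+\int_0^t(t-s)^{-\beta_1}f_1(t,s,y(s))\,\mathrm{d}s+\int_0^t(t-s)^{-\beta_2}f_2(t,s,y(s))\,\mathrm{d}W(s),\quad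 t\in\mathcal{J},\quad y(0)=y_0,$$ depends continuously on the initial value in the mean square sense: for every $\varepsilon>0$ there exists $\zeta>0$ such that, whenever $z$ is the solution of the same equation with initial value $z(0)=z_0$ and $\mathbb{E}[|y_0-z_0|^2]<\zeta$, one has $$\mathbb{E}\big[|y(t)-z(t)|^2\big]<\varepsilon\qquad\text{for all }t\in\mathcal{J}.$$ Here $z_0$ is an $\mathcal{F}_0$-measurable $\mathbb{R}^d$-valued random variable with $\mathbb{E}[|z_0|^p]<+\infty$.
   Context: $W$ is an $r$-dimensional standard Wiener process on a complete probability space $(\Omega,\mathcal{F},\mathbb{P})$ with a filtration $\{\mathcal{F}_t\}_{t\ge0}$ satisfying the usual conditions (right continuous, $\mathcal{F}_0$ contains all $\mathbb{P}$-null sets), and $W$ is a Wiener process with respect to this filtration; stochastic integrals are Itô integrals. $|\cdot|$ is the Euclidean norm on $\mathbb{R}^d$ and the Frobenius norm on $\mathbb{R}^{d\times r}$; $a\vee b=\max\{a,b\}$. $D^\alpha$ denotes the Caputo derivative of order $\alpha$, but the equation is rigorously defined by its integral form $$y(t)=y_0+\frac1{\Gamma(\alpha)}\int_0^t(t-\tau)^{\alpha-1}f_0(\tau,y(\tau))\,\mathrm{d}\tau+\frac1{\Gamma(\alpha)}\int_0^t(t-\tau)^{\alpha-1}\Big(\int_0^\tau(\tau-s)^{-\beta_1}f_1(\tau,s,y(s))\,\mathrm{d}s\Big)\mathrm{d}\tau+\frac1{\Gamma(\alpha)}\int_0^t(t-\tau)^{\alpha-1}\Big(\int_0^\tau(\tau-s)^{-\beta_2}f_2(\tau,s,y(s))\,\mathrm{d}W(s)\Big)\mathrm{d}\tau.\quad(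 * )$$ A solution is an $\mathbb{R}^d$-valued process $\{y(t)\}_{t\in\mathcal{J}}$ that is continuous and $\mathcal{F}_t$-adapted, such that almost surely $f_0(t,y(t))$ is integrable over $t\in\mathcal{J}$, $f_1(t,s,y(s))$ is integrable and $f_2(t,s,y(s))$ is square integrable over $\{0\le s\le t\le T\}$, and such that $( * )$ holds almost surely for every $t\in\mathcal{J}$. (Under the hypotheses of the claim the solution exists and is unique up to indistinguishability.) *)

theory Defs
  imports "HOL-Probability.Probability"
begin

section \<open>Filtered probability spaces and Wiener processes\<close>

text \<open>Time is \<open>{0..}\<close>; the values of processes and filtrations at negative times are irrelevant.\<close>

definition complete_filtered_prob_space :: "'a measure \<Rightarrow> (real \<Rightarrow> 'a measure) \<Rightarrow> bool" where
  "complete_filtered_prob_space M F \<longleftrightarrow>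
     prob_space M \<and> complete_measure M \<and>
     (\<forall>t\<ge>0. subalgebra M (F t)) \<and>
     (\<forall>s t. 0 \<le> s \<and> s \<le> t \<longrightarrow> sets (F s) \<subseteq> sets (F t)) \<and>
     (\<forall>t\<ge>0. sets (F t) = (\<Inter>s\<in>{t<..}. sets (F s))) \<and>
     null_sets M \<subseteq> sets (F 0)"

definition wiener_process ::
    "'a measure \<Rightarrow> (real \<Rightarrow> 'a measure) \<Rightarrow> (real \<Rightarrow> 'a \<Rightarrow> real ^ 'r) \<Rightarrow> bool" where
  "wiener_process M F W \<longleftrightarrow>
     (\<forall>t\<ge>0. W t \<in> borel_measurable (F t)) \<and>
     (AE \<omega> in M. W 0 \<omega> = 0) \<and>
     (AE \<omega> in M. continuous_on {0..} (\<lambda>t. W t \<omega>)) \<and>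
     (\<forall>s t. 0 \<le> s \<and> s < t \<longrightarrow>
        prob_space.indep_set M (sets (F s))
          (sets (vimage_algebra (space M) (\<lambda>\<omega>. W t \<omega> - W s \<omega>) borel)) \<and>
        prob_space.indep_vars M (\<lambda>_. borel) (\<lambda>i \<omega>. (W t \<omega> - W s \<omega>) $ i) UNIV \<and>
        (\<forall>i. distributed M lborel (\<lambda>\<omega>. (W t \<omega> - W s \<omega>) $ i) (normal_density 0 (sqrt (t - s)))))"

section \<open>The Ito integral\<close>

text \<open>
  The data \<open>n\<close>, \<open>u\<close>, \<open>\<xi>\<close> describe the simple process that equals \<open>\<xi> i\<close> on the time interval
  \<open>{u i<..u (Suc i)}\<close> for \<open>i < n\<close>, and vanishes elsewhere.
\<close>

definition simple_integrand ::
    "'a measure \<Rightarrow> (real \<Rightarrow> 'a measure) \<Rightarrow> real \<Rightarrow> nat \<Rightarrow> (nat \<Rightarrow> real)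
      \<Rightarrow> (nat \<Rightarrow> 'a \<Rightarrow> real ^ 'r ^ 'd) \<Rightarrow> bool" where
  "simple_integrand M F b n u \<xi> \<longleftrightarrow>
     0 \<le> u 0 \<and> u n \<le> b \<and> (\<forall>i<n. u i \<le> u (Suc i)) \<and>
     (\<forall>i<n. \<xi> i \<in> borel_measurable (F (u i)) \<and> bounded (\<xi> i ` space M))"

definition simple_process ::
    "nat \<Rightarrow> (nat \<Rightarrow> real) \<Rightarrow> (nat \<Rightarrow> 'a \<Rightarrow> real ^ 'r ^ 'd) \<Rightarrow> real \<Rightarrow> 'a \<Rightarrow> real ^ 'r ^ 'd" where
  "simple_process n u \<xi> s \<omega> = (\<Sum>i<n. indicator {u i<..u (Suc i)} s *\<^sub>R \<xi> i \<omega>)"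

definition simple_ito_integral ::
    "(real \<Rightarrow> 'a \<Rightarrow> real ^ 'r) \<Rightarrow> nat \<Rightarrow> (nat \<Rightarrow> real) \<Rightarrow> (nat \<Rightarrow> 'a \<Rightarrow> real ^ 'r ^ 'd)
      \<Rightarrow> 'a \<Rightarrow> real ^ 'd" where
  "simple_ito_integral W n u \<xi> \<omega> = (\<Sum>i<n. \<xi> i \<omega> *v (W (u (Suc i)) \<omega> - W (u i) \<omega>))"

text \<open>
  Measurable adapted processes on \<open>{0..b}\<close> whose paths are almost surely square integrable.
  Joint measurability refers to the completed product measure, so that it is not affected by
  what a process does on a null set of paths.
\<close>

definition ito_integrand ::
    "'a measure \<Rightarrow> (real \<Rightarrow> 'a measure) \<Rightarrow> real \<Rightarrow> (real \<Rightarrow> 'a \<Rightarrow> real ^ 'r ^ 'd) \<Rightarrow> bool" where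
  "ito_integrand M F b \<Phi> \<longleftrightarrow>
     (\<lambda>(s, \<omega>). \<Phi> s \<omega>) \<in> borel_measurable (completion (restrict_space lborel {0..b} \<Otimes>\<^sub>M M)) \<and>
     (\<forall>s\<in>{0..b}. \<Phi> s \<in> borel_measurable (F s)) \<and>
     (AE \<omega> in M. (\<integral>\<^sup>+s\<in>{0..b}. ennreal ((norm (\<Phi> s \<omega>))\<^sup>2) \<partial>lborel) < \<infinity>)"

text \<open>
  \<open>X\<close> is a version of \<open>\<integral>\<^sub>0\<^sup>b \<Phi>(s) dW(s)\<close>: the limit in probability of the integrals of simple
  processes that approximate \<open>\<Phi>\<close> in \<open>L\<^sup>2[0,b]\<close> in probability. This determines \<open>X\<close> up to
  almost sure equality.
\<close>

definition has_ito_integral ::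
    "'a measure \<Rightarrow> (real \<Rightarrow> 'a measure) \<Rightarrow> (real \<Rightarrow> 'a \<Rightarrow> real ^ 'r) \<Rightarrow> real
      \<Rightarrow> (real \<Rightarrow> 'a \<Rightarrow> real ^ 'r ^ 'd) \<Rightarrow> ('a \<Rightarrow> real ^ 'd) \<Rightarrow> bool" where
  "has_ito_integral M F W b \<Phi> X \<longleftrightarrow>
     ito_integrand M F b \<Phi> \<and> X \<in> borel_measurable M \<and>
     (\<exists>n u \<xi>.
        (\<forall>k. simple_integrand M F b (n k) (u k) (\<xi> k)) \<and>
        (\<forall>e>0. (\<lambda>k. \<P>(\<omega> in M. ennreal e <
            (\<integral>\<^sup>+s\<in>{0..b}. ennreal ((norm (simple_process (n k) (u k) (\<xi> k) s \<omega> - \<Phi> s \<omega>))\<^sup>2) \<partial>lborel)))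
          \<longlonglongrightarrow> 0) \<and>
        (\<forall>e>0. (\<lambda>k. \<P>(\<omega> in M. e < norm (simple_ito_integral W (n k) (u k) (\<xi> k) \<omega> - X \<omega>)))
          \<longlonglongrightarrow> 0))"

section \<open>The equation\<close>

text \<open>Riemann-Liouville integral of order \<open>\<alpha>\<close> of \<open>g\<close>, evaluated at \<open>t\<close>, and its existence.\<close>

definition frac_integrable :: "real \<Rightarrow> real \<Rightarrow> (real \<Rightarrow> real ^ 'd) \<Rightarrow> bool" where
  "frac_integrable \<alpha> t g \<longleftrightarrow> set_integrable lborel {0..t} (\<lambda>\<tau>. (t - \<tau>) powr (\<alpha> - 1) *\<^sub>R g \<tau>)"

definition frac_integral :: "real \<Rightarrow> real \<Rightarrow> (real \<Rightarrow> real ^ 'd) \<Rightarrow> real ^ 'd" where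
  "frac_integral \<alpha> t g =
     (1 / Gamma \<alpha>) *\<^sub>R (LINT \<tau>:{0..t}|lborel. (t - \<tau>) powr (\<alpha> - 1) *\<^sub>R g \<tau>)"

definition time_triangle :: "real \<Rightarrow> (real \<times> real) set" where
  "time_triangle T = {(t, s). 0 \<le> s \<and> s \<le> t \<and> t \<le> T}"

text \<open>
  Solutions of the integral equation on \<open>{0..T}\<close>. Ito integrals are only defined up to almost
  sure equality, separately for each upper limit \<open>\<tau>\<close>, so integrating them over \<open>\<tau>\<close> requires a
  jointly measurable version \<open>I\<close>; by Fubini, two such versions give almost surely the same
  outer integral. The Bochner integral of a non-integrable function is \<open>0\<close>, so the existence of
  the integrals in the equation is stated explicitly.
\<close>

definition is_solution ::
    "'a measure \<Rightarrow> (real \<Rightarrow> 'a measure) \<Rightarrow> (real \<Rightarrow> 'a \<Rightarrow> real ^ 'r) \<Rightarrow> real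
      \<Rightarrow> real \<Rightarrow> real \<Rightarrow> real
      \<Rightarrow> (real \<Rightarrow> real ^ 'd \<Rightarrow> real ^ 'd)
      \<Rightarrow> (real \<Rightarrow> real \<Rightarrow> real ^ 'd \<Rightarrow> real ^ 'd)
      \<Rightarrow> (real \<Rightarrow> real \<Rightarrow> real ^ 'd \<Rightarrow> real ^ 'r ^ 'd)
      \<Rightarrow> ('a \<Rightarrow> real ^ 'd) \<Rightarrow> (real \<Rightarrow> 'a \<Rightarrow> real ^ 'd) \<Rightarrow> bool" where
  "is_solution M F W T \<alpha> \<beta>\<^sub>1 \<beta>\<^sub>2 f\<^sub>0 f\<^sub>1 f\<^sub>2 y\<^sub>0 y \<longleftrightarrow>
     (\<forall>t\<in>{0..T}. y t \<in> borel_measurable (F t)) \<and>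
     (AE \<omega> in M. continuous_on {0..T} (\<lambda>t. y t \<omega>)) \<and>
     (AE \<omega> in M. set_integrable lborel {0..T} (\<lambda>t. f\<^sub>0 t (y t \<omega>))) \<and>
     (AE \<omega> in M. set_integrable lborel (time_triangle T) (\<lambda>(t, s). f\<^sub>1 t s (y s \<omega>))) \<and>
     (AE \<omega> in M. set_borel_measurable lborel (time_triangle T) (\<lambda>(t, s). f\<^sub>2 t s (y s \<omega>)) \<and>
        set_integrable lborel (time_triangle T) (\<lambda>(t, s). (norm (f\<^sub>2 t s (y s \<omega>)))\<^sup>2)) \<and>
     (\<exists>I. (\<lambda>(\<tau>, \<omega>). I \<tau> \<omega>) \<in> borel_measurable (restrict_space lborel {0..T} \<Otimes>\<^sub>M M) \<and>
        (\<forall>\<tau>\<in>{0..T}.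
           has_ito_integral M F W \<tau> (\<lambda>s \<omega>. (\<tau> - s) powr (-\<beta>\<^sub>2) *\<^sub>R f\<^sub>2 \<tau> s (y s \<omega>)) (I \<tau>)) \<and>
        (\<forall>t\<in>{0..T}. AE \<omega> in M.
           (let g\<^sub>1 = (\<lambda>\<tau>. LINT s:{0..\<tau>}|lborel. (\<tau> - s) powr (-\<beta>\<^sub>1) *\<^sub>R f\<^sub>1 \<tau> s (y s \<omega>)) in
            frac_integrable \<alpha> t (\<lambda>\<tau>. f\<^sub>0 \<tau> (y \<tau> \<omega>)) \<and>
            (AE \<tau> in lborel. \<tau> \<in> {0..t} \<longrightarrow>
               set_integrable lborel {0..\<tau>} (\<lambda>s. (\<tau> - s) powr (-\<beta>\<^sub>1) *\<^sub>R f\<^sub>1 \<tau> s (y s \<omega>))) \<and>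
            frac_integrable \<alpha> t g\<^sub>1 \<and>
            frac_integrable \<alpha> t (\<lambda>\<tau>. I \<tau> \<omega>) \<and>
            y t \<omega> = y\<^sub>0 \<omega> + frac_integral \<alpha> t (\<lambda>\<tau>. f\<^sub>0 \<tau> (y \<tau> \<omega>))
              + frac_integral \<alpha> t g\<^sub>1 + frac_integral \<alpha> t (\<lambda>\<tau>. I \<tau> \<omega>))))"

end

theory Submission
  imports Defs
begin

text \<open>
  The solutions are only known to have almost surely continuous paths, so all estimates are made
  before a stopping time and start with moment bounds for stopped Ito integrals. For a simple
  integrand with integral \<open>X\<close> and energy \<open>V = \<integral>|\<xi>|\<^sup>2 ds\<close>, the Hermite polynomial \<open>H\<^sub>2\<^sub>N(X, V)\<close> has mean
  zero, and this yields \<open>E[X ^ (2 * N)] \<le> C E[V ^ N]\<close>. With a Gronwall argument in an exponentially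
  weighted norm, linear growth gives bounds for the moments of a solution, conditionally on
  \<open>F 0\<close>-events \<open>A\<close>, and local Lipschitz continuity gives \<open>E[|y - z|\<^sup>2] \<le> C\<^sub>m E[|y\<^sub>0 - z\<^sub>0|\<^sup>2]\<close> as long as both
  solutions are bounded by \<open>m\<close>. On the event \<open>A = {|y\<^sub>0| \<le> k, |y\<^sub>0 - z\<^sub>0| \<le> 1}\<close> all moments are bounded
  uniformly in \<open>z\<close>; moments of order above \<open>1 / \<alpha>\<close> bound the suprema of the paths, so that leaving the ball of
  radius \<open>m\<close> has small probability, and fourth moments make this event negligible. Off \<open>A\<close> the second
  moments are controlled by those of the initial values.
\<close>

section \<open>Hermite polynomials and Gaussian variables\<close>

text \<open>The case p = 2 leaves no higher moment of the difference to interpolate with, and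
  \<open>z\<^sub>0\<close> varies, so that only E[|y_0 - z_0|^2] is uniformly small. Restricting to
  an event in \<open>F 0\<close> costs nothing, because later increments of the Wiener process are
  independent of it; where the initial values are bounded, moments of every order become available.
  The Ito integrand depends on the upper limit \<tau> of its own integral, so the Ito term is not a
  martingale in \<tau>. It sits inside a fractional integral, however, and moments at each fixed
  \<tau> suffice: the supremum over time is taken afterwards, from the time integral of these
  moments, with an order high enough to make the conjugate power of the outer kernel integrable. An
  Ito integral known only as a limit in probability cannot be stopped directly. Stopping is
  therefore done on simple processes, resampled on a uniform grid: the event at the left end of a
  cell is known when the cell begins, and multiplying by its indicator gives a simple process
  again.\<close>

text \<open>\<open>hermite n v\<close> is the polynomial in \<open>x\<close> for which \<open>x\<close>, \<open>v\<close> \<open>\<mapsto>\<close> \<open>poly (hermite n v) x\<close> solves the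
  backward heat equation with \<open>x ^ n\<close> as its value at \<open>v = 0\<close>.\<close>

fun hermite :: "nat \<Rightarrow> real \<Rightarrow> real poly" where
  "hermite 0 v = 1"
| "hermite (Suc 0) v = [:0, 1:]"
| "hermite (Suc (Suc n)) v = [:0, 1:] * hermite (Suc n) v - smult (real (Suc n) * v) (hermite n v)"

text \<open>The Appell property. Differentiating the recursion leaves \<open>hermite n v\<close>
  plus n times the recursion one index lower, which is again \<open>hermite n v\<close>; two earlier
  cases enter, hence the strong induction.\<close>

lemma pderiv_hermite: "pderiv (hermite (Suc n) v) = smult (real (Suc n)) (hermite n v)"
proof (induction n rule: less_induct)
  case (less n)
  show ?case
  proof (cases n)
    case 0
    then show ?thesis by (simp add: pderiv_pCons)
  next
    case (Suc m)
    have 1: "pderiv (hermite (Suc m) v) = smult (real (Suc m)) (hermite m v)"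
      using less Suc by auto
    show ?thesis
    proof (cases m)
      case 0
      then show ?thesis using Suc 1 by (simp add: pderiv_mult pderiv_pCons pderiv_diff pderiv_smult pderiv_1)
    next
      case (Suc k)
      have 2: "pderiv (hermite m v) = smult (real m) (hermite k v)"
        using less Suc \<open>n = Suc m\<close> by auto
      have "pderiv (hermite (Suc n) v) = 
         hermite n v + [:0,1:] * smult (real n) (hermite m v) - smult (real n * v) (smult (real m) (hermite k v))"
        using \<open>n = Suc m\<close> 1 2 by (simp add: pderiv_mult pderiv_diff pderiv_smult pderiv_pCons algebra_simps)
      also have "\<dots> = hermite n v + smult (real n) (hermite n v)"
        using Suc \<open>n = Suc m\<close> by (simp add: smult_diff_right algebra_simps)
      also have "\<dots> = smult (real (Suc n)) (hermite n v)"
        by (simp add: smult_add_left)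
      finally show ?thesis .
    qed
  qed
qed

lemma hermite_zero: "poly (hermite n 0) x = x ^ n"
  by (induction n "0::real" rule: hermite.induct) auto

text \<open>With v = r^2 the polynomial is homogeneous of degree n in x and r, and every term except
  the leading power of x carries a factor r. The recursion for the difference refers to two indices,
  so the difference bound and the size bound are proved together.\<close>

lemma hermite_bound:
  "\<exists>C\<ge>0. \<forall>x r. 0 \<le> r \<longrightarrow>
     \<bar>poly (hermite (Suc n) (r^2)) x - x ^ Suc n\<bar> \<le> C * r * (\<bar>x\<bar> + r) ^ n \<and>
     \<bar>poly (hermite n (r^2)) x\<bar> \<le> C * (\<bar>x\<bar> + r) ^ n"
proof (induction n)
  case 0
  show ?case by (rule exI[of _ 1]) auto
next
  case (Suc n)
  then obtain C where C: "C \<ge> 0" and C1: "\<And>x r. 0 \<le> r \<Longrightarrow> \<bar>poly (hermite (Suc n) (r^2)) x - x ^ Suc n\<bar> \<le> C * r * (\<bar>x\<bar> + r) ^ n"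
    and C2: "\<And>x r. 0 \<le> r \<Longrightarrow> \<bar>poly (hermite n (r^2)) x\<bar> \<le> C * (\<bar>x\<bar> + r) ^ n"
    by blast
  define D where "D = C + real (Suc n) * C + 1"
  have "0 \<le> D" using C by (simp add: D_def)
  moreover {
    fix x r :: real assume r: "0 \<le> r"
    define s where "s = \<bar>x\<bar> + r"
    have s: "0 \<le> s" "\<bar>x\<bar> \<le> s" "r \<le> s" using r by (auto simp: s_def)
    have a: "\<bar>poly (hermite (Suc n) (r^2)) x - x ^ Suc n\<bar> \<le> C * r * s ^ n"
      using C1[OF r] by (simp add: s_def)
    have b: "\<bar>poly (hermite n (r^2)) x\<bar> \<le> C * s ^ n" using C2[OF r] by (simp add: s_def)
    have "\<bar>poly (hermite (Suc n) (r^2)) x\<bar> \<le> \<bar>poly (hermite (Suc n) (r^2)) x - x ^ Suc n\<bar> + \<bar>x ^ Suc n\<bar>"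
      by linarith
    also have "\<dots> \<le> C * s * s ^ n + s ^ Suc n"
      using a C r s by (intro add_mono order.trans[OF a] mult_right_mono mult_left_mono)
        (auto simp: power_abs abs_mult intro!: mult_mono power_mono)
    also have "\<dots> = (C + 1) * s ^ Suc n" by (simp add: algebra_simps)
    also have "\<dots> \<le> D * s ^ Suc n"
      using C s by (intro mult_right_mono) (auto simp: D_def)
    finally have 2: "\<bar>poly (hermite (Suc n) (r^2)) x\<bar> \<le> D * s ^ Suc n" .
    have "poly (hermite (Suc (Suc n)) (r^2)) x - x ^ Suc (Suc n) =
        x * (poly (hermite (Suc n) (r^2)) x - x ^ Suc n) - real (Suc n) * r^2 * poly (hermite n (r^2)) x"
      by (simp add: algebra_simps)
    also have "\<bar>\<dots>\<bar> \<le> \<bar>x\<bar> * \<bar>poly (hermite (Suc n) (r^2)) x - x ^ Suc n\<bar> + real (Suc n) * r^2 * \<bar>poly (hermite n (r^2)) x\<bar>"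
      by (rule order.trans[OF abs_triangle_ineq4]) (simp add: abs_mult)
    also have "\<dots> \<le> s * (C * r * s ^ n) + real (Suc n) * (r * s) * (C * s ^ n)"
      using a b s r C by (intro add_mono mult_mono) (auto simp: power2_eq_square intro: mult_left_mono)
    also have "\<dots> = (C + real (Suc n) * C) * r * s ^ Suc n" by (simp add: algebra_simps)
    also have "\<dots> \<le> D * r * s ^ Suc n"
      using C s r by (intro mult_right_mono) (auto simp: D_def)
    finally have "\<bar>poly (hermite (Suc (Suc n)) (r^2)) x - x ^ Suc (Suc n)\<bar> \<le> D * r * s ^ Suc n" .
    note this 2 }
  ultimately show ?case by (auto simp del: hermite.simps power_Suc intro!: exI[of _ D])
qed

text \<open>A dichotomy on r = sqrt v. If r is small relative to |x|, the error of
  \<open>hermite_bound\<close> is at most half of the even power of x and is absorbed; otherwise |x|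
  is at most r / d and the error is a multiple of v^N.\<close>

lemma power_le_hermite:
  assumes "N \<ge> 1"
  shows "\<exists>C\<ge>0. \<forall>x v. 0 \<le> v \<longrightarrow> x ^ (2 * N) \<le> 2 * poly (hermite (2 * N) v) x + C * v ^ N"
proof -
  obtain n where n: "2 * N = Suc n" using assms by (cases "2 * N") auto
  obtain C where C: "C \<ge> 0" and C1: "\<And>x r. 0 \<le> r \<Longrightarrow> \<bar>poly (hermite (Suc n) (r^2)) x - x ^ Suc n\<bar> \<le> C * r * (\<bar>x\<bar> + r) ^ n"
    using hermite_bound[of n] by blast
  \<comment> \<open>Chosen so that (C + 1) * d * 2^n = 1/2, the share that can be absorbed. Also d
    is at most 1, so r \<le> d * |x| gives |x| + r \<le> 2 * |x|.\<close>
  define d where "d = 1 / (2 * (C + 1) * 2 ^ n)"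
  have "1 \<le> 2 * (C + 1) * 2 ^ n"
    using C mult_mono[of 1 "2 * (C + 1)" 1 "2 ^ n"] by simp
  then have d: "0 < d" "d \<le> 1" using C by (auto simp: d_def)
  \<comment> \<open>From the case |x| \<le> r / d, where |x| + r \<le> r * (1/d + 1); the factor 2
    pays for the doubling when half of the power of x is moved to the left.\<close>
  define D where "D = 2 * C * (1/d + 1) ^ n"
  have D: "0 \<le> D" using C d by (auto simp: D_def)
  have "x ^ (2 * N) \<le> 2 * poly (hermite (2 * N) v) x + D * v ^ N" if v: "0 \<le> v" for x v :: real
  proof -
    define r where "r = sqrt v"
    have r: "0 \<le> r" "r^2 = v" using v by (auto simp: r_def)
    have vN: "v ^ N = r ^ Suc n" using r n by (simp add: power_mult[symmetric] flip: r(2))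
    have xx: "x ^ Suc n = \<bar>x\<bar> ^ Suc n" using n by (metis power_even_abs dvd_triv_left)
    have "C * r * (\<bar>x\<bar> + r) ^ n \<le> 1/2 * x ^ Suc n + D/2 * r ^ Suc n"
    proof (cases "r \<le> d * \<bar>x\<bar>")
      case True
      then have "r \<le> \<bar>x\<bar>" using d mult_right_mono[of d 1 "\<bar>x\<bar>"] by simp
      have "C * r * (\<bar>x\<bar> + r) ^ n \<le> (C+1) * (d * \<bar>x\<bar>) * (2 * \<bar>x\<bar>) ^ n"
        using C r d True \<open>r \<le> \<bar>x\<bar>\<close> by (intro mult_mono power_mono) auto
      also have "\<dots> = 1/2 * \<bar>x\<bar> ^ Suc n"
      proof -
        have "(C + 1) * d * 2 ^ n = 1/2" using C by (simp add: d_def)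
        moreover have "(C+1) * (d * \<bar>x\<bar>) * (2 * \<bar>x\<bar>) ^ n = ((C + 1) * d * 2 ^ n) * \<bar>x\<bar> ^ Suc n"
          by (simp add: power_mult_distrib algebra_simps)
        ultimately show ?thesis by simp
      qed
      finally show ?thesis using r D unfolding xx by (intro add_increasing2 mult_nonneg_nonneg) auto
    next
      case False
      then have "\<bar>x\<bar> \<le> r / d" using d by (simp add: field_simps)
      then have "C * r * (\<bar>x\<bar> + r) ^ n \<le> C * r * (r / d + r) ^ n"
        using C r by (intro mult_left_mono power_mono) auto
      also have "r / d + r = r * (1/d + 1)" by (simp add: field_simps)
      also have "C * r * (r * (1/d + 1)) ^ n = D/2 * r ^ Suc n"
        by (simp add: D_def power_mult_distrib)
      finally show ?thesis using xx by (simp add: add_increasing)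
    qed
    moreover have "x ^ Suc n \<le> poly (hermite (Suc n) v) x + C * r * (\<bar>x\<bar> + r) ^ n"
      using C1[OF r(1), of x] r by (auto simp: abs_le_iff)
    ultimately show ?thesis
      unfolding n vN by linarith
  qed
  then show ?thesis using D by blast
qed

section \<open>Centred Gaussian moments and variables with all moments\<close>

context prob_space begin

text \<open>The moment recursion of a centred normal variable with variance \<open>v\<close>; unlike
  a normal density it includes the degenerate case \<open>v = 0\<close>.\<close>

definition gaussian_moments :: "real \<Rightarrow> ('a \<Rightarrow> real) \<Rightarrow> bool" where
  "gaussian_moments v Z \<longleftrightarrow> Z \<in> borel_measurable M \<and>
     (\<forall>k. integrable M (\<lambda>\<omega>. Z \<omega> ^ k)) \<and>
     (\<forall>k. expectation (\<lambda>\<omega>. Z \<omega> ^ Suc k) = v * real k * expectation (\<lambda>\<omega>. Z \<omega> ^ (k - 1)))"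

lemma gaussian_moments_normal:
  assumes D: "distributed M lborel Z (normal_density 0 \<sigma>)" and \<sigma>: "\<sigma> > 0"
  shows "gaussian_moments (\<sigma>\<^sup>2) Z"
proof -
  have Z: "Z \<in> borel_measurable M" using distributed_measurable[OF D] by simp
  have i: "integrable M (\<lambda>\<omega>. Z \<omega> ^ k)" for k
    using distributed_integrable[OF D, of "\<lambda>x. x ^ k"] integrable_normal_moment[OF \<sigma>, of 0 k]
    by simp
  have e: "expectation (\<lambda>\<omega>. Z \<omega> ^ k) = (\<integral>x. normal_density 0 \<sigma> x * x ^ k \<partial>lborel)" for k
    using distributed_integral[OF D, of "\<lambda>x. x ^ k"] by simp
  have ev: "expectation (\<lambda>\<omega>. Z \<omega> ^ (2 * k)) = fact (2 * k) / ((2 / \<sigma>\<^sup>2)^k * fact k)" for k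
    using integral_normal_moment_even[OF \<sigma>, of 0 k] e by simp
  have od: "expectation (\<lambda>\<omega>. Z \<omega> ^ (2 * k + 1)) = 0" for k
    using integral_normal_moment_odd[OF \<sigma>, of 0 k] unfolding e by simp
  \<comment> \<open>The recursion links orders of the same parity. For even \<open>k\<close> both
    moments are of odd order and vanish, except that at \<open>k = 0\<close> the right side is zero
    because of the factor \<open>real k\<close>, whatever \<open>k - 1\<close> is.\<close>
  have "expectation (\<lambda>\<omega>. Z \<omega> ^ Suc k) = \<sigma>\<^sup>2 * real k * expectation (\<lambda>\<omega>. Z \<omega> ^ (k - 1))" for k
  proof (cases "even k")
    case True
    then obtain j where j: "k = 2 * j" by auto
    show ?thesis
    proof (cases j)
      case 0 then show ?thesis using od[of 0] j by simp
    next
      case (Suc i)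
      then have "k - 1 = 2 * i + 1" using j by simp
      then show ?thesis using od[of j] od[of i] j by simp
    qed
  next
    case False
    then obtain j where j: "k = 2 * j + 1" by (auto elim: oddE)
    then have s: "Suc k = 2 * Suc j" "k - 1 = 2 * j" by auto
    have "(2 / \<sigma>\<^sup>2) ^ j > 0" using \<sigma> by simp
    then show ?thesis unfolding s ev using \<sigma> j
      by (simp add: divide_simps power2_eq_square del: power_divide)
  qed
  with Z i show ?thesis by (auto simp: gaussian_moments_def)
qed

text \<open>Gaussian integration by parts (Stein's identity). The moment recursion is its monomial
  case, and both sides are linear in \<open>p\<close>.\<close>

lemma gaussian_moments_poly:
  assumes "gaussian_moments v Z"
  shows "integrable M (\<lambda>\<omega>. poly p (Z \<omega>))"
    and "expectation (\<lambda>\<omega>. Z \<omega> * poly p (Z \<omega>)) = v * expectation (\<lambda>\<omega>. poly (pderiv p) (Z \<omega>))"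
proof -
  have Z[measurable]: "Z \<in> borel_measurable M"
    and i: "\<And>k. integrable M (\<lambda>\<omega>. Z \<omega> ^ k)"
    and e: "\<And>k. expectation (\<lambda>\<omega>. Z \<omega> ^ Suc k) = v * real k * expectation (\<lambda>\<omega>. Z \<omega> ^ (k - 1))"
    using assms by (auto simp: gaussian_moments_def)
  show ip: "integrable M (\<lambda>\<omega>. poly p (Z \<omega>))" for p
    by (auto simp: poly_altdef intro!: i)
  have s: "(\<Sum>k\<le>degree p. monom (coeff p k) k) = p" by (rule poly_as_sum_of_monoms)
  have "expectation (\<lambda>\<omega>. Z \<omega> * poly p (Z \<omega>)) = (\<Sum>k\<le>degree p. coeff p k * expectation (\<lambda>\<omega>. Z \<omega> ^ Suc k))"
  proof -
    have "expectation (\<lambda>\<omega>. Z \<omega> * poly p (Z \<omega>)) = expectation (\<lambda>\<omega>. \<Sum>k\<le>degree p. coeff p k * Z \<omega> ^ Suc k)"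
      by (simp add: poly_altdef sum_distrib_left ac_simps)
    also have "\<dots> = (\<Sum>k\<le>degree p. expectation (\<lambda>\<omega>. coeff p k * Z \<omega> ^ Suc k))"
      by (intro Bochner_Integration.integral_sum integrable_mult_right i)
    finally show ?thesis by (simp del: power_Suc)
  qed
  also have "\<dots> = (\<Sum>k\<le>degree p. v * expectation (\<lambda>\<omega>. poly (pderiv (monom (coeff p k) k)) (Z \<omega>)))"
    by (intro sum.cong refl) (subst e, simp add: pderiv_monom poly_monom)
  also have "\<dots> = v * expectation (\<lambda>\<omega>. \<Sum>k\<le>degree p. poly (pderiv (monom (coeff p k) k)) (Z \<omega>))"
    by (subst Bochner_Integration.integral_sum) (auto simp: sum_distrib_left intro!: ip)
  also have "(\<lambda>\<omega>. \<Sum>k\<le>degree p. poly (pderiv (monom (coeff p k) k)) (Z \<omega>)) = (\<lambda>\<omega>. poly (pderiv p) (Z \<omega>))"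
  proof -
    have "pderiv (\<Sum>k\<in>A. q k) = (\<Sum>k\<in>A. pderiv (q k))" if "finite A" for A and q :: "nat \<Rightarrow> real poly"
      using that by induction (auto simp: pderiv_add)
    from this[of "{..degree p}" "\<lambda>k. monom (coeff p k) k"] show ?thesis
      unfolding s by (simp add: poly_sum)
  qed
  finally show "expectation (\<lambda>\<omega>. Z \<omega> * poly p (Z \<omega>)) = v * expectation (\<lambda>\<omega>. poly (pderiv p) (Z \<omega>))" .
qed

text \<open>One step of the martingale property: averaging over a Gaussian of variance
  \<open>v\<close> is the heat flow, which lowers the variance parameter by \<open>v\<close>. In the
  recursion, integration by parts and \<open>pderiv_hermite\<close> turn the factor \<open>Z\<close>
  into a term that cancels the \<open>v\<close> in \<open>a + v\<close>.\<close>

lemma expectation_hermite: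
  assumes "gaussian_moments v Z"
  shows "expectation (\<lambda>\<omega>. poly (hermite n (a + v)) (x + Z \<omega>)) = poly (hermite n a) x"
proof (induction n rule: less_induct)
  case (less n)
  have sh: "poly p (x + z) = poly (p \<circ>\<^sub>p [:x, 1:]) z" for p z by (simp add: poly_pcompose)
  have int: "integrable M (\<lambda>\<omega>. poly p (x + Z \<omega>))" for p
    unfolding sh by (rule gaussian_moments_poly(1)[OF assms])
  have ibp: "expectation (\<lambda>\<omega>. Z \<omega> * poly p (x + Z \<omega>)) = v * expectation (\<lambda>\<omega>. poly (pderiv p) (x + Z \<omega>))" for p
    unfolding sh by (subst gaussian_moments_poly(2)[OF assms]) (simp add: pderiv_pcompose pderiv_pCons)
  have int': "integrable M (\<lambda>\<omega>. Z \<omega> * poly p (x + Z \<omega>))" for p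
    using gaussian_moments_poly(1)[OF assms, of "[:0,1:] * (p \<circ>\<^sub>p [:x, 1:])"] by (simp add: sh)
  consider "n = 0" | "n = 1" | k where "n = Suc (Suc k)"
    by (metis One_nat_def not0_implies_Suc)
  then show ?case
  proof cases
    case 1 then show ?thesis by (simp add: prob_space)
  next
    case 2 then show ?thesis using ibp[of 1] int'[of 1] by (simp add: prob_space)
  next
    case 3
    let ?h = "\<lambda>n. hermite n (a + v)"
    have IH: "expectation (\<lambda>\<omega>. poly (?h (Suc k)) (x + Z \<omega>)) = poly (hermite (Suc k) a) x"
      "expectation (\<lambda>\<omega>. poly (?h k) (x + Z \<omega>)) = poly (hermite k a) x"
      using less 3 by auto
    have "expectation (\<lambda>\<omega>. poly (?h n) (x + Z \<omega>)) =
       expectation (\<lambda>\<omega>. x * poly (?h (Suc k)) (x + Z \<omega>) + Z \<omega> * poly (?h (Suc k)) (x + Z \<omega>)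
          - real (Suc k) * (a + v) * poly (?h k) (x + Z \<omega>))"
      using 3 by (intro Bochner_Integration.integral_cong) (auto simp: algebra_simps)
    also have "\<dots> = x * poly (hermite (Suc k) a) x + v * expectation (\<lambda>\<omega>. poly (pderiv (?h (Suc k))) (x + Z \<omega>))
       - real (Suc k) * (a + v) * poly (hermite k a) x"
      by (subst Bochner_Integration.integral_diff Bochner_Integration.integral_add;
          (intro Bochner_Integration.integrable_add Bochner_Integration.integrable_mult_right int int')?)+
         (simp add: IH ibp)
    also have "\<dots> = x * poly (hermite (Suc k) a) x + v * (real (Suc k) * poly (hermite k a) x)
       - real (Suc k) * (a + v) * poly (hermite k a) x"
      by (subst pderiv_hermite) (simp add: IH)
    also have "\<dots> = poly (hermite n a) x" using 3 by (simp add: algebra_simps)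
    finally show ?thesis .
  qed
qed

text \<open>Closed under domination, sums and products. Hence integrability of a Hermite polynomial
  whose variance parameter is random as well needs no separate estimate.\<close>

definition all_moments :: "('a \<Rightarrow> real) \<Rightarrow> bool" where
  "all_moments f \<longleftrightarrow> f \<in> borel_measurable M \<and> (\<forall>k. integrable M (\<lambda>\<omega>. \<bar>f \<omega>\<bar> ^ k))"

lemma all_moments_bound:
  assumes "g \<in> borel_measurable M" "all_moments f" "\<And>\<omega>. \<omega> \<in> space M \<Longrightarrow> \<bar>g \<omega>\<bar> \<le> C * \<bar>f \<omega>\<bar>"
  shows "all_moments g"
  unfolding all_moments_def
proof safe
  fix k
  show "integrable M (\<lambda>\<omega>. \<bar>g \<omega>\<bar> ^ k)"
  proof (rule Bochner_Integration.integrable_bound)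
    show "integrable M (\<lambda>\<omega>. \<bar>C\<bar> ^ k * \<bar>f \<omega>\<bar> ^ k)"
      using assms by (auto simp: all_moments_def)
    show "AE \<omega> in M. norm (\<bar>g \<omega>\<bar> ^ k) \<le> norm (\<bar>C\<bar> ^ k * \<bar>f \<omega>\<bar> ^ k)"
    proof (rule AE_I2)
      fix \<omega> assume "\<omega> \<in> space M"
      then have "\<bar>g \<omega>\<bar> \<le> \<bar>C\<bar> * \<bar>f \<omega>\<bar>"
        using assms(3)[of \<omega>] mult_right_mono[OF abs_ge_self[of C], of "\<bar>f \<omega>\<bar>"] by linarith
      then show "norm (\<bar>g \<omega>\<bar> ^ k) \<le> norm (\<bar>C\<bar> ^ k * \<bar>f \<omega>\<bar> ^ k)"
        using power_mono[of "\<bar>g \<omega>\<bar>" "\<bar>C\<bar> * \<bar>f \<omega>\<bar>" k] by (simp add: power_mult_distrib)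
    qed
  qed (use assms in measurable)
qed (use assms in auto)

lemma all_moments_const: "all_moments (\<lambda>\<omega>. c)"
  by (auto simp: all_moments_def)

lemma all_moments_integrable:
  assumes "all_moments f" shows "integrable M f"
proof -
  have "integrable M (\<lambda>\<omega>. \<bar>f \<omega>\<bar>)" "f \<in> borel_measurable M"
    using assms by (auto simp: all_moments_def dest: spec[of _ 1])
  then show ?thesis by (simp add: integrable_abs_iff)
qed

lemma all_moments_add:
  assumes "all_moments f" "all_moments g" shows "all_moments (\<lambda>\<omega>. f \<omega> + g \<omega>)"
  unfolding all_moments_def
proof safe
  have [measurable]: "f \<in> borel_measurable M" "g \<in> borel_measurable M"
    using assms by (auto simp: all_moments_def)
  show "(\<lambda>\<omega>. f \<omega> + g \<omega>) \<in> borel_measurable M" by measurable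
  fix k
  show "integrable M (\<lambda>\<omega>. \<bar>f \<omega> + g \<omega>\<bar> ^ k)"
  proof (rule Bochner_Integration.integrable_bound)
    show "integrable M (\<lambda>\<omega>. 2 ^ k * \<bar>f \<omega>\<bar> ^ k + 2 ^ k * \<bar>g \<omega>\<bar> ^ k)"
      using assms by (auto simp: all_moments_def)
    have "norm (\<bar>f \<omega> + g \<omega>\<bar> ^ k) \<le> norm (2 ^ k * \<bar>f \<omega>\<bar> ^ k + 2 ^ k * \<bar>g \<omega>\<bar> ^ k)" for \<omega>
    proof -
      have "\<bar>f \<omega> + g \<omega>\<bar> ^ k \<le> (2 * max \<bar>f \<omega>\<bar> \<bar>g \<omega>\<bar>) ^ k" by (intro power_mono) auto
      also have "\<dots> \<le> 2 ^ k * \<bar>f \<omega>\<bar> ^ k + 2 ^ k * \<bar>g \<omega>\<bar> ^ k"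
        by (cases "\<bar>f \<omega>\<bar> \<le> \<bar>g \<omega>\<bar>") (auto simp: power_mult_distrib max_def)
      finally show ?thesis by simp
    qed
    then show "AE \<omega> in M. norm (\<bar>f \<omega> + g \<omega>\<bar> ^ k) \<le> norm (2 ^ k * \<bar>f \<omega>\<bar> ^ k + 2 ^ k * \<bar>g \<omega>\<bar> ^ k)"
      by simp
  qed measurable
qed

lemma all_moments_mult:
  assumes "all_moments f" "all_moments g" shows "all_moments (\<lambda>\<omega>. f \<omega> * g \<omega>)"
  unfolding all_moments_def
proof safe
  have [measurable]: "f \<in> borel_measurable M" "g \<in> borel_measurable M"
    using assms by (auto simp: all_moments_def)
  show "(\<lambda>\<omega>. f \<omega> * g \<omega>) \<in> borel_measurable M" by measurable
  fix k
  show "integrable M (\<lambda>\<omega>. \<bar>f \<omega> * g \<omega>\<bar> ^ k)"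
  proof (rule Bochner_Integration.integrable_bound)
    show "integrable M (\<lambda>\<omega>. \<bar>f \<omega>\<bar> ^ (2 * k) + \<bar>g \<omega>\<bar> ^ (2 * k))"
      using assms unfolding all_moments_def by (intro Bochner_Integration.integrable_add) blast+
    have "norm (\<bar>f \<omega> * g \<omega>\<bar> ^ k) \<le> norm (\<bar>f \<omega>\<bar> ^ (2 * k) + \<bar>g \<omega>\<bar> ^ (2 * k))" for \<omega>
    proof -
      have "2 * (\<bar>f \<omega>\<bar> ^ k * \<bar>g \<omega>\<bar> ^ k) \<le> (\<bar>f \<omega>\<bar> ^ k)^2 + (\<bar>g \<omega>\<bar> ^ k)^2"
        using sum_squares_bound[of "\<bar>f \<omega>\<bar> ^ k" "\<bar>g \<omega>\<bar> ^ k"] by (simp add: algebra_simps)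
      moreover have "0 \<le> \<bar>f \<omega>\<bar> ^ k * \<bar>g \<omega>\<bar> ^ k" by simp
      ultimately have "\<bar>f \<omega>\<bar> ^ k * \<bar>g \<omega>\<bar> ^ k \<le> (\<bar>f \<omega>\<bar> ^ k)^2 + (\<bar>g \<omega>\<bar> ^ k)^2" by linarith
      then show ?thesis
        by (simp add: abs_mult power_mult_distrib mult.commute[of 2 k] power_mult)
    qed
    then show "AE \<omega> in M. norm (\<bar>f \<omega> * g \<omega>\<bar> ^ k) \<le> norm (\<bar>f \<omega>\<bar> ^ (2 * k) + \<bar>g \<omega>\<bar> ^ (2 * k))"
      by simp
  qed measurable
qed

lemma all_moments_hermite:
  assumes "all_moments X" "all_moments V"
  shows "all_moments (\<lambda>\<omega>. poly (hermite n (V \<omega>)) (X \<omega>))"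
proof (induction n rule: less_induct)
  case (less n)
  consider "n = 0" | "n = 1" | k where "n = Suc (Suc k)"
    by (metis One_nat_def not0_implies_Suc)
  then show ?case
  proof cases
    case 3
    have "all_moments (\<lambda>\<omega>. X \<omega> * poly (hermite (Suc k) (V \<omega>)) (X \<omega>) +
        (- real (Suc k)) * (V \<omega> * poly (hermite k (V \<omega>)) (X \<omega>)))"
      using 3 less by (intro all_moments_add all_moments_mult all_moments_const assms) auto
    then show ?thesis using 3 by (simp add: algebra_simps)
  qed (use assms in \<open>auto simp: all_moments_const\<close>)
qed

end

section \<open>Integrals of simple processes\<close>

lemma grid_mono:
  fixes u :: "nat \<Rightarrow> real"
  assumes u: "\<And>i. i < n \<Longrightarrow> u i \<le> u (Suc i)" and "j \<le> n" "i \<le> j"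
  shows "u i \<le> u j"
  using assms(3,2)
proof (induction j rule: dec_induct)
  case (step m)
  then show ?case using u[of m] by simp
qed simp

lemma borel_measurable_vec_nth:
  fixes f :: "'z \<Rightarrow> 'b :: {second_countable_topology, topological_space} ^ 'n"
  assumes "f \<in> borel_measurable N" shows "(\<lambda>x. f x $ a) \<in> borel_measurable N"
  by (rule borel_measurable_continuous_on[OF _ assms]) (intro continuous_intros)

locale wiener_space = prob_space M for M :: "'a measure" +
  fixes F :: "real \<Rightarrow> 'a measure" and W :: "real \<Rightarrow> 'a \<Rightarrow> real ^ 'r"
  assumes filtration: "complete_filtered_prob_space M F"
    and wiener: "wiener_process M F W"
begin

lemma complete: "complete_measure M"
  using filtration by (simp add: complete_filtered_prob_space_def)

lemma subalgebra_F: "\<forall>t\<ge>0. subalgebra M (F t)"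
  using filtration unfolding complete_filtered_prob_space_def by (elim conjE)

lemma space_F: "0 \<le> t \<Longrightarrow> space (F t) = space M"
  and sets_F: "0 \<le> t \<Longrightarrow> sets (F t) \<subseteq> sets M"
  using subalgebra_F by (auto simp: subalgebra_def)

lemma sets_F_mono: "0 \<le> s \<Longrightarrow> s \<le> t \<Longrightarrow> sets (F s) \<subseteq> sets (F t)"
proof -
  have "\<forall>s t. 0 \<le> s \<and> s \<le> t \<longrightarrow> sets (F s) \<subseteq> sets (F t)"
    using filtration unfolding complete_filtered_prob_space_def by (elim conjE)
  then show "0 \<le> s \<Longrightarrow> s \<le> t \<Longrightarrow> sets (F s) \<subseteq> sets (F t)" by blast
qed

lemma F_measurable: "0 \<le> t \<Longrightarrow> f \<in> measurable (F t) N \<Longrightarrow> f \<in> measurable M N"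
  using sets_F[of t] space_F[of t] by (auto simp: measurable_def)

lemma F_mono: "0 \<le> s \<Longrightarrow> s \<le> t \<Longrightarrow> f \<in> measurable (F s) N \<Longrightarrow> f \<in> measurable (F t) N"
  using sets_F_mono[of s t] space_F[of s] space_F[of t] by (auto simp: measurable_def)

lemma W_measurable_F: "0 \<le> t \<Longrightarrow> W t \<in> borel_measurable (F t)"
  using wiener by (simp add: wiener_process_def)

lemma W_measurable: "0 \<le> t \<Longrightarrow> W t \<in> borel_measurable M"
  by (rule F_measurable[OF _ W_measurable_F])

section \<open>Wiener increments and the Hermite martingale\<close>

lemma increment_gaussian_moments:
  assumes st: "0 \<le> s" "s \<le> t"
  shows "gaussian_moments ((norm a)\<^sup>2 * (t - s)) (\<lambda>\<omega>. a \<bullet> (W t \<omega> - W s \<omega>))"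
proof (cases "a = 0 \<or> s = t")
  case True
  then show ?thesis by (auto simp: gaussian_moments_def prob_space power_0_left)
next
  case False
  then have "s < t" "a \<noteq> 0" using st by auto
  let ?\<Delta> = "\<lambda>i \<omega>. (W t \<omega> - W s \<omega>) $ i"
  have iv: "indep_vars (\<lambda>_. borel) ?\<Delta> UNIV"
    and d: "\<And>i. distributed M lborel (?\<Delta> i) (normal_density 0 (sqrt (t - s)))"
    using wiener st \<open>s < t\<close> by (auto simp: wiener_process_def)
  \<comment> \<open>Coordinates with coefficient 0 would be degenerate normals without a density, so
    the sum of independent normals runs over the others only; the case without such coordinates, or
    with \<open>s = t\<close>, is already settled.\<close>
  define I where "I = {i. a $ i \<noteq> 0}"
  have I: "finite I" "I \<noteq> {}" using \<open>a \<noteq> 0\<close> by (auto simp: I_def vec_eq_iff)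
  have 1: "indep_vars (\<lambda>_. borel) (\<lambda>i \<omega>. a $ i * ?\<Delta> i \<omega>) I"
    by (rule indep_vars_compose2[where M'="\<lambda>_. borel", OF indep_vars_subset[OF iv]]) auto
  have 2: "distributed M lborel (\<lambda>\<omega>. a $ i * ?\<Delta> i \<omega>) (normal_density 0 (\<bar>a $ i\<bar> * sqrt (t - s)))" if "i \<in> I" for i
    using normal_density_affine[OF d[of i], of "a $ i" 0] that \<open>s < t\<close> by (simp add: I_def)
  have 3: "distributed M lborel (\<lambda>\<omega>. \<Sum>i\<in>I. a $ i * ?\<Delta> i \<omega>)
      (normal_density (\<Sum>i\<in>I. 0) (sqrt (\<Sum>i\<in>I. (\<bar>a $ i\<bar> * sqrt (t - s))\<^sup>2)))"
    using I \<open>s < t\<close> by (intro sum_indep_normal 1 2) (auto simp: I_def)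
  have 4: "(\<Sum>i\<in>I. (\<bar>a $ i\<bar> * sqrt (t - s))\<^sup>2) = (norm a)\<^sup>2 * (t - s)"
  proof -
    have "(\<Sum>i\<in>I. (\<bar>a $ i\<bar> * sqrt (t - s))\<^sup>2) = (\<Sum>i\<in>UNIV. (\<bar>a $ i\<bar> * sqrt (t - s))\<^sup>2)"
      by (rule sum.mono_neutral_left) (auto simp: I_def)
    also have "\<dots> = (\<Sum>i\<in>UNIV. (a $ i)\<^sup>2) * (t - s)"
      using \<open>s < t\<close> by (simp add: sum_distrib_right power_mult_distrib)
    also have "(\<Sum>i\<in>UNIV. (a $ i)\<^sup>2) = (norm a)\<^sup>2"
      by (simp add: norm_vec_def L2_set_def sum_nonneg)
    finally show ?thesis .
  qed
  have 5: "(\<Sum>i\<in>I. a $ i * ?\<Delta> i \<omega>) = a \<bullet> (W t \<omega> - W s \<omega>)" for \<omega>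
    unfolding inner_vec_def inner_real_def by (rule sum.mono_neutral_left) (auto simp: I_def)
  have pos: "0 < (norm a)\<^sup>2 * (t - s)" using \<open>s < t\<close> \<open>a \<noteq> 0\<close> by simp
  have "distributed M lborel (\<lambda>\<omega>. a \<bullet> (W t \<omega> - W s \<omega>)) (normal_density 0 (sqrt ((norm a)\<^sup>2 * (t - s))))"
    using 3 unfolding 4 5 by simp
  from gaussian_moments_normal[OF this] pos show ?thesis by simp
qed

text \<open>The freezing lemma: past and increment are independent, so their joint law is a product
  and Fubini allows the increment to be averaged with the past held fixed. It takes the place of a
  conditional expectation given \<open>F s\<close>.\<close>

lemma expectation_increment:
  assumes st: "0 \<le> s" "s < t"
    and f: "f \<in> borel_measurable (F s \<Otimes>\<^sub>M borel)"
    and int: "integrable M (\<lambda>\<omega>. f (\<omega>, W t \<omega> - W s \<omega>) :: real)"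
  shows "expectation (\<lambda>\<omega>. f (\<omega>, W t \<omega> - W s \<omega>)) =
     expectation (\<lambda>\<omega>. expectation (\<lambda>\<omega>'. f (\<omega>, W t \<omega>' - W s \<omega>')))"
proof -
  let ?\<Delta> = "\<lambda>\<omega>. W t \<omega> - W s \<omega>"
  have [measurable]: "?\<Delta> \<in> borel_measurable M"
    using st by (intro borel_measurable_diff W_measurable) auto
  \<comment> \<open>The identity into the coarser space \<open>F s\<close> is the random variable
    that represents the entire past; its joint law with the increment is computed below.\<close>
  have id: "(\<lambda>\<omega>. \<omega>) \<in> measurable M (F s)"
    using sets_F[of s] space_F[of s] sets.sets_into_space st by (auto simp: measurable_def Int_absorb2)
  note id[measurable] f[measurable]
  have ind: "indep_set (sets (F s)) (sets (vimage_algebra (space M) ?\<Delta> borel))"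
    using wiener st by (auto simp: wiener_process_def)
  interpret P1: prob_space "distr M (F s) (\<lambda>\<omega>. \<omega>)" by (rule prob_space_distr) measurable
  interpret P2: prob_space "distr M borel ?\<Delta>" by (rule prob_space_distr) measurable
  have eq: "distr M (F s) (\<lambda>\<omega>. \<omega>) \<Otimes>\<^sub>M distr M borel ?\<Delta> = distr M (F s \<Otimes>\<^sub>M borel) (\<lambda>\<omega>. (\<omega>, ?\<Delta> \<omega>))"
  proof (rule pair_measure_eqI)
    fix A and B :: "(real ^ 'r) set"
    assume "A \<in> sets (distr M (F s) (\<lambda>\<omega>. \<omega>))" "B \<in> sets (distr M borel ?\<Delta>)"
    then have A: "A \<in> sets (F s)" and B: "B \<in> sets borel" by auto
    then have [measurable]: "A \<in> sets M" using sets_F[OF st(1)] by auto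
    have Asp: "A \<subseteq> space M" using sets.sets_into_space[OF A] space_F[OF st(1)] by simp
    have "prob (A \<inter> (?\<Delta> -` B \<inter> space M)) = prob A * prob (?\<Delta> -` B \<inter> space M)"
      by (rule indep_setD[OF ind A]) (use B in \<open>auto simp: sets_vimage_algebra intro!: sigma_sets.Basic\<close>)
    moreover have "(\<lambda>\<omega>. (\<omega>, ?\<Delta> \<omega>)) -` (A \<times> B) \<inter> space M = A \<inter> (?\<Delta> -` B \<inter> space M)"
      "(\<lambda>\<omega>. \<omega>) -` A \<inter> space M = A" using Asp by auto
    ultimately show "emeasure (distr M (F s) (\<lambda>\<omega>. \<omega>)) A * emeasure (distr M borel ?\<Delta>) B =
        emeasure (distr M (F s \<Otimes>\<^sub>M borel) (\<lambda>\<omega>. (\<omega>, ?\<Delta> \<omega>))) (A \<times> B)"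
      using A B by (simp add: emeasure_distr emeasure_eq_measure ennreal_mult[symmetric])
  qed (auto intro: P1.sigma_finite_measure_axioms P2.sigma_finite_measure_axioms cong: sets_pair_measure_cong)
  interpret P: pair_prob_space "distr M (F s) (\<lambda>\<omega>. \<omega>)" "distr M borel ?\<Delta>" ..
  have int': "integrable (distr M (F s) (\<lambda>\<omega>. \<omega>) \<Otimes>\<^sub>M distr M borel ?\<Delta>) f"
    unfolding eq using int by (subst integrable_distr_eq) auto
  have "expectation (\<lambda>\<omega>. f (\<omega>, ?\<Delta> \<omega>)) = integral\<^sup>L (distr M (F s \<Otimes>\<^sub>M borel) (\<lambda>\<omega>. (\<omega>, ?\<Delta> \<omega>))) f"
    by (subst integral_distr) auto
  also have "\<dots> = (\<integral>x. (\<integral>y. f (x, y) \<partial>distr M borel ?\<Delta>) \<partial>distr M (F s) (\<lambda>\<omega>. \<omega>))"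
    unfolding eq[symmetric] using P.integral_fst'[OF int'] by simp
  also have "\<dots> = expectation (\<lambda>\<omega>. \<integral>y. f (\<omega>, y) \<partial>distr M borel ?\<Delta>)"
    by (subst integral_distr) (auto intro!: P2.borel_measurable_lebesgue_integral)
  also have "\<dots> = expectation (\<lambda>\<omega>. expectation (\<lambda>\<omega>'. f (\<omega>, ?\<Delta> \<omega>')))"
  proof (intro Bochner_Integration.integral_cong refl)
    fix \<omega> assume "\<omega> \<in> space M"
    then have [measurable]: "\<omega> \<in> space (F s)" using space_F[of s] st by simp
    show "(\<integral>y. f (\<omega>, y) \<partial>distr M borel ?\<Delta>) = expectation (\<lambda>\<omega>'. f (\<omega>, ?\<Delta> \<omega>'))"
      by (subst integral_distr) auto
  qed
  finally show ?thesis .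
qed

lemma increment_all_moments:
  assumes "0 \<le> s" "s \<le> t"
  shows "all_moments (\<lambda>\<omega>. norm (W t \<omega> - W s \<omega>))"
proof -
  have [measurable]: "(\<lambda>\<omega>. W t \<omega> - W s \<omega>) \<in> borel_measurable M"
    using assms by (intro borel_measurable_diff W_measurable) auto
  have 1: "all_moments (\<lambda>\<omega>. \<bar>axis i 1 \<bullet> (W t \<omega> - W s \<omega>)\<bar>)" for i
  proof -
    have "gaussian_moments ((norm (axis i 1 :: real ^ 'r))\<^sup>2 * (t - s)) (\<lambda>\<omega>. axis i 1 \<bullet> (W t \<omega> - W s \<omega>))"
      by (rule increment_gaussian_moments[OF assms])
    then show ?thesis
      by (auto simp: gaussian_moments_def all_moments_def power_abs[symmetric] intro: integrable_abs)
  qed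
  have "all_moments (\<lambda>\<omega>. \<Sum>i\<in>I. \<bar>axis i 1 \<bullet> (W t \<omega> - W s \<omega>)\<bar>)" if "finite I" for I :: "'r set"
    using that by (induction I) (auto simp: all_moments_const intro!: all_moments_add 1)
  from this[of UNIV] show ?thesis
    by (rule all_moments_bound[where C=1, rotated])
       (auto simp: inner_axis' abs_of_nonneg[OF sum_nonneg] intro: order.trans[OF norm_le_l1_cart])
qed

text \<open>\<open>X\<close> is a discrete stochastic integral and \<open>V\<close> its quadratic
  variation, so the Hermite polynomial of the pair is a martingale in the step number. All its
  values therefore have the mean of the initial one, at which \<open>X\<close> and \<open>V\<close>
  are zero.\<close>

lemma hermite_martingale:
  fixes \<eta> :: "nat \<Rightarrow> 'a \<Rightarrow> real ^ 'r"
  assumes u: "0 \<le> u 0" "\<And>i. i < n \<Longrightarrow> u i \<le> u (Suc i)"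
    and \<eta>: "\<And>i. i < n \<Longrightarrow> \<eta> i \<in> borel_measurable (F (u i))" "\<And>i. i < n \<Longrightarrow> bounded (\<eta> i ` space M)"
  defines "X \<equiv> \<lambda>m \<omega>. \<Sum>i<m. \<eta> i \<omega> \<bullet> (W (u (Suc i)) \<omega> - W (u i) \<omega>)"
  defines "V \<equiv> \<lambda>m \<omega>. \<Sum>i<m. (norm (\<eta> i \<omega>))\<^sup>2 * (u (Suc i) - u i)"
  shows "m \<le> n \<Longrightarrow> expectation (\<lambda>\<omega>. poly (hermite k (V m \<omega>)) (X m \<omega>)) = poly (hermite k 0) 0"
    and "m \<le> n \<Longrightarrow> all_moments (X m)" "m \<le> n \<Longrightarrow> all_moments (V m)"
    and "m \<le> n \<Longrightarrow> all_moments (\<lambda>\<omega>. poly (hermite k (V m \<omega>)) (X m \<omega>))"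
proof -
  have u0: "i \<le> n \<Longrightarrow> 0 \<le> u i" for i
    using grid_mono[of n u i 0] u by force
  have \<eta>b: "\<exists>C. \<forall>\<omega>\<in>space M. norm (\<eta> i \<omega>) \<le> C" if "i < n" for i
    using \<eta>(2)[OF that] by (auto simp: bounded_iff)
  have aX: "all_moments (\<lambda>\<omega>. \<eta> i \<omega> \<bullet> (W (u (Suc i)) \<omega> - W (u i) \<omega>))" if i: "i < n" for i
  proof -
    obtain C where C: "\<And>\<omega>. \<omega> \<in> space M \<Longrightarrow> norm (\<eta> i \<omega>) \<le> C" using \<eta>b[OF i] by auto
    have [measurable]: "\<eta> i \<in> borel_measurable M" "W (u (Suc i)) \<in> borel_measurable M" "W (u i) \<in> borel_measurable M"
      using \<eta>(1)[OF i] u0[of i] u0[of "Suc i"] i by (auto intro: F_measurable W_measurable)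
    show ?thesis
    proof (rule all_moments_bound[OF _ increment_all_moments])
      fix \<omega> assume "\<omega> \<in> space M"
      show "\<bar>\<eta> i \<omega> \<bullet> (W (u (Suc i)) \<omega> - W (u i) \<omega>)\<bar> \<le> C * \<bar>norm (W (u (Suc i)) \<omega> - W (u i) \<omega>)\<bar>"
        using mult_right_mono[OF C[OF \<open>\<omega> \<in> space M\<close>], of "norm (W (u (Suc i)) \<omega> - W (u i) \<omega>)"]
          Cauchy_Schwarz_ineq2[of "\<eta> i \<omega>" "W (u (Suc i)) \<omega> - W (u i) \<omega>"]
        by simp
    qed (use u u0 i in auto)
  qed
  have aV: "all_moments (\<lambda>\<omega>. (norm (\<eta> i \<omega>))\<^sup>2 * (u (Suc i) - u i))" if i: "i < n" for i
  proof -
    obtain C where C: "\<And>\<omega>. \<omega> \<in> space M \<Longrightarrow> norm (\<eta> i \<omega>) \<le> C" using \<eta>b[OF i] by auto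
    have [measurable]: "\<eta> i \<in> borel_measurable M"
      using \<eta>(1)[OF i] u0[of i] i by (auto intro: F_measurable)
    show ?thesis
      by (rule all_moments_bound[OF _ all_moments_const[of "C\<^sup>2 * \<bar>u (Suc i) - u i\<bar>"], where C=1])
         (auto simp: abs_mult intro!: mult_right_mono power_mono C)
  qed
  have X: "all_moments (X m)" if "m \<le> n" for m
    using that
  proof (induction m)
    case (Suc m)
    then show ?case using all_moments_add[OF _ aX, of "X m" m] by (auto simp: X_def)
  qed (simp add: X_def all_moments_const)
  have V: "all_moments (V m)" if "m \<le> n" for m
    using that
  proof (induction m)
    case (Suc m)
    then show ?case using all_moments_add[OF _ aV, of "V m" m] by (auto simp: V_def)
  qed (simp add: V_def all_moments_const)
  show "m \<le> n \<Longrightarrow> all_moments (X m)" "m \<le> n \<Longrightarrow> all_moments (V m)" by fact+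
  have H: "m \<le> n \<Longrightarrow> all_moments (\<lambda>\<omega>. poly (hermite k (V m \<omega>)) (X m \<omega>))" for m
    by (intro all_moments_hermite X V)
  then show "m \<le> n \<Longrightarrow> all_moments (\<lambda>\<omega>. poly (hermite k (V m \<omega>)) (X m \<omega>))" .
  show "m \<le> n \<Longrightarrow> expectation (\<lambda>\<omega>. poly (hermite k (V m \<omega>)) (X m \<omega>)) = poly (hermite k 0) 0"
  proof (induction m)
    case 0
    then show ?case by (simp add: X_def V_def prob_space)
  next
    case (Suc m)
    then have m: "m < n" "u m \<le> u (Suc m)" "0 \<le> u m" using u u0 by auto
    show ?case
    proof (cases "u m = u (Suc m)")
      case True
      then have "X (Suc m) = X m" "V (Suc m) = V m" by (auto simp: X_def V_def)
      then show ?thesis using Suc by simp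
    next
      case False
      let ?\<delta> = "u (Suc m) - u m"
      have ui: "0 \<le> u i" "u i \<le> u m" if "i \<le> m" for i
      proof -
        show "0 \<le> u i" using u0 that m by auto
        show "u i \<le> u m" using grid_mono[of n u m i] u m that by auto
      qed
      have [measurable]: "\<eta> i \<in> borel_measurable (F (u m))" "W (u i) \<in> borel_measurable (F (u m))" if "i \<le> m" for i
        using that ui[OF that] m by (auto intro!: F_mono[OF _ _ \<eta>(1)] F_mono[OF _ _ W_measurable_F])
      have [measurable]: "X m \<in> borel_measurable (F (u m))" "V m \<in> borel_measurable (F (u m))"
        unfolding X_def V_def by measurable
      have hm: "(\<lambda>x. poly (hermite k (f x)) (g x)) \<in> borel_measurable N"
        if [measurable]: "f \<in> borel_measurable N" "g \<in> borel_measurable N" for f g k and N :: "'z measure"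
      proof (induction k rule: less_induct)
        case (less k)
        consider "k = 0" | "k = 1" | j where "k = Suc (Suc j)"
          by (metis One_nat_def not0_implies_Suc)
        then show ?case
        proof cases
          case 3
          have [measurable]: "(\<lambda>x. poly (hermite (Suc j) (f x)) (g x)) \<in> borel_measurable N"
            "(\<lambda>x. poly (hermite j (f x)) (g x)) \<in> borel_measurable N" using less 3 by auto
          show ?thesis unfolding 3 by simp
        qed auto
      qed
      let ?f = "\<lambda>(\<omega>, w). poly (hermite k (V m \<omega> + (norm (\<eta> m \<omega>))\<^sup>2 * ?\<delta>)) (X m \<omega> + \<eta> m \<omega> \<bullet> w)"
      have f: "?f \<in> borel_measurable (F (u m) \<Otimes>\<^sub>M borel)"
        unfolding split_beta' by (rule hm) measurable
      have XV: "poly (hermite k (V (Suc m) \<omega>)) (X (Suc m) \<omega>) = ?f (\<omega>, W (u (Suc m)) \<omega> - W (u m) \<omega>)" for \<omega>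
        by (simp add: X_def V_def)
      have "expectation (\<lambda>\<omega>. poly (hermite k (V (Suc m) \<omega>)) (X (Suc m) \<omega>)) =
         expectation (\<lambda>\<omega>. expectation (\<lambda>\<omega>'. ?f (\<omega>, W (u (Suc m)) \<omega>' - W (u m) \<omega>')))"
        unfolding XV
        by (rule expectation_increment[OF _ _ f])
           (use m False all_moments_integrable[OF H[of "Suc m"]] in \<open>auto simp: XV\<close>)
      \<comment> \<open>With the past frozen, this is \<open>expectation_hermite\<close> with a =
        \<open>V m \<omega>\<close>, x = \<open>X m \<omega>\<close>, and for v the squared norm of
        \<open>\<eta> m \<omega>\<close> times the length of the step.\<close>
      also have "\<dots> = expectation (\<lambda>\<omega>. poly (hermite k (V m \<omega>)) (X m \<omega>))"
        using expectation_hermite[OF increment_gaussian_moments[OF m(3,2)]] by simp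
      also have "\<dots> = poly (hermite k 0) 0" using Suc by simp
      finally show ?thesis .
    qed
  qed
qed

text \<open>Integrate the pointwise inequality \<open>power_le_hermite\<close> along the martingale.
  Its constant depends on \<open>N\<close> alone, so the bound is uniform in the partition and in
  the size of the integrand, as the passage to Ito integrals requires.\<close>

lemma scalar_simple_moment:
  assumes "N \<ge> 1"
  shows "\<exists>C::real\<ge>0. \<forall>n u (\<eta> :: nat \<Rightarrow> 'a \<Rightarrow> real ^ 'r). 0 \<le> u 0 \<longrightarrow> (\<forall>i<n. u i \<le> u (Suc i)) \<longrightarrow>
     (\<forall>i<n. \<eta> i \<in> borel_measurable (F (u i)) \<and> bounded (\<eta> i ` space M)) \<longrightarrow>
     (\<integral>\<^sup>+\<omega>. ennreal ((\<Sum>i<n. \<eta> i \<omega> \<bullet> (W (u (Suc i)) \<omega> - W (u i) \<omega>)) ^ (2 * N)) \<partial>M) \<le>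
     ennreal C * (\<integral>\<^sup>+\<omega>. ennreal ((\<Sum>i<n. (norm (\<eta> i \<omega>))\<^sup>2 * (u (Suc i) - u i)) ^ N) \<partial>M)"
proof -
  obtain C where C: "C \<ge> 0" and CC: "\<And>x v. 0 \<le> v \<Longrightarrow> x ^ (2 * N) \<le> 2 * poly (hermite (2 * N) v) x + C * v ^ N"
    using power_le_hermite[OF assms] by blast
  show ?thesis
  proof (rule exI[of _ C], intro conjI allI impI C)
    fix n u and \<eta> :: "nat \<Rightarrow> 'a \<Rightarrow> real ^ 'r"
    assume u: "0 \<le> u 0" "\<forall>i<n. u i \<le> u (Suc i)"
      and \<eta>: "\<forall>i<n. \<eta> i \<in> borel_measurable (F (u i)) \<and> bounded (\<eta> i ` space M)"
    define X where "X \<equiv> (\<lambda>m \<omega>. \<Sum>i<m. \<eta> i \<omega> \<bullet> (W (u (Suc i)) \<omega> - W (u i) \<omega>))"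
    define V where "V \<equiv> (\<lambda>m \<omega>. \<Sum>i<m. (norm (\<eta> i \<omega>))\<^sup>2 * (u (Suc i) - u i))"
    note h = hermite_martingale[where u=u and n=n and \<eta>=\<eta>, folded X_def V_def]
    have V0: "0 \<le> V n \<omega>" for \<omega> unfolding V_def using u by (auto intro!: sum_nonneg)
    have a: "all_moments (X n)" "all_moments (V n)" "all_moments (\<lambda>\<omega>. poly (hermite k (V n \<omega>)) (X n \<omega>))" for k
      using h(2-4)[OF _ _ _ _ order_refl] u \<eta> unfolding X_def V_def by auto
    have VN: "integrable M (\<lambda>\<omega>. V n \<omega> ^ N)" and XN: "integrable M (\<lambda>\<omega>. X n \<omega> ^ (2 * N))"
      using a(1,2) V0 unfolding all_moments_def
      by (auto simp: power_even_abs dest: spec[of _ "2 * N"])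
    have "(\<integral>\<^sup>+\<omega>. ennreal (X n \<omega> ^ (2 * N)) \<partial>M) = ennreal (expectation (\<lambda>\<omega>. X n \<omega> ^ (2 * N)))"
      by (rule nn_integral_eq_integral[OF XN]) auto
    also have "expectation (\<lambda>\<omega>. X n \<omega> ^ (2 * N)) \<le> expectation (\<lambda>\<omega>. 2 * poly (hermite (2 * N) (V n \<omega>)) (X n \<omega>) + C * V n \<omega> ^ N)"
      using all_moments_integrable[OF a(3)] VN
      by (intro integral_mono XN CC V0 Bochner_Integration.integrable_add integrable_mult_right) auto
    also have "\<dots> = 2 * poly (hermite (2 * N) 0) 0 + C * expectation (\<lambda>\<omega>. V n \<omega> ^ N)"
      using all_moments_integrable[OF a(3)] VN h(1)[OF _ _ _ _ order_refl, of "2 * N"] u \<eta> unfolding X_def V_def by simp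
    \<comment> \<open>At variance 0 the Hermite polynomial is a pure power, which vanishes at 0
      because \<open>N\<close> is at least 1.\<close>
    also have "\<dots> = C * expectation (\<lambda>\<omega>. V n \<omega> ^ N)"
      using assms by (simp add: hermite_zero)
    also have "ennreal (C * expectation (\<lambda>\<omega>. V n \<omega> ^ N)) = ennreal C * (\<integral>\<^sup>+\<omega>. ennreal (V n \<omega> ^ N) \<partial>M)"
      using C V0 VN by (subst nn_integral_eq_integral) (auto simp: ennreal_mult)
    finally show "(\<integral>\<^sup>+\<omega>. ennreal ((\<Sum>i<n. \<eta> i \<omega> \<bullet> (W (u (Suc i)) \<omega> - W (u i) \<omega>)) ^ (2 * N)) \<partial>M) \<le>
      ennreal C * (\<integral>\<^sup>+\<omega>. ennreal ((\<Sum>i<n. (norm (\<eta> i \<omega>))\<^sup>2 * (u (Suc i) - u i)) ^ N) \<partial>M)"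
      by (simp add: X_def V_def ennreal_leI)
  qed
qed

text \<open>The largest squared coordinate controls both sides: the squared norm is at most the
  dimension times it, and its N-th power is one of the summands.\<close>

lemma norm_power_le_sum:
  fixes x :: "real ^ 'd"
  shows "norm x ^ (2 * N) \<le> real CARD('d) ^ N * (\<Sum>a\<in>UNIV. (x $ a) ^ (2 * N))"
proof -
  define S where "S = range (\<lambda>a. (x $ a)\<^sup>2)"
  have S: "finite S" "S \<noteq> {}" "\<And>a. (x $ a)\<^sup>2 \<in> S" "\<forall>m\<in>S. \<exists>b. m = (x $ b)\<^sup>2"
    by (auto simp: S_def)
  obtain b where "Max S = (x $ b)\<^sup>2" using S(4) Max_in[OF S(1,2)] by blast
  then have b: "(x $ a)\<^sup>2 \<le> (x $ b)\<^sup>2" for a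
    using Max_ge[OF S(1) S(3)[of a]] by simp
  have "norm x ^ (2 * N) = (\<Sum>a\<in>UNIV. (x $ a)\<^sup>2) ^ N"
    by (simp add: power_mult norm_vec_def L2_set_def sum_nonneg)
  also have "\<dots> \<le> (real CARD('d) * (x $ b)\<^sup>2) ^ N"
    using sum_bounded_above[of UNIV "\<lambda>a. (x $ a)\<^sup>2" "(x $ b)\<^sup>2"] b by (intro power_mono sum_nonneg) auto
  also have "\<dots> = real CARD('d) ^ N * (x $ b) ^ (2 * N)" by (simp add: power_mult_distrib power_mult)
  also have "\<dots> \<le> real CARD('d) ^ N * (\<Sum>a\<in>UNIV. (x $ a) ^ (2 * N))"
    by (intro mult_left_mono member_le_sum) (auto simp: power_mult)
  finally show ?thesis .
qed

text \<open>The \<open>itself\<close> argument records the state dimension, on which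
  \<open>C\<close> depends. Horizon, partition and integrand are quantified after
  \<open>C\<close>.\<close>

definition simple_moment_constant :: "'d :: finite itself \<Rightarrow> nat \<Rightarrow> real \<Rightarrow> bool" where
  "simple_moment_constant (_ :: 'd itself) N C \<longleftrightarrow> 0 \<le> C \<and> (\<forall>b n u (\<xi> :: nat \<Rightarrow> 'a \<Rightarrow> real ^ 'r ^ 'd). simple_integrand M F b n u \<xi> \<longrightarrow>
     (\<integral>\<^sup>+\<omega>. ennreal (norm (simple_ito_integral W n u \<xi> \<omega>) ^ (2 * N)) \<partial>M) \<le>
     ennreal C * (\<integral>\<^sup>+\<omega>. ennreal ((\<Sum>i<n. (norm (\<xi> i \<omega>))\<^sup>2 * (u (Suc i) - u i)) ^ N) \<partial>M))"

text \<open>Each component of the integral is the scalar integral of one row of the integrand, and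
  the energy of a row is at most that of the matrix.\<close>

lemma simple_moment:
  assumes "N \<ge> 1"
  shows "\<exists>C. simple_moment_constant TYPE('d :: finite) N C"
proof -
  obtain C :: real where C: "C \<ge> 0" and CC: "\<forall>n u (\<eta> :: nat \<Rightarrow> 'a \<Rightarrow> real ^ 'r). 0 \<le> u 0 \<longrightarrow> (\<forall>i<n. u i \<le> u (Suc i)) \<longrightarrow>
     (\<forall>i<n. \<eta> i \<in> borel_measurable (F (u i)) \<and> bounded (\<eta> i ` space M)) \<longrightarrow>
     (\<integral>\<^sup>+\<omega>. ennreal ((\<Sum>i<n. \<eta> i \<omega> \<bullet> (W (u (Suc i)) \<omega> - W (u i) \<omega>)) ^ (2 * N)) \<partial>M) \<le>
     ennreal C * (\<integral>\<^sup>+\<omega>. ennreal ((\<Sum>i<n. (norm (\<eta> i \<omega>))\<^sup>2 * (u (Suc i) - u i)) ^ N) \<partial>M)"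
    using scalar_simple_moment[OF assms] by (elim exE conjE) (rule that)
  \<comment> \<open>The power of the dimension comes from \<open>norm_power_le_sum\<close>, the
    further factor from adding the equal bounds of the rows.\<close>
  define D where "D = real CARD('d) ^ N * (real CARD('d) * C)"
  have "D \<ge> 0" using C by (simp add: D_def)
  moreover have "(\<integral>\<^sup>+\<omega>. ennreal (norm (simple_ito_integral W n u \<xi> \<omega>) ^ (2 * N)) \<partial>M) \<le>
     ennreal D * (\<integral>\<^sup>+\<omega>. ennreal ((\<Sum>i<n. (norm (\<xi> i \<omega>))\<^sup>2 * (u (Suc i) - u i)) ^ N) \<partial>M)"
    if S: "simple_integrand M F b n u \<xi>" for b n u and \<xi> :: "nat \<Rightarrow> 'a \<Rightarrow> real ^ 'r ^ 'd"
  proof -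
    have u: "0 \<le> u 0" "\<forall>i<n. u i \<le> u (Suc i)"
      and \<xi>: "\<And>i. i < n \<Longrightarrow> \<xi> i \<in> borel_measurable (F (u i))" "\<And>i. i < n \<Longrightarrow> bounded (\<xi> i ` space M)"
      using S by (auto simp: simple_integrand_def)
    have u0: "i \<le> n \<Longrightarrow> 0 \<le> u i" for i
      using grid_mono[of n u i 0] u by force
    let ?X = "\<lambda>a \<omega>. \<Sum>i<n. (\<xi> i \<omega> $ a) \<bullet> (W (u (Suc i)) \<omega> - W (u i) \<omega>)"
    let ?R = "(\<integral>\<^sup>+\<omega>. ennreal ((\<Sum>i<n. (norm (\<xi> i \<omega>))\<^sup>2 * (u (Suc i) - u i)) ^ N) \<partial>M)"
    have X: "simple_ito_integral W n u \<xi> \<omega> $ a = ?X a \<omega>" for a \<omega>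
      by (simp add: simple_ito_integral_def matrix_vector_mul_component)
    have Xm[measurable]: "?X a \<in> borel_measurable M" for a
    proof (rule borel_measurable_sum)
      fix i assume "i \<in> {..<n}"
      then have i: "i < n" by simp
      have "\<xi> i \<in> borel_measurable M"
        by (rule F_measurable[OF _ \<xi>(1)]) (use i u0[of i] in auto)
      then have [measurable]: "(\<lambda>\<omega>. \<xi> i \<omega> $ a) \<in> borel_measurable M"
        by (rule borel_measurable_vec_nth)
      have [measurable]: "W (u (Suc i)) \<in> borel_measurable M" "W (u i) \<in> borel_measurable M"
        using i u0[of i] u0[of "Suc i"] by (auto intro: W_measurable)
      show "(\<lambda>\<omega>. (\<xi> i \<omega> $ a) \<bullet> (W (u (Suc i)) \<omega> - W (u i) \<omega>)) \<in> borel_measurable M"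
        by measurable
    qed
    have le: "(\<integral>\<^sup>+\<omega>. ennreal (?X a \<omega> ^ (2 * N)) \<partial>M) \<le> ennreal C * ?R" for a
    proof -
      have "(\<integral>\<^sup>+\<omega>. ennreal (?X a \<omega> ^ (2 * N)) \<partial>M) \<le>
        ennreal C * (\<integral>\<^sup>+\<omega>. ennreal ((\<Sum>i<n. (norm (\<xi> i \<omega> $ a))\<^sup>2 * (u (Suc i) - u i)) ^ N) \<partial>M)"
      proof (rule CC[rule_format], goal_cases)
        case 1 show ?case by (rule u)
      next
        case (2 i) then show ?case using u by simp
      next
        case (3 i)
        show ?case
        proof (intro conjI)
        have i: "i < n" by fact
        show "(\<lambda>\<omega>. \<xi> i \<omega> $ a) \<in> borel_measurable (F (u i))"
          using \<xi>(1)[OF i] by (rule borel_measurable_vec_nth)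
        obtain K where "\<And>\<omega>. \<omega> \<in> space M \<Longrightarrow> norm (\<xi> i \<omega>) \<le> K" using \<xi>(2)[OF i] by (auto simp: bounded_iff)
        then show "bounded ((\<lambda>\<omega>. \<xi> i \<omega> $ a) ` space M)"
          unfolding bounded_iff by (intro exI[of _ K]) (auto intro: order.trans[OF Finite_Cartesian_Product.norm_nth_le])
        qed
      qed
      also have "\<dots> \<le> ennreal C * ?R"
        using u by (intro mult_left_mono nn_integral_mono ennreal_leI power_mono sum_mono mult_right_mono
            Finite_Cartesian_Product.norm_nth_le sum_nonneg) auto
      finally show ?thesis .
    qed
    have "(\<integral>\<^sup>+\<omega>. ennreal (norm (simple_ito_integral W n u \<xi> \<omega>) ^ (2 * N)) \<partial>M) \<le>
       (\<integral>\<^sup>+\<omega>. ennreal (real CARD('d) ^ N) * (\<Sum>a\<in>UNIV. ennreal (?X a \<omega> ^ (2 * N))) \<partial>M)"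
    proof (rule nn_integral_mono)
      fix \<omega>
      have "norm (simple_ito_integral W n u \<xi> \<omega>) ^ (2 * N) \<le>
          real CARD('d) ^ N * (\<Sum>a\<in>UNIV. ?X a \<omega> ^ (2 * N))"
        using norm_power_le_sum[of "simple_ito_integral W n u \<xi> \<omega>" N] by (simp only: X)
      then have "ennreal (norm (simple_ito_integral W n u \<xi> \<omega>) ^ (2 * N)) \<le>
          ennreal (real CARD('d) ^ N * (\<Sum>a\<in>UNIV. ?X a \<omega> ^ (2 * N)))" by (rule ennreal_leI)
      also have "\<dots> = ennreal (real CARD('d) ^ N) * ennreal (\<Sum>a\<in>UNIV. ?X a \<omega> ^ (2 * N))"
        by (intro ennreal_mult sum_nonneg) (simp_all add: power_mult)
      also have "ennreal (\<Sum>a\<in>UNIV. ?X a \<omega> ^ (2 * N)) = (\<Sum>a\<in>UNIV. ennreal (?X a \<omega> ^ (2 * N)))"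
        by (rule sum_ennreal[symmetric]) (simp add: power_mult)
      finally show "ennreal (norm (simple_ito_integral W n u \<xi> \<omega>) ^ (2 * N)) \<le>
        ennreal (real CARD('d) ^ N) * (\<Sum>a\<in>UNIV. ennreal (?X a \<omega> ^ (2 * N)))" .
    qed
    also have "\<dots> = ennreal (real CARD('d) ^ N) * (\<Sum>a\<in>UNIV. \<integral>\<^sup>+\<omega>. ennreal (?X a \<omega> ^ (2 * N)) \<partial>M)"
    proof -
      have [measurable]: "(\<lambda>\<omega>. ennreal (?X a \<omega> ^ (2 * N))) \<in> borel_measurable M" for a
        by (rule measurable_compose[OF Xm]) measurable
      show ?thesis by (subst nn_integral_cmult nn_integral_sum; (measurable; fail)?)+
    qed
    also have "\<dots> \<le> ennreal (real CARD('d) ^ N) * (\<Sum>a\<in>(UNIV::'d set). ennreal C * ?R)"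
      by (intro mult_left_mono sum_mono le) auto
    also have "\<dots> = ennreal D * ?R"
      using C by (simp add: D_def ennreal_mult ennreal_of_nat_eq_real_of_nat mult.assoc)
    finally show ?thesis .
  qed
  ultimately show ?thesis unfolding simple_moment_constant_def by (intro exI[of _ D] conjI allI impI)
qed

end

lemma tendsto_ennreal_power:
  assumes "(f \<longlongrightarrow> x) G" "x < (\<top>::ennreal)"
  shows "((\<lambda>y. f y ^ n) \<longlongrightarrow> x ^ n) G"
proof -
  have x: "x = ennreal (enn2real x)" using assms by simp
  have ev: "\<forall>\<^sub>F y in G. f y < \<top>" using order_tendstoD(2)[OF assms] .
  have "((\<lambda>y. enn2real (f y)) \<longlongrightarrow> enn2real x) G"
    by (rule tendsto_enn2real) (use assms x in auto)
  then have "((\<lambda>y. ennreal (enn2real (f y) ^ n)) \<longlongrightarrow> ennreal (enn2real x ^ n)) G"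
    by (intro tendsto_ennrealI tendsto_power)
  moreover have "\<forall>\<^sub>F y in G. ennreal (enn2real (f y) ^ n) = f y ^ n"
    using ev by eventually_elim (simp add: ennreal_power[symmetric])
  moreover have "ennreal (enn2real x ^ n) = x ^ n"
    using x by (simp add: ennreal_power[symmetric])
  ultimately show ?thesis by (simp add: tendsto_cong)
qed

section \<open>Sampling simple processes on a uniform grid\<close>

definition grid :: "real \<Rightarrow> nat \<Rightarrow> nat \<Rightarrow> real" where
  "grid b l j = b * real j / real (Suc l)"

definition grid_index :: "real \<Rightarrow> nat \<Rightarrow> real \<Rightarrow> nat" where
  "grid_index b l s = nat \<lfloor>s * real (Suc l) / b\<rfloor>"

lemma grid_step: "grid b l (Suc j) - grid b l j = b / real (Suc l)"
  unfolding grid_def diff_divide_distrib[symmetric] by (simp add: algebra_simps)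

lemma grid_step_nonneg: "0 < b \<Longrightarrow> grid b l j \<le> grid b l (Suc j)"
  unfolding grid_def by (intro divide_right_mono mult_left_mono) auto

lemma grid_bounds: "0 < b \<Longrightarrow> 0 \<le> grid b l j" "0 < b \<Longrightarrow> j \<le> Suc l \<Longrightarrow> grid b l j \<le> b"
  using mult_left_mono[of "real j" "real (Suc l)" b]
  by (auto simp: grid_def pos_divide_le_eq simp del: of_nat_Suc)

lemma grid_le_iff:
  assumes "0 < b" "0 \<le> s"
  shows "grid b l j \<le> s \<longleftrightarrow> j \<le> grid_index b l s"
proof -
  have "j \<le> grid_index b l s \<longleftrightarrow> real j \<le> s * real (Suc l) / b"
    using assms by (auto simp: grid_index_def le_nat_iff le_floor_iff)
  then show ?thesis using assms by (simp add: grid_def field_simps)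
qed

lemma grid_index_bounds:
  assumes "0 < b" "0 \<le> s"
  shows "grid b l (grid_index b l s) \<le> s" "s < grid b l (Suc (grid_index b l s))"
    "s - b / real (Suc l) < grid b l (grid_index b l s)"
proof -
  show 1: "grid b l (grid_index b l s) \<le> s" "s < grid b l (Suc (grid_index b l s))"
    using grid_le_iff[OF assms, of l "grid_index b l s"] grid_le_iff[OF assms, of l "Suc (grid_index b l s)"]
    by auto
  then show "s - b / real (Suc l) < grid b l (grid_index b l s)"
    using grid_step[of b l "grid_index b l s"] by linarith
qed

lemma grid_index_less:
  assumes "0 < b" "0 \<le> s" "s < b" shows "grid_index b l s < Suc l"
proof -
  have "grid b l (Suc l) = b" using assms by (simp add: grid_def)
  then show ?thesis using grid_le_iff[of b s l "Suc l"] assms by auto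
qed

lemma inverse_Suc_tendsto: "(\<lambda>l. b / real (Suc l)) \<longlonglongrightarrow> 0"
  using tendsto_mult[OF tendsto_const[of b] LIMSEQ_inverse_real_of_nat] by (simp add: divide_inverse)

lemma grid_floor_tendsto:
  assumes "0 < b" "0 \<le> s"
  shows "(\<lambda>l. grid b l (grid_index b l s)) \<longlonglongrightarrow> s"
proof (rule tendsto_sandwich)
  show "(\<lambda>l. s - b / real (Suc l)) \<longlonglongrightarrow> s"
    using tendsto_diff[OF tendsto_const inverse_Suc_tendsto[of b], of s] by simp
  show "\<forall>\<^sub>F l in sequentially. s - b / real (Suc l) \<le> grid b l (grid_index b l s)"
    using grid_index_bounds(3)[OF assms] by (intro always_eventually allI less_imp_le)
qed (use grid_index_bounds[OF assms] in auto)

text \<open>The indicator selects the cells whose left end lies in the interval. Their increments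
  telescope to the value of \<open>w\<close> at the first grid point after \<open>c\<close> minus
  that after \<open>a\<close>, and continuity finishes the argument.\<close>

lemma grid_sum_tendsto:
  fixes w :: "real \<Rightarrow> 'v :: real_normed_vector"
  assumes w: "continuous_on {0..} w" and b: "0 < b" and ac: "0 \<le> a" "a \<le> c" "c \<le> b"
  shows "(\<lambda>l. \<Sum>j<Suc l. indicator {a<..c} (grid b l j) *\<^sub>R (w (grid b l (Suc j)) - w (grid b l j))) \<longlonglongrightarrow> w c - w a"
proof -
  define G where "G l a = (\<Sum>j<Suc l. (if grid b l j \<le> a then w (grid b l (Suc j)) - w (grid b l j) else 0))" for l a
  have G: "G l a = w (grid b l (min (Suc l) (Suc (grid_index b l a)))) - w 0" if "0 \<le> a" for l a
  proof -
    have "G l a = (\<Sum>j\<in>{j\<in>{..<Suc l}. j \<le> grid_index b l a}. w (grid b l (Suc j)) - w (grid b l j))"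
      unfolding G_def grid_le_iff[OF b that] by (subst sum.inter_filter) auto
    also have "{j\<in>{..<Suc l}. j \<le> grid_index b l a} = {..<min (Suc l) (Suc (grid_index b l a))}"
      by auto
    also have "(\<Sum>j\<in>\<dots>. w (grid b l (Suc j)) - w (grid b l j)) = w (grid b l (min (Suc l) (Suc (grid_index b l a)))) - w (grid b l 0)"
      by (rule sum_lessThan_telescope)
    finally show ?thesis by (simp add: grid_def)
  qed
  have lim: "(\<lambda>l. G l a) \<longlonglongrightarrow> w a - w 0" if a: "0 \<le> a" "a \<le> b" for a
  proof -
    have "(\<lambda>l. grid b l (min (Suc l) (Suc (grid_index b l a)))) \<longlonglongrightarrow> a"
    proof (rule tendsto_sandwich)
      show "(\<lambda>l. a) \<longlonglongrightarrow> a" by simp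
      show "(\<lambda>l. a + b / real (Suc l)) \<longlonglongrightarrow> a"
        using tendsto_add[OF tendsto_const inverse_Suc_tendsto[of b], of a] by simp
      have "a \<le> grid b l (min (Suc l) (Suc (grid_index b l a))) \<and>
        grid b l (min (Suc l) (Suc (grid_index b l a))) \<le> a + b / real (Suc l)" for l
      proof (cases "grid_index b l a < Suc l")
        case True
        then have "min (Suc l) (Suc (grid_index b l a)) = Suc (grid_index b l a)" by simp
        then show ?thesis using grid_index_bounds[OF b a(1), of l] grid_step[of b l "grid_index b l a"]
          by auto
      next
        \<comment> \<open>Only \<open>a = b\<close> reaches this case: its index lies beyond the
          last cell, and the \<open>min\<close> in the upper index replaces it by the end point
          \<open>b\<close>.\<close>
        case False
        then have "a = b" using grid_index_less[OF b a(1), of l] a by force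
        moreover have "grid b l (Suc l) = b" by (simp add: grid_def)
        ultimately show ?thesis using False b by (simp add: min_def)
      qed
      then show "\<forall>\<^sub>F l in sequentially. a \<le> grid b l (min (Suc l) (Suc (grid_index b l a)))"
        "\<forall>\<^sub>F l in sequentially. grid b l (min (Suc l) (Suc (grid_index b l a))) \<le> a + b / real (Suc l)"
        by auto
    qed
    then have "(\<lambda>l. w (grid b l (min (Suc l) (Suc (grid_index b l a))))) \<longlonglongrightarrow> w a"
      by (rule continuous_on_tendsto_compose[OF w]) (use a grid_bounds[OF b] in auto)
    then show ?thesis unfolding G[OF a(1)] by (intro tendsto_diff tendsto_const)
  qed
  have "(\<Sum>j<Suc l. indicator {a<..c} (grid b l j) *\<^sub>R (w (grid b l (Suc j)) - w (grid b l j))) = G l c - G l a" for l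
    unfolding G_def sum_subtractf[symmetric] using ac
    by (intro sum.cong refl) (auto simp: indicator_def)
  then show ?thesis using tendsto_diff[OF lim[of c] lim[of a]] ac by simp
qed

lemma nn_integral_grid:
  assumes "0 < b"
  shows "(\<integral>\<^sup>+s. (\<Sum>j<Suc l. ennreal (c j) * indicator {grid b l j..<grid b l (Suc j)} s) \<partial>lborel) =
    (\<Sum>j<Suc l. ennreal (c j) * ennreal (grid b l (Suc j) - grid b l j))"
proof -
  have "grid b l j \<le> grid b l (Suc j)" for j using grid_step_nonneg[OF assms] .
  then show ?thesis
    by (subst nn_integral_sum) (auto simp: nn_integral_cmult)
qed

lemma grid_step_function:
  assumes "0 < b" "0 \<le> s" "s < b"
  shows "(\<Sum>j<Suc l. c j * indicator {grid b l j..<grid b l (Suc j)} s) = (c (grid_index b l s) :: ennreal)"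
proof -
  have "s \<in> {grid b l j..<grid b l (Suc j)} \<longleftrightarrow> j = grid_index b l s" for j
    using grid_le_iff[OF assms(1,2), of l j] grid_le_iff[OF assms(1,2), of l "Suc j"] by auto
  then have "(\<Sum>j<Suc l. c j * indicator {grid b l j..<grid b l (Suc j)} s) =
     (\<Sum>j<Suc l. if j = grid_index b l s then c j else 0)"
    by (intro sum.cong refl) (simp add: indicator_def)
  then show ?thesis using grid_index_less[OF assms, of l] by simp
qed

text \<open>Simple processes are left continuous, their intervals being closed on the right. Samples
  taken from below are thus eventually exact, also at jump times, which is why the grid is read at
  left end points.\<close>

lemma simple_process_left_limit:
  assumes "\<And>l. w l \<le> s" "w \<longlonglongrightarrow> (s::real)"
  shows "\<forall>\<^sub>F l in sequentially. simple_process n u \<xi> (w l) \<omega> = simple_process n u \<xi> s \<omega>"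
proof -
  have "\<forall>\<^sub>F l in sequentially. \<forall>i\<in>{..<n}. indicator {u i<..u (Suc i)} (w l) = (indicator {u i<..u (Suc i)} s :: real)"
  proof (rule eventually_ball_finite)
    show "\<forall>i\<in>{..<n}. \<forall>\<^sub>F l in sequentially. indicator {u i<..u (Suc i)} (w l) = (indicator {u i<..u (Suc i)} s :: real)"
    proof
      fix i
      consider "s \<le> u i" | "s > u (Suc i)" | "u i < s" "s \<le> u (Suc i)" by linarith
      then show "\<forall>\<^sub>F l in sequentially. indicator {u i<..u (Suc i)} (w l) = (indicator {u i<..u (Suc i)} s :: real)"
      proof cases
        case 1
        have "indicator {u i<..u (Suc i)} (w l) = (indicator {u i<..u (Suc i)} s :: real)" for l
          using assms(1)[of l] 1 by (auto simp: indicator_def)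
        then show ?thesis by simp
      next
        case 2
        have "\<forall>\<^sub>F l in sequentially. u (Suc i) < w l" using order_tendstoD(1)[OF assms(2) 2] .
        then show ?thesis by eventually_elim (use 2 in \<open>auto simp: indicator_def\<close>)
      next
        case 3
        have "\<forall>\<^sub>F l in sequentially. u i < w l" using order_tendstoD(1)[OF assms(2) 3(1)] .
        then show ?thesis
        proof eventually_elim
          case (elim l)
          then show ?case using 3 assms(1)[of l] by (auto simp: indicator_def)
        qed
      qed
    qed
  qed simp
  then show ?thesis
    by eventually_elim (simp add: simple_process_def)
qed

text \<open>Two simple processes with unrelated partitions can be subtracted and stopped once both
  are read on one grid; this limit shows that the resampling does not alter the integral. Exchanging
  the sums reduces it to \<open>grid_sum_tendsto\<close> for each interval.\<close>

lemma simple_integral_grid_tendsto: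
  fixes W :: "real \<Rightarrow> 'a \<Rightarrow> real ^ 'r" and \<xi> :: "nat \<Rightarrow> 'a \<Rightarrow> real ^ 'r ^ 'd"
  assumes W: "continuous_on {0..} (\<lambda>t. W t \<omega>)" and b: "0 < b"
    and u: "0 \<le> u 0" "u n \<le> b" "\<And>i. i < n \<Longrightarrow> u i \<le> u (Suc i)"
  shows "(\<lambda>l. simple_ito_integral W (Suc l) (grid b l) (\<lambda>j. simple_process n u \<xi> (grid b l j)) \<omega>)
     \<longlonglongrightarrow> simple_ito_integral W n u \<xi> \<omega>"
proof -
  let ?g = "\<lambda>l i. \<Sum>j<Suc l. indicator {u i<..u (Suc i)} (grid b l j) *\<^sub>R (W (grid b l (Suc j)) \<omega> - W (grid b l j) \<omega>)"
  have "simple_ito_integral W (Suc l) (grid b l) (\<lambda>j. simple_process n u \<xi> (grid b l j)) \<omega> = (\<Sum>i<n. \<xi> i \<omega> *v ?g l i)" for l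
  proof -
    have [simp]: "(\<Sum>i\<in>I. A i) *v x = (\<Sum>i\<in>I. A i *v x)" if "finite I" for I and A :: "nat \<Rightarrow> real ^ 'r ^ 'd" and x
      using that by induction (auto simp: matrix_vector_mult_add_rdistrib)
    have [simp]: "A *v (\<Sum>i\<in>I. x i) = (\<Sum>i\<in>I. A *v x i)" if "finite I" for I and x :: "nat \<Rightarrow> real ^ 'r" and A :: "real ^ 'r ^ 'd"
      using that by induction (auto simp: matrix_vector_right_distrib)
    have "simple_ito_integral W (Suc l) (grid b l) (\<lambda>j. simple_process n u \<xi> (grid b l j)) \<omega> =
      (\<Sum>j<Suc l. \<Sum>i<n. indicator {u i<..u (Suc i)} (grid b l j) *\<^sub>R
         (\<xi> i \<omega> *v (W (grid b l (Suc j)) \<omega> - W (grid b l j) \<omega>)))"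
      unfolding simple_ito_integral_def simple_process_def
      by (rule sum.cong[OF refl]) (simp add: scaleR_matrix_vector_assoc del: sum_indicator_scaleR)
    also have "\<dots> = (\<Sum>i<n. \<Sum>j<Suc l. indicator {u i<..u (Suc i)} (grid b l j) *\<^sub>R
         (\<xi> i \<omega> *v (W (grid b l (Suc j)) \<omega> - W (grid b l j) \<omega>)))"
      by (rule sum.swap)
    also have "\<dots> = (\<Sum>i<n. \<xi> i \<omega> *v ?g l i)"
      by (simp add: matrix_vector_mult_scaleR[symmetric] del: sum.lessThan_Suc sum_indicator_scaleR)
    finally show ?thesis .
  qed
  moreover have "(\<lambda>l. \<Sum>i<n. \<xi> i \<omega> *v ?g l i) \<longlonglongrightarrow> (\<Sum>i<n. \<xi> i \<omega> *v (W (u (Suc i)) \<omega> - W (u i) \<omega>))"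
  proof (intro tendsto_sum bounded_linear.tendsto[OF matrix_vector_mul_bounded_linear] grid_sum_tendsto[OF W b])
    fix i assume "i \<in> {..<n}"
    then show "0 \<le> u i" "u i \<le> u (Suc i)" "u (Suc i) \<le> b"
      using grid_mono[of n u i 0] grid_mono[of n u n "Suc i"] u by force+
  qed
  ultimately show ?thesis by (simp add: simple_ito_integral_def)
qed

text \<open>The terms are nonnegative, so once the test fails it fails for all later indices and the
  retained terms form an initial segment. As the test includes the current term, the total cannot
  exceed \<open>R\<close> even by one step.\<close>

lemma truncated_sum_le:
  fixes a :: "nat \<Rightarrow> real"
  assumes "\<And>j. 0 \<le> a j" "0 \<le> R"
  shows "(\<Sum>j<m. if (\<Sum>i<Suc j. a i) \<le> R then a j else 0) \<le> min R (\<Sum>j<m. a j)"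
proof (induction m)
  case (Suc m)
  show ?case
  proof (cases "(\<Sum>i<Suc m. a i) \<le> R")
    case True
    then show ?thesis using Suc by simp
  next
    case False
    then show ?thesis using Suc assms(1)[of m] by simp
  qed
qed (use assms in simp)

section \<open>Moments of Ito integrals up to a stopping time\<close>

lemma section_measurable:
  assumes "(\<lambda>(s, \<omega>). f s \<omega>) \<in> borel_measurable (borel \<Otimes>\<^sub>M M)" "\<omega> \<in> space M"
  shows "(\<lambda>s. f s \<omega>) \<in> borel_measurable borel"
  using measurable_Pair1[OF assms] by simp

section \<open>Stopped integrals of simple processes\<close>

context wiener_space begin

lemma simple_process_measurable:
  assumes S: "simple_integrand M F b n u \<xi>" and s: "0 \<le> s"
  shows "simple_process n u \<xi> s \<in> borel_measurable (F s)"
proof -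
  have u0: "i \<le> n \<Longrightarrow> 0 \<le> u i" for i
    using S grid_mono[of n u i 0] by (force simp: simple_integrand_def)
  have "(\<lambda>\<omega>. indicator {u i<..u (Suc i)} s *\<^sub>R \<xi> i \<omega>) \<in> borel_measurable (F s)" if "i < n" for i
  proof (cases "s \<in> {u i<..u (Suc i)}")
    case True
    have "\<xi> i \<in> borel_measurable (F s)"
      by (rule F_mono[of "u i"]) (use S True u0[of i] that in \<open>auto simp: simple_integrand_def\<close>)
    then show ?thesis by simp
  qed simp
  then show ?thesis unfolding simple_process_def by (intro borel_measurable_sum) auto
qed

lemma simple_process_bounded:
  assumes S: "simple_integrand M F b n u \<xi>"
  obtains C where "0 \<le> C" "\<And>s \<omega>. \<omega> \<in> space M \<Longrightarrow> norm (simple_process n u \<xi> s \<omega>) \<le> C"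
proof -
  have "\<forall>i<n. \<exists>C. \<forall>\<omega>\<in>space M. norm (\<xi> i \<omega>) \<le> C"
    using S by (auto simp: simple_integrand_def bounded_iff)
  then obtain C where C: "\<And>i \<omega>. i < n \<Longrightarrow> \<omega> \<in> space M \<Longrightarrow> norm (\<xi> i \<omega>) \<le> C i" by metis
  have "norm (simple_process n u \<xi> s \<omega>) \<le> (\<Sum>i<n. \<bar>C i\<bar>)" if "\<omega> \<in> space M" for s \<omega>
    unfolding simple_process_def using C[OF _ that]
    by (intro order.trans[OF norm_sum] sum_mono) (force simp: indicator_def)
  then show thesis by (intro that[of "\<Sum>i<n. \<bar>C i\<bar>"]) (auto intro: sum_nonneg)
qed

text \<open>The events \<open>B s\<close> stand for \<open>s \<le> \<tau>\<close> with a stopping time \<open>\<tau>\<close>.\<close>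

definition stopping_family :: "real \<Rightarrow> (real \<Rightarrow> 'a set) \<Rightarrow> bool" where
  "stopping_family b B \<longleftrightarrow> (\<forall>s. 0 \<le> s \<and> s \<le> b \<longrightarrow> B s \<in> sets (F s)) \<and>
     (\<forall>s t. 0 \<le> s \<and> s \<le> t \<and> t \<le> b \<longrightarrow> B t \<subseteq> B s) \<and>
     (\<lambda>(s, \<omega>). indicator (B s) \<omega> :: ennreal) \<in> borel_measurable (borel \<Otimes>\<^sub>M M)"

lemma simple_ito_measurable:
  fixes \<xi> :: "nat \<Rightarrow> 'a \<Rightarrow> real ^ 'r ^ 'd"
  assumes S: "simple_integrand M F b n u \<xi>"
  shows "simple_ito_integral W n u \<xi> \<in> borel_measurable M"
proof -
  have u0: "i \<le> n \<Longrightarrow> 0 \<le> u i" for i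
    using S grid_mono[of n u i 0] by (force simp: simple_integrand_def)
  have "(\<lambda>\<omega>. \<xi> i \<omega> *v (W (u (Suc i)) \<omega> - W (u i) \<omega>)) \<in> borel_measurable M" if "i < n" for i
  proof -
    have [measurable]: "\<xi> i \<in> borel_measurable M" "W (u (Suc i)) \<in> borel_measurable M" "W (u i) \<in> borel_measurable M"
      using S u0[of i] u0[of "Suc i"] that
      by (auto simp: simple_integrand_def intro: W_measurable F_measurable[of "u i"])
    have c: "continuous_on UNIV (\<lambda>p :: (real ^ 'r ^ 'd) \<times> (real ^ 'r). fst p *v snd p)"
      unfolding matrix_vector_mult_def by (intro continuous_intros)
    show ?thesis
      using borel_measurable_continuous_Pair[OF _ _ c, of "\<xi> i" M "\<lambda>\<omega>. W (u (Suc i)) \<omega> - W (u i) \<omega>"] by simp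
  qed
  then show ?thesis unfolding simple_ito_integral_def[abs_def] by (intro borel_measurable_sum) auto
qed

lemma simple_process_jointly_measurable:
  assumes S: "simple_integrand M F b n u \<xi>"
  shows "(\<lambda>(s, \<omega>). simple_process n u \<xi> s \<omega>) \<in> borel_measurable (borel \<Otimes>\<^sub>M M)"
proof -
  have u0: "i \<le> n \<Longrightarrow> 0 \<le> u i" for i
    using S grid_mono[of n u i 0] by (force simp: simple_integrand_def)
  have "(\<lambda>(s, \<omega>). indicator {u i<..u (Suc i)} s *\<^sub>R \<xi> i \<omega>) \<in> borel_measurable (borel \<Otimes>\<^sub>M M)" if "i < n" for i
  proof -
    have [measurable]: "\<xi> i \<in> borel_measurable M"
      by (rule F_measurable[of "u i"]) (use S u0[of i] that in \<open>auto simp: simple_integrand_def\<close>)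
    show ?thesis by measurable
  qed
  then show ?thesis unfolding simple_process_def split_beta' by (intro borel_measurable_sum) auto
qed

text \<open>The sums are integrals of step functions that sample the integrand at the left end of
  each cell. These converge at all times but at most two, the exit time of the path and
  \<open>b\<close>, and are dominated by a constant on a bounded interval.\<close>

lemma sampled_energy_tendsto:
  fixes S :: "real \<Rightarrow> 'a \<Rightarrow> 'v :: real_normed_vector"
  assumes b: "0 < b" and B: "stopping_family b B" and \<omega>: "\<omega> \<in> space M"
    and left: "\<And>w s. (\<And>l. w l \<le> s) \<Longrightarrow> w \<longlonglongrightarrow> s \<Longrightarrow> \<forall>\<^sub>F l in sequentially. S (w l) \<omega> = S s \<omega>"
    and bound: "\<And>s. norm (S s \<omega>) \<le> C"
    and meas: "(\<lambda>s. norm (S s \<omega>)) \<in> borel_measurable borel"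
  shows "(\<lambda>l. ennreal (\<Sum>j<Suc l. (norm (indicator (B (grid b l j)) \<omega> *\<^sub>R S (grid b l j) \<omega>))\<^sup>2 * (grid b l (Suc j) - grid b l j)))
    \<longlonglongrightarrow> (\<integral>\<^sup>+s\<in>{0..b}. ennreal ((norm (S s \<omega>))\<^sup>2) * indicator (B s) \<omega> \<partial>lborel)"
proof -
  have [measurable]: "(\<lambda>s. norm (S s \<omega>)) \<in> borel_measurable borel" by fact
  have jm[measurable]: "(\<lambda>s. indicator (B s) \<omega> :: ennreal) \<in> borel_measurable borel"
    using B section_measurable[OF _ \<omega>] unfolding stopping_family_def by blast
  have mono: "0 \<le> s \<Longrightarrow> s \<le> t \<Longrightarrow> t \<le> b \<Longrightarrow> \<omega> \<in> B t \<Longrightarrow> \<omega> \<in> B s" for s t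
    using B by (auto simp: stopping_family_def)
  let ?c = "\<lambda>l j. (norm (indicator (B (grid b l j)) \<omega> *\<^sub>R S (grid b l j) \<omega>))\<^sup>2"
  let ?h = "\<lambda>l s. \<Sum>j<Suc l. ennreal (?c l j) * indicator {grid b l j..<grid b l (Suc j)} s"
  let ?f = "\<lambda>s. ennreal ((norm (S s \<omega>))\<^sup>2) * indicator (B s) \<omega> * indicator {0..b} s"
  have st: "0 \<le> grid b l (Suc j) - grid b l j" for l j
    using grid_step_nonneg[OF b, of l j] by simp
  have eq: "(\<integral>\<^sup>+s. ?h l s \<partial>lborel) = ennreal (\<Sum>j<Suc l. ?c l j * (grid b l (Suc j) - grid b l j))" for l
    unfolding nn_integral_grid[OF b] using st
    by (subst sum_ennreal[symmetric]) (auto simp: ennreal_mult)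
  have C0: "0 \<le> C" using bound[of 0] norm_ge_zero order.trans by blast
  \<comment> \<open>At most one point, the exit time itself, where all samples from the left may
    still lie in the family although the path no longer does. At any other time outside
    \<open>B\<close>, an earlier exit time is passed by the samples and monotonicity
    applies.\<close>
  define E where "E = {s\<in>{0..b}. \<omega> \<notin> B s \<and> (\<forall>s'\<in>{0..<s}. \<omega> \<in> B s')}"
  have "\<forall>x\<in>E. \<forall>y\<in>E. x = y"
    unfolding E_def by (metis (mono_tags, lifting) atLeastAtMost_iff atLeastLessThan_iff linorder_cases mem_Collect_eq)
  then have "countable E" by (metis countable_subset countable_insert countable_empty insertCI subsetI all_not_in_conv)
  then have ae: "AE s in lborel. s \<notin> E \<union> {b}"
    by (intro AE_not_in countable_imp_null_set_lborel) auto
  have "(\<lambda>l. \<integral>\<^sup>+s. ?h l s \<partial>lborel) \<longlonglongrightarrow> (\<integral>\<^sup>+s. ?f s \<partial>lborel)"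
  proof (rule nn_integral_dominated_convergence)
    show "(\<integral>\<^sup>+ s. ennreal (C\<^sup>2) * indicator {0..b} s \<partial>lborel) < \<infinity>"
      using b by (simp add: nn_integral_cmult ennreal_mult_less_top)
    show "AE s in lborel. ?h l s \<le> ennreal (C\<^sup>2) * indicator {0..b} s" for l
    proof (rule AE_I2)
      fix s
      consider "0 \<le> s" "s < b" | "s < 0 \<or> b \<le> s" by linarith
      then show "?h l s \<le> ennreal (C\<^sup>2) * indicator {0..b} s"
      proof cases
        case 1
        have "?c l j \<le> C\<^sup>2" for j
          using bound[of "grid b l j"] C0 by (intro power_mono) (auto simp: indicator_def)
        then show ?thesis unfolding grid_step_function[OF b 1] using 1 by (auto intro: ennreal_leI)
      next
        case 2
        have "s \<notin> {grid b l j..<grid b l (Suc j)}" if "j < Suc l" for j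
          using grid_bounds(1)[OF b, of l j] grid_bounds(2)[OF b, of "Suc j" l] 2 that by auto
        then have "?h l s = 0" by (intro sum.neutral) auto
        then show ?thesis by (simp del: sum.lessThan_Suc)
      qed
    qed
    show "AE s in lborel. (\<lambda>l. ?h l s) \<longlonglongrightarrow> ?f s"
      using ae
    proof eventually_elim
      case (elim s)
      consider "0 \<le> s" "s < b" | "s < 0 \<or> b < s" using elim by force
      then show ?case
      proof cases
        case 1
        let ?w = "\<lambda>l. grid b l (grid_index b l s)"
        have w: "?w l \<le> s" "0 \<le> ?w l" for l using grid_index_bounds[OF b 1(1)] grid_bounds(1)[OF b] by auto
        have wl: "?w \<longlonglongrightarrow> s" by (rule grid_floor_tendsto[OF b 1(1)])
        have 2: "\<forall>\<^sub>F l in sequentially. S (?w l) \<omega> = S s \<omega>" by (rule left[OF w(1) wl])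
        have 3: "\<forall>\<^sub>F l in sequentially. indicator (B (?w l)) \<omega> = (indicator (B s) \<omega> :: real)"
        proof (cases "\<omega> \<in> B s")
          case True
          then have "\<omega> \<in> B (?w l)" for l using mono[OF w(2) w(1)] 1 by auto
          then show ?thesis using True by simp
        next
          case False
          then obtain s' where s': "0 \<le> s'" "s' < s" "\<omega> \<notin> B s'" using elim 1 by (auto simp: E_def)
          have "\<forall>\<^sub>F l in sequentially. s' < ?w l" using order_tendstoD(1)[OF wl s'(2)] .
          then show ?thesis
          proof eventually_elim
            case (elim l)
            then have "\<omega> \<notin> B (?w l)" using mono[of s' "?w l"] s' w[of l] 1 by auto
            then show ?case using False by simp
          qed
        qed
        have "\<forall>\<^sub>F l in sequentially. ?h l s = ?f s"
          using 2 3
        proof eventually_elim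
          case (elim l)
          have "?h l s = ennreal (?c l (grid_index b l s))" by (rule grid_step_function[OF b 1])
          also have "\<dots> = ?f s" using elim 1 by (auto simp: indicator_def)
          finally show ?case .
        qed
        then show ?thesis by (rule tendsto_eventually)
      next
        case 2
        have "s \<notin> {grid b l j..<grid b l (Suc j)}" if "j < Suc l" for j l
          using grid_bounds(1)[OF b, of l j] grid_bounds(2)[OF b, of "Suc j" l] 2 that by auto
        then have "?h l s = 0" for l by (intro sum.neutral) auto
        moreover have "?f s = 0" using 2 by (auto simp: indicator_def)
        ultimately show ?thesis by (simp only: tendsto_const)
      qed
    qed
  qed measurable
  then show ?thesis unfolding eq by simp
qed

text \<open>The resampled difference is cut off twice, by the stopping events and by the energy
  level \<open>R\<close>, so that its energy is at most \<open>R\<close> and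
  \<open>simple_moment_constant\<close> applies. On the event on the left both cuts are eventually
  inactive. Fatou's lemma treats the left side, dominated convergence with the constant R^N the
  right side.\<close>

lemma stopped_simple_moment:
  fixes \<xi> \<xi>' :: "nat \<Rightarrow> 'a \<Rightarrow> real ^ 'r ^ 'd"
  assumes moment: "simple_moment_constant TYPE('d) N C"
    and b: "0 < b" and B: "stopping_family b B" and R: "0 \<le> R"
    and S: "simple_integrand M F b n u \<xi>" "simple_integrand M F b n' u' \<xi>'"
  defines "S \<equiv> \<lambda>s \<omega>. simple_process n u \<xi> s \<omega> - simple_process n' u' \<xi>' s \<omega>"
  defines "J \<equiv> \<lambda>\<omega>. simple_ito_integral W n u \<xi> \<omega> - simple_ito_integral W n' u' \<xi>' \<omega>"
  defines "V \<equiv> \<lambda>\<omega>. \<integral>\<^sup>+s\<in>{0..b}. ennreal ((norm (S s \<omega>))\<^sup>2) * indicator (B s) \<omega> \<partial>lborel"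
  shows "(\<integral>\<^sup>+\<omega>. indicator {\<omega>\<in>B b. V \<omega> < ennreal R} \<omega> * ennreal (norm (J \<omega>) ^ (2 * N)) \<partial>M) \<le>
     ennreal C * (\<integral>\<^sup>+\<omega>. (min (ennreal R) (V \<omega>)) ^ N \<partial>M)"
proof -
  define \<eta> where "\<eta> l j \<omega> = indicator (B (grid b l j)) \<omega> *\<^sub>R S (grid b l j) \<omega>" for l j \<omega>
  define a where "a l j \<omega> = (norm (\<eta> l j \<omega>))\<^sup>2 * (grid b l (Suc j) - grid b l j)" for l j \<omega>
  \<comment> \<open>The energy up to and including cell \<open>j\<close> depends only on values
    known at the left end of that cell, so the truncated process is adapted.\<close>
  define \<zeta> where "\<zeta> l j \<omega> = (if (\<Sum>i<Suc j. a l i \<omega>) \<le> R then \<eta> l j \<omega> else 0)" for l j \<omega>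
  obtain K K' where K: "\<And>s \<omega>. \<omega> \<in> space M \<Longrightarrow> norm (simple_process n u \<xi> s \<omega>) \<le> K"
    "\<And>s \<omega>. \<omega> \<in> space M \<Longrightarrow> norm (simple_process n' u' \<xi>' s \<omega>) \<le> K'"
    using simple_process_bounded[OF S(1)] simple_process_bounded[OF S(2)] by metis
  have SK: "norm (S s \<omega>) \<le> K + K'" if "\<omega> \<in> space M" for s \<omega>
    unfolding S_def using K(1)[OF that, of s] K(2)[OF that, of s] by norm
  have KK: "0 \<le> K + K'" if "\<omega> \<in> space M" for \<omega>
    using SK[OF that, of 0] norm_ge_zero[of "S 0 \<omega>"] by linarith
  have Sjm[measurable]: "(\<lambda>(s, \<omega>). S s \<omega>) \<in> borel_measurable (borel \<Otimes>\<^sub>M M)"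
    unfolding S_def using simple_process_jointly_measurable[OF S(1)] simple_process_jointly_measurable[OF S(2)]
    by (simp add: split_beta')
  have Bjm[measurable]: "(\<lambda>(s, \<omega>). indicator (B s) \<omega> :: ennreal) \<in> borel_measurable (borel \<Otimes>\<^sub>M M)"
    using B by (simp add: stopping_family_def)
  have Vm[measurable]: "V \<in> borel_measurable M"
    unfolding V_def by (intro lborel.borel_measurable_nn_integral) measurable
  have Bb: "B b \<in> sets M" using B sets_F[of b] b by (auto simp: stopping_family_def)
  have g0: "0 \<le> grid b l j" and gs: "grid b l j \<le> grid b l (Suc j)" for l j
    using grid_bounds(1)[OF b] grid_step_nonneg[OF b] by auto
  have gm: "i \<le> j \<Longrightarrow> grid b l i \<le> grid b l j" for l i j
    by (rule grid_mono[of j]) (use gs in auto)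
  have a0: "0 \<le> a l j \<omega>" for l j \<omega> using gs[of l j] by (simp add: a_def)
  have \<eta>m: "\<eta> l i \<in> borel_measurable (F (grid b l j))" if "i \<le> j" "j \<le> l" for l i j
  proof (rule F_mono[OF g0 gm[OF that(1)]])
    have "B (grid b l i) \<in> sets (F (grid b l i))"
      using B g0 grid_bounds(2)[OF b, of i l] that by (auto simp: stopping_family_def)
    moreover have "S (grid b l i) \<in> borel_measurable (F (grid b l i))"
      unfolding S_def using simple_process_measurable[OF S(1) g0] simple_process_measurable[OF S(2) g0]
      by (rule borel_measurable_diff)
    ultimately show "\<eta> l i \<in> borel_measurable (F (grid b l i))"
      unfolding \<eta>_def by (intro borel_measurable_scaleR borel_measurable_indicator) auto
  qed
  have simp_\<zeta>: "simple_integrand M F b (Suc l) (grid b l) (\<zeta> l)" for l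
    unfolding simple_integrand_def
  proof (intro conjI allI impI)
    show "0 \<le> grid b l 0" "grid b l (Suc l) \<le> b" using g0 grid_bounds(2)[OF b, of "Suc l" l] by auto
    fix j assume j: "j < Suc l"
    show "grid b l j \<le> grid b l (Suc j)" by (rule gs)
    have [measurable]: "\<eta> l i \<in> borel_measurable (F (grid b l j))" if "i < Suc j" for i
      using \<eta>m[of i j l] j that by auto
    have [measurable]: "(\<lambda>\<omega>. \<Sum>i<Suc j. a l i \<omega>) \<in> borel_measurable (F (grid b l j))"
      unfolding a_def by (intro borel_measurable_sum) measurable
    show "\<zeta> l j \<in> borel_measurable (F (grid b l j))"
      unfolding \<zeta>_def by (intro measurable_If) (use \<eta>m[of j j l] j in measurable)
    have "norm (\<zeta> l j \<omega>) \<le> K + K'" if "\<omega> \<in> space M" for \<omega>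
      using SK[OF that, of "grid b l j"] KK[OF that] by (auto simp: \<zeta>_def \<eta>_def indicator_def)
    then show "bounded (\<zeta> l j ` space M)" by (auto simp: bounded_iff)
  qed
  define A where "A l \<omega> = (\<Sum>j<Suc l. a l j \<omega>)" for l \<omega>
  have Am[measurable]: "A l \<in> borel_measurable M" for l
  proof -
    have "\<eta> l j \<in> borel_measurable M" if "j < Suc l" for j
      by (rule F_measurable[OF g0 \<eta>m[of j j l]]) (use that in auto)
    then show ?thesis unfolding A_def a_def
      by (intro borel_measurable_sum borel_measurable_times borel_measurable_power borel_measurable_norm) auto
  qed
  have le: "(\<integral>\<^sup>+\<omega>. ennreal (norm (simple_ito_integral W (Suc l) (grid b l) (\<zeta> l) \<omega>) ^ (2 * N)) \<partial>M) \<le>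
     ennreal C * (\<integral>\<^sup>+\<omega>. (min (ennreal R) (ennreal (A l \<omega>))) ^ N \<partial>M)" for l
  proof -
    have "(\<Sum>j<Suc l. (norm (\<zeta> l j \<omega>))\<^sup>2 * (grid b l (Suc j) - grid b l j)) \<le> min R (A l \<omega>)" for \<omega>
    proof -
      have "(\<Sum>j<Suc l. (norm (\<zeta> l j \<omega>))\<^sup>2 * (grid b l (Suc j) - grid b l j)) =
        (\<Sum>j<Suc l. if (\<Sum>i<Suc j. a l i \<omega>) \<le> R then a l j \<omega> else 0)"
        by (intro sum.cong refl) (simp add: \<zeta>_def a_def del: sum.lessThan_Suc)
      also have "\<dots> \<le> min R (A l \<omega>)" unfolding A_def by (rule truncated_sum_le[OF a0 R])
      finally show ?thesis .
    qed
    then have le1: "ennreal ((\<Sum>j<Suc l. (norm (\<zeta> l j \<omega>))\<^sup>2 * (grid b l (Suc j) - grid b l j)) ^ N) \<le>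
       (min (ennreal R) (ennreal (A l \<omega>))) ^ N" for \<omega>
    proof -
      have "0 \<le> min R (A l \<omega>)" using R a0 unfolding A_def by (intro min.boundedI sum_nonneg) auto
      have "ennreal ((\<Sum>j<Suc l. (norm (\<zeta> l j \<omega>))\<^sup>2 * (grid b l (Suc j) - grid b l j)) ^ N) \<le> ennreal (min R (A l \<omega>) ^ N)"
        using gs \<open>\<And>\<omega>. _ \<le> min R (A l \<omega>)\<close> by (intro ennreal_leI power_mono sum_nonneg) auto
      also have "\<dots> = (min (ennreal R) (ennreal (A l \<omega>))) ^ N"
        using \<open>0 \<le> min R (A l \<omega>)\<close> by (simp add: min_ennreal ennreal_power)
      finally show ?thesis .
    qed
    show ?thesis
      by (rule order.trans[OF moment[unfolded simple_moment_constant_def, THEN conjunct2, rule_format, OF simp_\<zeta>[of l]]])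
         (intro mult_left_mono nn_integral_mono le1, simp)
  qed
  have AV: "(\<lambda>l. ennreal (A l \<omega>)) \<longlonglongrightarrow> V \<omega>" if \<omega>: "\<omega> \<in> space M" for \<omega>
    unfolding A_def a_def \<eta>_def V_def
  proof (rule sampled_energy_tendsto[OF b B \<omega>])
    show "norm (S s \<omega>) \<le> K + K'" for s by (rule SK[OF \<omega>])
    show "(\<lambda>s. norm (S s \<omega>)) \<in> borel_measurable borel"
      by (rule measurable_compose[OF section_measurable[OF Sjm \<omega>] borel_measurable_norm])
    fix w :: "nat \<Rightarrow> real" and s assume w: "\<And>l. w l \<le> s" "w \<longlonglongrightarrow> s"
    show "\<forall>\<^sub>F l in sequentially. S (w l) \<omega> = S s \<omega>"
      using simple_process_left_limit[OF w, of n u \<xi> \<omega>] simple_process_left_limit[OF w, of n' u' \<xi>' \<omega>]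
      by eventually_elim (simp add: S_def)
  qed
  have "AE \<omega> in M. continuous_on {0..} (\<lambda>t. W t \<omega>)"
    using wiener by (simp add: wiener_process_def)
  then have lim: "AE \<omega> in M. indicator {\<omega>\<in>B b. V \<omega> < ennreal R} \<omega> * ennreal (norm (J \<omega>) ^ (2 * N)) \<le>
     liminf (\<lambda>l. ennreal (norm (simple_ito_integral W (Suc l) (grid b l) (\<zeta> l) \<omega>) ^ (2 * N)))"
  proof eventually_elim
    case W: (elim \<omega>)
    show ?case
    proof (cases "\<omega> \<in> B b \<and> V \<omega> < ennreal R")
      case False
      then have "indicator {\<omega>\<in>B b. V \<omega> < ennreal R} \<omega> = (0::ennreal)" by (simp add: indicator_def)
      then show ?thesis by (simp only: mult_zero_left zero_le)
    next
      case True
      then have \<omega>: "\<omega> \<in> space M" using Bb sets.sets_into_space by auto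
      \<comment> \<open>The sampled energies converge to a value strictly below \<open>R\<close>, so
        the truncation at \<open>R\<close> is inactive for large \<open>l\<close>; membership in
        \<open>B b\<close> gives membership in all earlier events, so the stopping is inactive as
        well.\<close>
      have "\<forall>\<^sub>F l in sequentially. ennreal (A l \<omega>) < ennreal R"
        using order_tendstoD(2)[OF AV[OF \<omega>]] True by blast
      then have ev: "\<forall>\<^sub>F l in sequentially. simple_ito_integral W (Suc l) (grid b l) (\<zeta> l) \<omega> =
         simple_ito_integral W (Suc l) (grid b l) (\<lambda>j. simple_process n u \<xi> (grid b l j)) \<omega> -
         simple_ito_integral W (Suc l) (grid b l) (\<lambda>j. simple_process n' u' \<xi>' (grid b l j)) \<omega>"
      proof eventually_elim
        case (elim l)
        then have AR: "A l \<omega> \<le> R" using R ennreal_leI[of R "A l \<omega>"] by (meson linorder_not_le order.strict_iff_not)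
        have "\<zeta> l j \<omega> = S (grid b l j) \<omega>" if "j < Suc l" for j
        proof -
          have "(\<Sum>i<Suc j. a l i \<omega>) \<le> A l \<omega>"
            unfolding A_def using that a0 by (intro sum_mono2) auto
          moreover have "\<omega> \<in> B (grid b l j)"
            using True B g0[of l j] grid_bounds(2)[OF b, of j l] that unfolding stopping_family_def by auto
          ultimately show ?thesis using AR by (simp add: \<zeta>_def \<eta>_def del: sum.lessThan_Suc)
        qed
        then have "simple_ito_integral W (Suc l) (grid b l) (\<zeta> l) \<omega> =
           simple_ito_integral W (Suc l) (grid b l) (\<lambda>j. S (grid b l j)) \<omega>"
          unfolding simple_ito_integral_def by (intro sum.cong refl) auto
        then show ?case
          by (simp add: S_def simple_ito_integral_def matrix_vector_mult_diff_rdistrib sum_subtractf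
              del: sum.lessThan_Suc)
      qed
      have "(\<lambda>l. simple_ito_integral W (Suc l) (grid b l) (\<zeta> l) \<omega>) \<longlonglongrightarrow> J \<omega>"
        unfolding tendsto_cong[OF ev] J_def
        by (intro tendsto_diff simple_integral_grid_tendsto W b)
           (use S in \<open>auto simp: simple_integrand_def\<close>)
      then have "(\<lambda>l. ennreal (norm (simple_ito_integral W (Suc l) (grid b l) (\<zeta> l) \<omega>) ^ (2 * N)))
          \<longlonglongrightarrow> ennreal (norm (J \<omega>) ^ (2 * N))"
        by (intro tendsto_ennrealI tendsto_power tendsto_norm)
      from lim_imp_Liminf[OF trivial_limit_sequentially this] show ?thesis using True by simp
    qed
  qed
  have \<zeta>im: "(\<lambda>\<omega>. ennreal (norm (simple_ito_integral W (Suc l) (grid b l) (\<zeta> l) \<omega>) ^ (2 * N))) \<in> borel_measurable M" for l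
    using simple_ito_measurable[OF simp_\<zeta>[of l]] by measurable
  have "(\<integral>\<^sup>+\<omega>. indicator {\<omega>\<in>B b. V \<omega> < ennreal R} \<omega> * ennreal (norm (J \<omega>) ^ (2 * N)) \<partial>M) \<le>
     (\<integral>\<^sup>+\<omega>. liminf (\<lambda>l. ennreal (norm (simple_ito_integral W (Suc l) (grid b l) (\<zeta> l) \<omega>) ^ (2 * N))) \<partial>M)"
    by (rule nn_integral_mono_AE[OF lim])
  also have "\<dots> \<le> liminf (\<lambda>l. \<integral>\<^sup>+\<omega>. ennreal (norm (simple_ito_integral W (Suc l) (grid b l) (\<zeta> l) \<omega>) ^ (2 * N)) \<partial>M)"
    by (rule nn_integral_liminf[OF \<zeta>im])
  also have "\<dots> \<le> liminf (\<lambda>l. ennreal C * (\<integral>\<^sup>+\<omega>. (min (ennreal R) (ennreal (A l \<omega>))) ^ N \<partial>M))"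
    by (intro Liminf_mono always_eventually allI le)
  also have "\<dots> = ennreal C * (\<integral>\<^sup>+\<omega>. (min (ennreal R) (V \<omega>)) ^ N \<partial>M)"
  proof (rule lim_imp_Liminf)
    have "(\<lambda>l. \<integral>\<^sup>+\<omega>. (min (ennreal R) (ennreal (A l \<omega>))) ^ N \<partial>M) \<longlonglongrightarrow> (\<integral>\<^sup>+\<omega>. (min (ennreal R) (V \<omega>)) ^ N \<partial>M)"
    proof (rule nn_integral_dominated_convergence)
      show "(\<integral>\<^sup>+\<omega>. ennreal R ^ N \<partial>M) < \<infinity>" using R by (simp add: emeasure_space_1 ennreal_power)
      show "AE \<omega> in M. (min (ennreal R) (ennreal (A l \<omega>))) ^ N \<le> ennreal R ^ N" for l
        by (intro AE_I2 power_mono) auto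
      show "AE \<omega> in M. (\<lambda>l. (min (ennreal R) (ennreal (A l \<omega>))) ^ N) \<longlonglongrightarrow> (min (ennreal R) (V \<omega>)) ^ N"
        by (intro AE_I2 tendsto_ennreal_power tendsto_min tendsto_const AV) (auto simp: min_less_iff_disj)
    qed measurable
    then show "(\<lambda>l. ennreal C * (\<integral>\<^sup>+\<omega>. (min (ennreal R) (ennreal (A l \<omega>))) ^ N \<partial>M))
       \<longlonglongrightarrow> ennreal C * (\<integral>\<^sup>+\<omega>. (min (ennreal R) (V \<omega>)) ^ N \<partial>M)"
      by (intro ennreal_tendsto_cmult) auto
  qed simp
  finally show ?thesis .
qed

section \<open>Convergence in probability and stopped Ito integrals\<close>

lemma measurable_AE_cong:
  fixes f g :: "'a \<Rightarrow> 'v :: topological_space"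
  assumes f: "f \<in> borel_measurable M" and eq: "AE \<omega> in M. f \<omega> = g \<omega>"
  shows "g \<in> borel_measurable M"
proof (rule measurableI)
  fix A :: "'v set" assume A: "A \<in> sets borel"
  show "g -` A \<inter> space M \<in> sets M"
  proof (rule complete_measure.in_sets_AE[OF complete])
    show "AE \<omega> in M. \<omega> \<in> f -` A \<inter> space M \<longleftrightarrow> \<omega> \<in> g -` A \<inter> space M"
      using eq by eventually_elim auto
    show "f -` A \<inter> space M \<in> sets M" using f A by (rule measurable_sets)
  qed auto
qed simp

text \<open>For values in [0, 1] the mean is at most e + P(Z > e). This converts convergence in
  probability into convergence in mean, from which an almost surely convergent subsequence can be
  drawn.\<close>

lemma expectation_tendsto_0:
  fixes Z :: "nat \<Rightarrow> 'a \<Rightarrow> real"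
  assumes Z: "\<And>k. Z k \<in> borel_measurable M" "\<And>k \<omega>. 0 \<le> Z k \<omega>" "\<And>k \<omega>. Z k \<omega> \<le> 1"
    and lim: "\<And>e. 0 < e \<Longrightarrow> e < 1 \<Longrightarrow> (\<lambda>k. \<P>(\<omega> in M. e < Z k \<omega>)) \<longlonglongrightarrow> 0"
  shows "(\<lambda>k. expectation (Z k)) \<longlonglongrightarrow> 0"
proof (rule LIMSEQ_I)
  fix d :: real assume d: "0 < d"
  define e where "e = min (d / 2) (1 / 2)"
  have e: "0 < e" "e < 1" "e \<le> d / 2" using d by (auto simp: e_def)
  note Z(1)[measurable]
  have le: "expectation (Z k) \<le> e + \<P>(\<omega> in M. e < Z k \<omega>)" for k
  proof -
    have "expectation (Z k) \<le> expectation (\<lambda>\<omega>. e + indicator {\<omega>\<in>space M. e < Z k \<omega>} \<omega>)"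
    proof (rule integral_mono)
      show "integrable M (Z k)" using Z by (intro integrable_const_bound[of _ 1]) auto
      show "integrable M (\<lambda>\<omega>. e + indicator {\<omega>\<in>space M. e < Z k \<omega>} \<omega>)"
        using e by (intro integrable_const_bound[of _ "e + 1"]) (auto simp: indicator_def)
      fix \<omega> assume "\<omega> \<in> space M"
      then show "Z k \<omega> \<le> e + indicator {\<omega>\<in>space M. e < Z k \<omega>} \<omega>"
        using Z(3)[of k \<omega>] e by (auto simp: indicator_def)
    qed
    also have "\<dots> = e + \<P>(\<omega> in M. e < Z k \<omega>)"
      by (subst Bochner_Integration.integral_add)
         (auto simp: prob_space intro!: integrable_const_bound[of _ 1])
    finally show ?thesis .
  qed
  have "\<forall>\<^sub>F k in sequentially. \<P>(\<omega> in M. e < Z k \<omega>) < d / 2"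
    using order_tendstoD(2)[OF lim[OF e(1,2)], of "d / 2"] d by simp
  then obtain K where K: "\<And>k. K \<le> k \<Longrightarrow> \<P>(\<omega> in M. e < Z k \<omega>) < d / 2"
    by (auto simp: eventually_sequentially)
  show "\<exists>K. \<forall>k\<ge>K. norm (expectation (Z k) - 0) < d"
  proof (intro exI[of _ K] allI impI)
    fix k assume "K \<le> k"
    then have "expectation (Z k) < d" using K[of k] le[of k] e by linarith
    moreover have "0 \<le> expectation (Z k)" using Z(2) by simp
    ultimately show "norm (expectation (Z k) - 0) < d" by simp
  qed
qed

lemma tendsto_0_ennreal_cap:
  fixes D :: "nat \<Rightarrow> ennreal"
  assumes "(\<lambda>k. enn2real (min 1 (D k))) \<longlonglongrightarrow> 0"
  shows "D \<longlonglongrightarrow> 0"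
proof -
  have eq: "ennreal (enn2real (min 1 (D k))) = min 1 (D k)" for k
    by (intro ennreal_enn2real) (simp add: min_less_iff_disj)
  have "(\<lambda>k. min 1 (D k)) \<longlonglongrightarrow> 0"
    using tendsto_ennrealI[OF assms] unfolding eq by simp
  moreover have "\<forall>\<^sub>F k in sequentially. min 1 (D k) < 1"
    using order_tendstoD(2)[OF \<open>(\<lambda>k. min 1 (D k)) \<longlonglongrightarrow> 0\<close>, of 1] by simp
  then have "\<forall>\<^sub>F k in sequentially. min 1 (D k) = D k"
    by eventually_elim (auto simp: min_def split: if_splits)
  ultimately show ?thesis by (simp add: tendsto_cong)
qed

lemma norm_sum_sq_le: "(norm (x + y :: 'v :: real_normed_vector))\<^sup>2 \<le> 2 * (norm x)\<^sup>2 + 2 * (norm y)\<^sup>2"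
proof -
  have "(norm (x + y))\<^sup>2 \<le> (norm x + norm y)\<^sup>2" by (intro power_mono norm_triangle_ineq) auto
  also have "\<dots> \<le> 2 * (norm x)\<^sup>2 + 2 * (norm y)\<^sup>2"
    using sum_squares_bound[of "norm x" "norm y"] by (simp add: power2_sum)
  finally show ?thesis .
qed

text \<open>An Ito integral is given by its approximations in probability only, so the moment bound
  for simple processes is transferred along an almost surely convergent subsequence. Truncating
  the approximations in \<open>stopped_simple_moment\<close> makes the right-hand sides converge.\<close>

lemma stopped_ito_moment:
  fixes X1 X2 :: "'a \<Rightarrow> real ^ 'd" and \<Phi>1 \<Phi>2 :: "real \<Rightarrow> 'a \<Rightarrow> real ^ 'r ^ 'd"
  assumes moment: "simple_moment_constant TYPE('d) N C"
    and b: "0 < b" and B: "stopping_family b B"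
    and I1: "has_ito_integral M F W b \<Phi>1 X1" and I2: "has_ito_integral M F W b \<Phi>2 X2"
    and \<psi>: "(\<lambda>(s, \<omega>). \<psi>1 s \<omega>) \<in> borel_measurable (borel \<Otimes>\<^sub>M M)" "(\<lambda>(s, \<omega>). \<psi>2 s \<omega>) \<in> borel_measurable (borel \<Otimes>\<^sub>M M)"
    and eq: "AE \<omega> in M. \<forall>s\<in>{0..b}. \<Phi>1 s \<omega> = \<psi>1 s \<omega>" "AE \<omega> in M. \<forall>s\<in>{0..b}. \<Phi>2 s \<omega> = \<psi>2 s \<omega>"
  defines "V \<equiv> \<lambda>\<omega>. \<integral>\<^sup>+s\<in>{0..b}. ennreal ((norm (\<psi>1 s \<omega> - \<psi>2 s \<omega>))\<^sup>2) * indicator (B s) \<omega> \<partial>lborel"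
  assumes R: "0 \<le> R" "AE \<omega> in M. V \<omega> \<le> ennreal R"
  shows "(\<integral>\<^sup>+\<omega>. indicator (B b) \<omega> * ennreal (norm (X1 \<omega> - X2 \<omega>) ^ (2 * N)) \<partial>M) \<le>
     ennreal (C * 2 ^ N) * (\<integral>\<^sup>+\<omega>. V \<omega> ^ N \<partial>M)"
proof -
  have C: "0 \<le> C" using moment by (simp add: simple_moment_constant_def)
  note \<psi>[measurable]
  have Bjm[measurable]: "(\<lambda>(s, \<omega>). indicator (B s) \<omega> :: ennreal) \<in> borel_measurable (borel \<Otimes>\<^sub>M M)"
    using B by (simp add: stopping_family_def)
  have X[measurable]: "X1 \<in> borel_measurable M" "X2 \<in> borel_measurable M"
    using I1 I2 by (auto simp: has_ito_integral_def)
  have Bb[measurable]: "B b \<in> sets M" using B sets_F[of b] b by (auto simp: stopping_family_def)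
  obtain n1 u1 \<xi>1 where S1: "\<And>k. simple_integrand M F b (n1 k) (u1 k) (\<xi>1 k)"
    and D1: "\<And>e. e > 0 \<Longrightarrow> (\<lambda>k. \<P>(\<omega> in M. ennreal e <
            (\<integral>\<^sup>+s\<in>{0..b}. ennreal ((norm (simple_process (n1 k) (u1 k) (\<xi>1 k) s \<omega> - \<Phi>1 s \<omega>))\<^sup>2) \<partial>lborel))) \<longlonglongrightarrow> 0"
    and J1: "\<And>e. e > 0 \<Longrightarrow> (\<lambda>k. \<P>(\<omega> in M. e < norm (simple_ito_integral W (n1 k) (u1 k) (\<xi>1 k) \<omega> - X1 \<omega>))) \<longlonglongrightarrow> 0"
    using I1 unfolding has_ito_integral_def by blast
  obtain n2 u2 \<xi>2 where S2: "\<And>k. simple_integrand M F b (n2 k) (u2 k) (\<xi>2 k)"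
    and D2: "\<And>e. e > 0 \<Longrightarrow> (\<lambda>k. \<P>(\<omega> in M. ennreal e <
            (\<integral>\<^sup>+s\<in>{0..b}. ennreal ((norm (simple_process (n2 k) (u2 k) (\<xi>2 k) s \<omega> - \<Phi>2 s \<omega>))\<^sup>2) \<partial>lborel))) \<longlonglongrightarrow> 0"
    and J2: "\<And>e. e > 0 \<Longrightarrow> (\<lambda>k. \<P>(\<omega> in M. e < norm (simple_ito_integral W (n2 k) (u2 k) (\<xi>2 k) \<omega> - X2 \<omega>))) \<longlonglongrightarrow> 0"
    using I2 unfolding has_ito_integral_def by blast
  define P1 where "P1 k = simple_process (n1 k) (u1 k) (\<xi>1 k)" for k
  define P2 where "P2 k = simple_process (n2 k) (u2 k) (\<xi>2 k)" for k
  define Q1 where "Q1 k = simple_ito_integral W (n1 k) (u1 k) (\<xi>1 k)" for k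
  define Q2 where "Q2 k = simple_ito_integral W (n2 k) (u2 k) (\<xi>2 k)" for k
  have Pm[measurable]: "(\<lambda>(s, \<omega>). P1 k s \<omega>) \<in> borel_measurable (borel \<Otimes>\<^sub>M M)" "(\<lambda>(s, \<omega>). P2 k s \<omega>) \<in> borel_measurable (borel \<Otimes>\<^sub>M M)" for k
    unfolding P1_def P2_def by (rule simple_process_jointly_measurable[OF S1] simple_process_jointly_measurable[OF S2])+
  have Qm[measurable]: "Q1 k \<in> borel_measurable M" "Q2 k \<in> borel_measurable M" for k
    unfolding Q1_def Q2_def by (rule simple_ito_measurable[OF S1] simple_ito_measurable[OF S2])+
  define E1 where "E1 k \<omega> = (\<integral>\<^sup>+s\<in>{0..b}. ennreal ((norm (P1 k s \<omega> - \<Phi>1 s \<omega>))\<^sup>2) \<partial>lborel)" for k \<omega>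
  define E2 where "E2 k \<omega> = (\<integral>\<^sup>+s\<in>{0..b}. ennreal ((norm (P2 k s \<omega> - \<Phi>2 s \<omega>))\<^sup>2) \<partial>lborel)" for k \<omega>
  \<comment> \<open>The integrands \<open>\<Phi>1\<close>, \<open>\<Phi>2\<close> are jointly
    measurable only for a completed product; the energies formed with the Borel versions
    \<open>\<psi>1\<close>, \<open>\<psi>2\<close> are measurable by Tonelli's theorem and agree
    almost surely with those of the definition.\<close>
  define E1' where "E1' k \<omega> = (\<integral>\<^sup>+s\<in>{0..b}. ennreal ((norm (P1 k s \<omega> - \<psi>1 s \<omega>))\<^sup>2) \<partial>lborel)" for k \<omega>
  define E2' where "E2' k \<omega> = (\<integral>\<^sup>+s\<in>{0..b}. ennreal ((norm (P2 k s \<omega> - \<psi>2 s \<omega>))\<^sup>2) \<partial>lborel)" for k \<omega>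
  have E'm[measurable]: "E1' k \<in> borel_measurable M" "E2' k \<in> borel_measurable M" for k
    unfolding E1'_def E2'_def by (intro lborel.borel_measurable_nn_integral; measurable)+
  have ae1: "AE \<omega> in M. \<forall>k. E1' k \<omega> = E1 k \<omega>"
    using eq(1) by eventually_elim (auto simp: E1'_def E1_def intro!: nn_integral_cong split: split_indicator)
  have ae2: "AE \<omega> in M. \<forall>k. E2' k \<omega> = E2 k \<omega>"
    using eq(2) by eventually_elim (auto simp: E2'_def E2_def intro!: nn_integral_cong split: split_indicator)
  \<comment> \<open>Completeness of \<open>M\<close> passes measurability to an almost surely equal
    function.\<close>
  have Em[measurable]: "E1 k \<in> borel_measurable M" "E2 k \<in> borel_measurable M" for k
    by (rule measurable_AE_cong[OF E'm(1)[of k]], use ae1 in eventually_elim, simp)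
       (rule measurable_AE_cong[OF E'm(2)[of k]], use ae2 in eventually_elim, simp)
  have cap: "e < enn2real (min 1 D) \<longleftrightarrow> ennreal e < D" if "0 < e" "e < 1" for e D
  proof -
    have "e < enn2real (min 1 D) \<longleftrightarrow> ennreal e < ennreal (enn2real (min 1 D))"
      using that by (simp add: ennreal_less_iff)
    also have "ennreal (enn2real (min 1 D)) = min 1 D" by (intro ennreal_enn2real) (simp add: min_less_iff_disj)
    also have "ennreal e < min 1 D \<longleftrightarrow> ennreal e < D" using that ennreal_less_iff[of e 1] by simp
    finally show ?thesis .
  qed
  \<comment> \<open>All four errors, capped at 1, are added into one sequence, so that a single
    subsequence serves both integrands and both integrals.\<close>
  define q where "q k \<omega> = enn2real (min 1 (E1 k \<omega>)) + enn2real (min 1 (E2 k \<omega>)) +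
     min 1 (norm (Q1 k \<omega> - X1 \<omega>)) + min 1 (norm (Q2 k \<omega> - X2 \<omega>))" for k \<omega>
  have enn1: "enn2real (min 1 D) \<le> 1" for D
    using enn2real_mono[of "min 1 D" 1] by simp
  have i: "integrable M (\<lambda>\<omega>. enn2real (min 1 (E1 k \<omega>)))" "integrable M (\<lambda>\<omega>. enn2real (min 1 (E2 k \<omega>)))"
    "integrable M (\<lambda>\<omega>. min 1 (norm (Q1 k \<omega> - X1 \<omega>)))" "integrable M (\<lambda>\<omega>. min 1 (norm (Q2 k \<omega> - X2 \<omega>)))" for k
    by (rule integrable_const_bound[of _ 1]; (simp add: enn1)?)+
  have qi: "integrable M (q k)" for k
    unfolding q_def[abs_def] by (intro Bochner_Integration.integrable_add i)
  have l1: "(\<lambda>k. expectation (\<lambda>\<omega>. enn2real (min 1 (E1 k \<omega>)))) \<longlonglongrightarrow> 0"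
  proof (rule expectation_tendsto_0)
    show "(\<lambda>k. \<P>(\<omega> in M. e < enn2real (min 1 (E1 k \<omega>)))) \<longlonglongrightarrow> 0" if "0 < e" "e < 1" for e
      using D1[OF that(1)] by (simp add: cap[OF that] E1_def P1_def)
  qed (simp_all add: enn1)
  have l2: "(\<lambda>k. expectation (\<lambda>\<omega>. enn2real (min 1 (E2 k \<omega>)))) \<longlonglongrightarrow> 0"
  proof (rule expectation_tendsto_0)
    show "(\<lambda>k. \<P>(\<omega> in M. e < enn2real (min 1 (E2 k \<omega>)))) \<longlonglongrightarrow> 0" if "0 < e" "e < 1" for e
      using D2[OF that(1)] by (simp add: cap[OF that] E2_def P2_def)
  qed (simp_all add: enn1)
  have l3: "(\<lambda>k. expectation (\<lambda>\<omega>. min 1 (norm (Q1 k \<omega> - X1 \<omega>)))) \<longlonglongrightarrow> 0"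
  proof (rule expectation_tendsto_0)
    show "(\<lambda>k. \<P>(\<omega> in M. e < min 1 (norm (Q1 k \<omega> - X1 \<omega>)))) \<longlonglongrightarrow> 0" if "0 < e" "e < 1" for e
      using J1[OF that(1)] that by (simp add: Q1_def)
  qed simp_all
  have l4: "(\<lambda>k. expectation (\<lambda>\<omega>. min 1 (norm (Q2 k \<omega> - X2 \<omega>)))) \<longlonglongrightarrow> 0"
  proof (rule expectation_tendsto_0)
    show "(\<lambda>k. \<P>(\<omega> in M. e < min 1 (norm (Q2 k \<omega> - X2 \<omega>)))) \<longlonglongrightarrow> 0" if "0 < e" "e < 1" for e
      using J2[OF that(1)] that by (simp add: Q2_def)
  qed simp_all
  have q0: "0 \<le> q k \<omega>" for k \<omega> by (auto simp: q_def)
  have "(\<lambda>k. expectation (\<lambda>\<omega>. norm (q k \<omega>))) \<longlonglongrightarrow> 0"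
  proof -
    have "expectation (\<lambda>\<omega>. norm (q k \<omega>)) = expectation (\<lambda>\<omega>. enn2real (min 1 (E1 k \<omega>))) + expectation (\<lambda>\<omega>. enn2real (min 1 (E2 k \<omega>))) +
       expectation (\<lambda>\<omega>. min 1 (norm (Q1 k \<omega> - X1 \<omega>))) + expectation (\<lambda>\<omega>. min 1 (norm (Q2 k \<omega> - X2 \<omega>)))" for k
      using q0 i[of k] unfolding real_norm_def abs_of_nonneg[OF q0] unfolding q_def by simp
    then show ?thesis using tendsto_add[OF tendsto_add[OF tendsto_add[OF l1 l2] l3] l4] by simp
  qed
  from tendsto_L1_AE_subseq[OF qi this] obtain r where r: "AE \<omega> in M. (\<lambda>k. q (r k) \<omega>) \<longlonglongrightarrow> 0"
    by blast
  have conv: "AE \<omega> in M. (\<lambda>k. E1' (r k) \<omega>) \<longlonglongrightarrow> 0 \<and> (\<lambda>k. E2' (r k) \<omega>) \<longlonglongrightarrow> 0 \<and>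
     (\<lambda>k. Q1 (r k) \<omega>) \<longlonglongrightarrow> X1 \<omega> \<and> (\<lambda>k. Q2 (r k) \<omega>) \<longlonglongrightarrow> X2 \<omega>"
    using r ae1 ae2
  proof eventually_elim
    case (elim \<omega>)
    have sq: "h \<longlonglongrightarrow> 0" if "\<And>k. 0 \<le> h k" "\<And>k. h k \<le> q (r k) \<omega>" for h :: "nat \<Rightarrow> real"
      by (rule tendsto_sandwich[OF _ _ tendsto_const elim(1)]) (use that in auto)
    have e1: "(\<lambda>k. E1 (r k) \<omega>) \<longlonglongrightarrow> 0"
      by (rule tendsto_0_ennreal_cap, rule sq) (auto simp: q_def)
    have e2: "(\<lambda>k. E2 (r k) \<omega>) \<longlonglongrightarrow> 0"
      by (rule tendsto_0_ennreal_cap, rule sq) (auto simp: q_def)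
    have c: "(\<lambda>k. g k) \<longlonglongrightarrow> x" if "(\<lambda>k. min 1 (norm (g k - x))) \<longlonglongrightarrow> 0" for g :: "nat \<Rightarrow> real ^ 'd" and x
    proof -
      have "\<forall>\<^sub>F k in sequentially. min 1 (norm (g k - x)) < 1" using order_tendstoD(2)[OF that] by simp
      then have "\<forall>\<^sub>F k in sequentially. min 1 (norm (g k - x)) = norm (g k - x)"
        by eventually_elim (auto simp: min_def split: if_splits)
      then have "(\<lambda>k. norm (g k - x)) \<longlonglongrightarrow> 0" using that by (simp add: tendsto_cong)
      then show ?thesis by (simp add: tendsto_norm_zero_iff LIM_zero_iff)
    qed
    have "(\<lambda>k. Q1 (r k) \<omega>) \<longlonglongrightarrow> X1 \<omega>" "(\<lambda>k. Q2 (r k) \<omega>) \<longlonglongrightarrow> X2 \<omega>"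
      by (rule c, rule sq, simp, simp add: q_def)+
    then show ?case using e1 e2 elim by auto
  qed
  \<comment> \<open>The energy of the approximations is at most 2 * V plus errors that tend to 0,
    and 2 * V is at most 2 * R. The additional 1 makes the inequality strict, so that it holds
    eventually along the subsequence.\<close>
  define R' where "R' = 2 * R + 1"
  have "0 \<le> R'" using R by (simp add: R'_def)
  define V' where "V' k \<omega> = (\<integral>\<^sup>+s\<in>{0..b}. ennreal ((norm (P1 k s \<omega> - P2 k s \<omega>))\<^sup>2) * indicator (B s) \<omega> \<partial>lborel)" for k \<omega>
  have Vm[measurable]: "V \<in> borel_measurable M" "V' k \<in> borel_measurable M" for k
    unfolding V_def V'_def by (intro lborel.borel_measurable_nn_integral; measurable)+
  have V'le: "V' k \<omega> \<le> 2 * V \<omega> + (4 * E1' k \<omega> + 4 * E2' k \<omega>)" if \<omega>[measurable]: "\<omega> \<in> space M" for k \<omega>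
  proof -
    have [measurable]: "(\<lambda>s. P1 k s \<omega>) \<in> borel_measurable borel" "(\<lambda>s. P2 k s \<omega>) \<in> borel_measurable borel"
      "(\<lambda>s. \<psi>1 s \<omega>) \<in> borel_measurable borel" "(\<lambda>s. \<psi>2 s \<omega>) \<in> borel_measurable borel"
      "(\<lambda>s. indicator (B s) \<omega> :: ennreal) \<in> borel_measurable borel"
      by (rule section_measurable[OF _ \<omega>]; fact Pm \<psi> Bjm)+
    have "V' k \<omega> \<le> (\<integral>\<^sup>+s. 2 * (ennreal ((norm (\<psi>1 s \<omega> - \<psi>2 s \<omega>))\<^sup>2) * indicator (B s) \<omega> * indicator {0..b} s) +
        (4 * (ennreal ((norm (P1 k s \<omega> - \<psi>1 s \<omega>))\<^sup>2) * indicator {0..b} s) +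
         4 * (ennreal ((norm (P2 k s \<omega> - \<psi>2 s \<omega>))\<^sup>2) * indicator {0..b} s)) \<partial>lborel)"
      unfolding V'_def
    proof (rule nn_integral_mono)
      fix s
      have "(norm (P1 k s \<omega> - P2 k s \<omega>))\<^sup>2 \<le> 2 * (norm (\<psi>1 s \<omega> - \<psi>2 s \<omega>))\<^sup>2 +
        (4 * (norm (P1 k s \<omega> - \<psi>1 s \<omega>))\<^sup>2 + 4 * (norm (P2 k s \<omega> - \<psi>2 s \<omega>))\<^sup>2)"
        using norm_sum_sq_le[of "\<psi>1 s \<omega> - \<psi>2 s \<omega>" "(P1 k s \<omega> - \<psi>1 s \<omega>) - (P2 k s \<omega> - \<psi>2 s \<omega>)"]
          norm_sum_sq_le[of "P1 k s \<omega> - \<psi>1 s \<omega>" "- (P2 k s \<omega> - \<psi>2 s \<omega>)"]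
        unfolding norm_minus_cancel by (simp add: algebra_simps)
      then have "ennreal ((norm (P1 k s \<omega> - P2 k s \<omega>))\<^sup>2) \<le> ennreal (2 * (norm (\<psi>1 s \<omega> - \<psi>2 s \<omega>))\<^sup>2 +
        (4 * (norm (P1 k s \<omega> - \<psi>1 s \<omega>))\<^sup>2 + 4 * (norm (P2 k s \<omega> - \<psi>2 s \<omega>))\<^sup>2))"
        by (rule ennreal_leI)
      then have "ennreal ((norm (P1 k s \<omega> - P2 k s \<omega>))\<^sup>2) \<le> 2 * ennreal ((norm (\<psi>1 s \<omega> - \<psi>2 s \<omega>))\<^sup>2) +
        (4 * ennreal ((norm (P1 k s \<omega> - \<psi>1 s \<omega>))\<^sup>2) + 4 * ennreal ((norm (P2 k s \<omega> - \<psi>2 s \<omega>))\<^sup>2))"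
        by (simp add: ennreal_mult)
      then show "ennreal ((norm (P1 k s \<omega> - P2 k s \<omega>))\<^sup>2) * indicator (B s) \<omega> * indicator {0..b} s \<le>
        2 * (ennreal ((norm (\<psi>1 s \<omega> - \<psi>2 s \<omega>))\<^sup>2) * indicator (B s) \<omega> * indicator {0..b} s) +
        (4 * (ennreal ((norm (P1 k s \<omega> - \<psi>1 s \<omega>))\<^sup>2) * indicator {0..b} s) +
         4 * (ennreal ((norm (P2 k s \<omega> - \<psi>2 s \<omega>))\<^sup>2) * indicator {0..b} s))"
        by (simp split: split_indicator)
    qed
    also have "\<dots> = 2 * V \<omega> + (4 * E1' k \<omega> + 4 * E2' k \<omega>)"
      unfolding V_def E1'_def E2'_def
      by (subst nn_integral_add, measurable)+ (subst nn_integral_cmult, measurable)+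
    finally show ?thesis .
  qed
  have bound: "(\<integral>\<^sup>+\<omega>. indicator {\<omega>\<in>B b. V' k \<omega> < ennreal R'} \<omega> * ennreal (norm (Q1 k \<omega> - Q2 k \<omega>) ^ (2 * N)) \<partial>M) \<le>
     ennreal C * (\<integral>\<^sup>+\<omega>. (min (ennreal R') (V' k \<omega>)) ^ N \<partial>M)" for k
    unfolding V'_def P1_def P2_def Q1_def Q2_def
    by (rule stopped_simple_moment[OF moment b B _ S1 S2]) (use R in \<open>simp add: R'_def\<close>)
  have lim: "AE \<omega> in M. indicator (B b) \<omega> * ennreal (norm (X1 \<omega> - X2 \<omega>) ^ (2 * N)) \<le>
     liminf (\<lambda>k. indicator {\<omega>\<in>B b. V' (r k) \<omega> < ennreal R'} \<omega> * ennreal (norm (Q1 (r k) \<omega> - Q2 (r k) \<omega>) ^ (2 * N)))"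
    using conv R(2) AE_space
  proof eventually_elim
    case (elim \<omega>)
    show ?case
    proof (cases "\<omega> \<in> B b")
      case True
      have "(\<lambda>k. 2 * V \<omega> + (4 * E1' (r k) \<omega> + 4 * E2' (r k) \<omega>)) \<longlonglongrightarrow> 2 * V \<omega> + (4 * 0 + 4 * 0)"
        using elim by (intro tendsto_add tendsto_const ennreal_tendsto_cmult) auto
      moreover have "2 * V \<omega> < ennreal R'"
      proof -
        have "2 * V \<omega> \<le> ennreal (2 * R)" using elim R(1) mult_left_mono[of "V \<omega>" "ennreal R" 2] by (simp add: ennreal_mult)
        also have "\<dots> < ennreal R'" using R(1) by (simp add: R'_def ennreal_less_iff)
        finally show ?thesis .
      qed
      ultimately have "\<forall>\<^sub>F k in sequentially. 2 * V \<omega> + (4 * E1' (r k) \<omega> + 4 * E2' (r k) \<omega>) < ennreal R'"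
        using order_tendstoD(2) by fastforce
      then have ev: "\<forall>\<^sub>F k in sequentially. indicator {\<omega>\<in>B b. V' (r k) \<omega> < ennreal R'} \<omega> * ennreal (norm (Q1 (r k) \<omega> - Q2 (r k) \<omega>) ^ (2 * N)) =
         ennreal (norm (Q1 (r k) \<omega> - Q2 (r k) \<omega>) ^ (2 * N))"
      proof eventually_elim
        case (elim k)
        then have "V' (r k) \<omega> < ennreal R'" using V'le[OF \<open>\<omega> \<in> space M\<close>, of "r k"] by (rule le_less_trans[rotated])
        then show ?case using True by simp
      qed
      have "(\<lambda>k. ennreal (norm (Q1 (r k) \<omega> - Q2 (r k) \<omega>) ^ (2 * N))) \<longlonglongrightarrow> ennreal (norm (X1 \<omega> - X2 \<omega>) ^ (2 * N))"
        using elim by (intro tendsto_ennrealI tendsto_power tendsto_norm tendsto_diff) auto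
      then have "(\<lambda>k. indicator {\<omega>\<in>B b. V' (r k) \<omega> < ennreal R'} \<omega> * ennreal (norm (Q1 (r k) \<omega> - Q2 (r k) \<omega>) ^ (2 * N))) \<longlonglongrightarrow> ennreal (norm (X1 \<omega> - X2 \<omega>) ^ (2 * N))"
        unfolding tendsto_cong[OF ev] .
      from lim_imp_Liminf[OF trivial_limit_sequentially this] show ?thesis using True by simp
    qed simp
  qed
  have lim2: "(\<lambda>k. \<integral>\<^sup>+\<omega>. (min (ennreal R') (2 * V \<omega> + (4 * E1' (r k) \<omega> + 4 * E2' (r k) \<omega>))) ^ N \<partial>M)
      \<longlonglongrightarrow> (\<integral>\<^sup>+\<omega>. (min (ennreal R') (2 * V \<omega>)) ^ N \<partial>M)"
  proof (rule nn_integral_dominated_convergence)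
    show "(\<integral>\<^sup>+\<omega>. ennreal R' ^ N \<partial>M) < \<infinity>" using \<open>0 \<le> R'\<close> by (simp add: emeasure_space_1 ennreal_power)
    show "AE \<omega> in M. (min (ennreal R') (2 * V \<omega> + (4 * E1' (r k) \<omega> + 4 * E2' (r k) \<omega>))) ^ N \<le> ennreal R' ^ N" for k
      by (intro AE_I2 power_mono) auto
    show "AE \<omega> in M. (\<lambda>k. (min (ennreal R') (2 * V \<omega> + (4 * E1' (r k) \<omega> + 4 * E2' (r k) \<omega>))) ^ N) \<longlonglongrightarrow> (min (ennreal R') (2 * V \<omega>)) ^ N"
      using conv
    proof eventually_elim
      case (elim \<omega>)
      have "(\<lambda>k. 2 * V \<omega> + (4 * E1' (r k) \<omega> + 4 * E2' (r k) \<omega>)) \<longlonglongrightarrow> 2 * V \<omega> + (4 * 0 + 4 * 0)"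
        using elim by (intro tendsto_add tendsto_const ennreal_tendsto_cmult) auto
      then show ?case
        by (intro tendsto_ennreal_power tendsto_min tendsto_const) (auto simp: min_less_iff_disj)
    qed
  qed measurable
  have "(\<integral>\<^sup>+\<omega>. indicator (B b) \<omega> * ennreal (norm (X1 \<omega> - X2 \<omega>) ^ (2 * N)) \<partial>M) \<le>
    (\<integral>\<^sup>+\<omega>. liminf (\<lambda>k. indicator {\<omega>\<in>B b. V' (r k) \<omega> < ennreal R'} \<omega> * ennreal (norm (Q1 (r k) \<omega> - Q2 (r k) \<omega>) ^ (2 * N))) \<partial>M)"
    by (rule nn_integral_mono_AE[OF lim])
  also have "\<dots> \<le> liminf (\<lambda>k. \<integral>\<^sup>+\<omega>. indicator {\<omega>\<in>B b. V' (r k) \<omega> < ennreal R'} \<omega> * ennreal (norm (Q1 (r k) \<omega> - Q2 (r k) \<omega>) ^ (2 * N)) \<partial>M)"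
  proof (rule nn_integral_liminf)
    fix k
    have "{\<omega>\<in>B b. V' (r k) \<omega> < ennreal R'} = B b \<inter> {\<omega>\<in>space M. V' (r k) \<omega> < ennreal R'}"
      using sets.sets_into_space[OF Bb] by auto
    then have [measurable]: "{\<omega>\<in>B b. V' (r k) \<omega> < ennreal R'} \<in> sets M" by simp
    show "(\<lambda>\<omega>. indicator {\<omega>\<in>B b. V' (r k) \<omega> < ennreal R'} \<omega> * ennreal (norm (Q1 (r k) \<omega> - Q2 (r k) \<omega>) ^ (2 * N))) \<in> borel_measurable M"
      by measurable
  qed
  also have "\<dots> \<le> liminf (\<lambda>k. ennreal C * (\<integral>\<^sup>+\<omega>. (min (ennreal R') (2 * V \<omega> + (4 * E1' (r k) \<omega> + 4 * E2' (r k) \<omega>))) ^ N \<partial>M))"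
    by (intro Liminf_mono always_eventually allI order.trans[OF bound] mult_left_mono nn_integral_mono
        power_mono min.mono order_refl V'le) auto
  also have "\<dots> = ennreal C * (\<integral>\<^sup>+\<omega>. (min (ennreal R') (2 * V \<omega>)) ^ N \<partial>M)"
    by (intro lim_imp_Liminf ennreal_tendsto_cmult lim2) auto
  also have "\<dots> \<le> ennreal C * (\<integral>\<^sup>+\<omega>. 2 ^ N * V \<omega> ^ N \<partial>M)"
  proof (intro mult_left_mono nn_integral_mono)
    fix \<omega>
    show "(min (ennreal R') (2 * V \<omega>)) ^ N \<le> 2 ^ N * V \<omega> ^ N"
      using power_mono[of "min (ennreal R') (2 * V \<omega>)" "2 * V \<omega>" N] by (simp add: power_mult_distrib)
  qed simp
  also have "\<dots> = ennreal (C * 2 ^ N) * (\<integral>\<^sup>+\<omega>. V \<omega> ^ N \<partial>M)"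
    using C by (subst nn_integral_cmult) (auto simp: ennreal_mult ennreal_power[symmetric] mult.assoc)
  finally show ?thesis .
qed

end

section \<open>A Gronwall inequality for moments of Volterra processes\<close>

text \<open>A convex power lies above its tangent at \<open>c\<close>. The induction multiplies by
  \<open>x\<close>, and what is missing is a nonnegative multiple of (x - c)^2.\<close>

lemma power_tangent:
  fixes x c :: real
  assumes "0 \<le> x" "0 \<le> c"
  shows "real (Suc p) * c ^ p * x \<le> x ^ Suc p + real p * c ^ Suc p"
proof (induction p)
  case (Suc p)
  have "0 \<le> real (Suc p) * c ^ p * (x - c)\<^sup>2" using assms by simp
  moreover have "x * (real (Suc p) * c ^ p * x) \<le> x * (x ^ Suc p + real p * c ^ Suc p)"
    using Suc assms by (intro mult_left_mono) auto
  ultimately show ?case by (simp add: power2_eq_square algebra_simps)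
qed (use assms in simp)

text \<open>Jensen's inequality for the measure with density \<open>k\<close>, not normalised,
  whence the power of the total mass. It is the integrated tangent inequality at the mean value of
  \<open>h\<close>; mass 0 and an infinite right side are treated separately.\<close>

lemma nn_integral_jensen_power:
  fixes k h :: "'z \<Rightarrow> ennreal"
  assumes [measurable]: "k \<in> borel_measurable N" "h \<in> borel_measurable N"
    and fin: "(\<integral>\<^sup>+x. k x \<partial>N) < \<top>"
  shows "(\<integral>\<^sup>+x. k x * h x \<partial>N) ^ Suc p \<le> (\<integral>\<^sup>+x. k x \<partial>N) ^ p * (\<integral>\<^sup>+x. k x * h x ^ Suc p \<partial>N)"
proof -
  let ?A = "\<integral>\<^sup>+x. k x \<partial>N" and ?B = "\<integral>\<^sup>+x. k x * h x \<partial>N" and ?D = "\<integral>\<^sup>+x. k x * h x ^ Suc p \<partial>N"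
  consider "?A = 0" | "?A \<noteq> 0" "?D = \<top>" | "?A \<noteq> 0" "?D < \<top>"
    by (metis top.not_eq_extremum)
  then show ?thesis
  proof cases
    case 1
    then have "AE x in N. k x = 0" by (simp add: nn_integral_0_iff_AE)
    then have "?B = 0" by (subst nn_integral_0_iff_AE) auto
    then show ?thesis by simp
  next
    case 2
    then show ?thesis by (simp add: ennreal_mult_top)
  next
    case 3
    \<comment> \<open>Finiteness of \<open>?B\<close>, from h \<le> 1 + h^(p+1), is required before
      the computation can move to real numbers.\<close>
    have "?B \<le> (\<integral>\<^sup>+x. k x + k x * h x ^ Suc p \<partial>N)"
    proof (rule nn_integral_mono)
      fix x
      have "h x \<le> 1 + h x ^ Suc p"
      proof (cases "h x \<le> 1")
        case False
        then have "h x \<le> h x ^ Suc p" using power_increasing[of 1 "Suc p" "h x"] by simp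
        then show ?thesis by (rule add_increasing[rotated]) simp
      qed (auto intro: add_increasing2)
      then show "k x * h x \<le> k x + k x * h x ^ Suc p"
        using mult_left_mono[of "h x" "1 + h x ^ Suc p" "k x"] by (simp add: distrib_left)
    qed
    also have "\<dots> = ?A + ?D" by (subst nn_integral_add) auto
    also have "\<dots> < \<top>" using 3 fin by simp
    finally have B: "?B < \<top>" .
    have fin_real: "\<exists>r\<ge>0. z = ennreal r" if "z < \<top>" for z using that by (cases z) auto
    obtain a b d where abd: "?A = ennreal a" "?B = ennreal b" "?D = ennreal d" "0 \<le> a" "0 \<le> b" "0 \<le> d"
      using fin_real[OF fin] fin_real[OF B] fin_real[OF 3(2)] by (elim exE conjE) (rule that)
    then have a: "0 < a" using 3 by (auto simp: less_le)
    \<comment> \<open>The mean of \<open>h\<close> under the normalised kernel, the optimal point of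
      tangency.\<close>
    define c where "c = b / a"
    have c: "0 \<le> c" using abd a by (simp add: c_def)
    have "ennreal (real (Suc p) * c ^ p) * ?B = (\<integral>\<^sup>+x. k x * (ennreal (real (Suc p) * c ^ p) * h x) \<partial>N)"
      by (subst nn_integral_cmult[symmetric]) (auto simp: ac_simps)
    also have "\<dots> \<le> (\<integral>\<^sup>+x. k x * h x ^ Suc p + ennreal (real p * c ^ Suc p) * k x \<partial>N)"
    proof (rule nn_integral_mono)
      fix x
      have "ennreal (real (Suc p) * c ^ p) * h x \<le> h x ^ Suc p + ennreal (real p * c ^ Suc p)"
      proof (cases "h x")
        case (real y)
        then show ?thesis using power_tangent[of y c p] c
          by (simp add: ennreal_power ennreal_mult[symmetric] ennreal_plus[symmetric] ennreal_leI del: ennreal_plus power_Suc of_nat_Suc)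
      qed simp
      then show "k x * (ennreal (real (Suc p) * c ^ p) * h x) \<le> k x * h x ^ Suc p + ennreal (real p * c ^ Suc p) * k x"
        using mult_left_mono[of "ennreal (real (Suc p) * c ^ p) * h x" "h x ^ Suc p + ennreal (real p * c ^ Suc p)" "k x"]
        by (simp add: distrib_left mult.commute)
    qed
    also have "\<dots> = ?D + ennreal (real p * c ^ Suc p) * ?A"
      by (subst nn_integral_add) (auto simp: nn_integral_cmult)
    finally have "real (Suc p) * c ^ p * b \<le> d + real p * c ^ Suc p * a"
      unfolding abd using abd c
      by (simp add: ennreal_mult[symmetric] ennreal_plus[symmetric] del: ennreal_plus power_Suc of_nat_Suc)
    moreover have "real p * c ^ Suc p * a = real p * c ^ p * b"
      "real (Suc p) * c ^ p * b = c ^ p * b + real p * c ^ p * b"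
      using a by (simp_all add: c_def algebra_simps)
    ultimately have "c ^ p * b \<le> d" by linarith
    then have "b ^ Suc p \<le> a ^ p * d"
      using a by (simp add: c_def power_divide field_simps)
    then show ?thesis unfolding abd using abd
      by (simp add: ennreal_power ennreal_mult[symmetric] ennreal_leI del: power_Suc)
  qed
qed

lemma nn_integral_reflect:
  fixes f :: "real \<Rightarrow> ennreal"
  assumes [measurable]: "f \<in> borel_measurable borel"
  shows "(\<integral>\<^sup>+s\<in>{0..t}. f (t - s) \<partial>lborel) = (\<integral>\<^sup>+s\<in>{0..t}. f s \<partial>lborel)"
proof -
  have "(\<integral>\<^sup>+s\<in>{0..t}. f s \<partial>lborel) = (\<integral>\<^sup>+s. f (t + (-1) * s) * indicator {0..t} (t + (-1) * s) \<partial>lborel)"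
    by (subst nn_integral_real_affine[where c="-1" and t=t]) auto
  also have "\<dots> = (\<integral>\<^sup>+s\<in>{0..t}. f (t - s) \<partial>lborel)"
    by (intro nn_integral_cong) (auto simp: indicator_def)
  finally show ?thesis by simp
qed

lemma convolution_le:
  fixes k f :: "real \<Rightarrow> ennreal"
  assumes [measurable]: "k \<in> borel_measurable borel" and "t \<le> T" and f: "\<And>s. 0 \<le> s \<Longrightarrow> s \<le> t \<Longrightarrow> f s \<le> c"
  shows "(\<integral>\<^sup>+s\<in>{0..t}. k (t - s) * f s \<partial>lborel) \<le> (\<integral>\<^sup>+s\<in>{0..T}. k s \<partial>lborel) * c"
proof -
  have "(\<integral>\<^sup>+s\<in>{0..t}. k (t - s) * f s \<partial>lborel) \<le> (\<integral>\<^sup>+s. c * (k (t - s) * indicator {0..t} s) \<partial>lborel)"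
    by (intro nn_integral_mono) (auto simp: indicator_def mult.commute[of c] intro!: mult_left_mono f)
  also have "\<dots> = c * (\<integral>\<^sup>+s\<in>{0..t}. k s \<partial>lborel)"
    by (subst nn_integral_cmult) (auto simp: nn_integral_reflect)
  also have "\<dots> \<le> c * (\<integral>\<^sup>+s\<in>{0..T}. k s \<partial>lborel)"
    using assms by (intro mult_left_mono nn_integral_mono) (auto simp: indicator_def)
  finally show ?thesis by (simp add: mult.commute)
qed

text \<open>The Laplace transform of an integrable kernel tends to 0, by dominated convergence away
  from s = 0. However singular the kernel is at 0, a large weight therefore makes the Volterra
  operator a contraction.\<close>

lemma laplace_kernel_small:
  fixes k :: "real \<Rightarrow> ennreal"
  assumes [measurable]: "k \<in> borel_measurable borel" and fin: "(\<integral>\<^sup>+s\<in>{0..T}. k s \<partial>lborel) < \<top>"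
    and e: "0 < (e::ennreal)"
  shows "\<exists>l::real>0. (\<integral>\<^sup>+s\<in>{0..T}. k s * ennreal (exp (- l * s)) \<partial>lborel) < e"
proof -
  have "(\<lambda>n. \<integral>\<^sup>+s\<in>{0..T}. k s * ennreal (exp (- real (Suc n) * s)) \<partial>lborel) \<longlonglongrightarrow> (\<integral>\<^sup>+s. (0::ennreal) \<partial>(lborel :: real measure))"
  proof (rule nn_integral_dominated_convergence)
    show "(\<integral>\<^sup>+s\<in>{0..T}. k s \<partial>lborel) < \<infinity>" using fin by simp
    show "AE s in lborel. k s * ennreal (exp (- real (Suc n) * s)) * indicator {0..T} s \<le> k s * indicator {0..T} s" for n
    proof (rule AE_I2)
      fix s
      have "ennreal (exp (- real (Suc n) * s)) \<le> 1" if "0 \<le> s"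
        using that by (simp add: mult_nonpos_nonneg)
      then show "k s * ennreal (exp (- real (Suc n) * s)) * indicator {0..T} s \<le> k s * indicator {0..T} s"
        using mult_left_mono[of "ennreal (exp (- real (Suc n) * s))" 1 "k s"] by (auto simp: indicator_def)
    qed
    have kf: "AE s in lborel. k s * indicator {0..T} s \<noteq> \<infinity>"
      using fin by (intro nn_integral_noteq_infinite) auto
    have "AE s in lborel. s \<noteq> (0::real)" by (rule AE_lborel_singleton)
    with kf show "AE s in lborel. (\<lambda>n. k s * ennreal (exp (- real (Suc n) * s)) * indicator {0..T} s) \<longlonglongrightarrow> 0"
    proof eventually_elim
      case (elim s)
      show ?case
      proof (cases "0 < s \<and> s \<le> T")
        case True
        have "exp (- real (Suc n) * s) = exp (- s) ^ Suc n" for n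
          using exp_of_nat_mult[of "Suc n" "- s"] by (simp del: of_nat_Suc power_Suc)
        then have "(\<lambda>n. exp (- real (Suc n) * s)) \<longlonglongrightarrow> 0"
          using LIMSEQ_Suc[OF LIMSEQ_power_zero[of "exp (- s)"]] True by (simp del: of_nat_Suc power_Suc)
        then have "(\<lambda>n. ennreal (exp (- real (Suc n) * s))) \<longlonglongrightarrow> ennreal 0"
          by (rule tendsto_ennrealI)
        then have "(\<lambda>n. k s * ennreal (exp (- real (Suc n) * s))) \<longlonglongrightarrow> k s * ennreal 0"
          using True elim by (intro ennreal_tendsto_cmult) (auto simp: less_top)
        then show ?thesis using True by simp
      next
        case False
        then have "indicator {0..T} s = (0::ennreal)" using elim by (auto simp: indicator_def)
        then show ?thesis by simp
      qed
    qed
  qed measurable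
  then have "\<forall>\<^sub>F n in sequentially. (\<integral>\<^sup>+s\<in>{0..T}. k s * ennreal (exp (- real (Suc n) * s)) \<partial>lborel) < e"
    using order_tendstoD(2)[of _ 0 sequentially e] e by simp
  then obtain n where "(\<integral>\<^sup>+s\<in>{0..T}. k s * ennreal (exp (- real (Suc n) * s)) \<partial>lborel) < e"
    by (auto simp: eventually_sequentially)
  then show ?thesis by (intro exI[of _ "real (Suc n)"]) auto
qed

lemma add_power_le_ennreal: "(a + b :: ennreal) ^ q \<le> 2 ^ q * (a ^ q + b ^ q)"
proof -
  have "(a + b) ^ q \<le> (2 * max a b) ^ q"
    by (intro power_mono) (auto simp: mult_2 intro!: add_mono)
  also have "\<dots> \<le> 2 ^ q * (a ^ q + b ^ q)"
    unfolding power_mult_distrib by (intro mult_left_mono) (auto simp: max_def intro: add_increasing add_increasing2)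
  finally show ?thesis .
qed

lemma add3_power_le_ennreal: "(a + b + c :: ennreal) ^ q \<le> 4 ^ q * (a ^ q + b ^ q + c ^ q)"
proof -
  have "(a + b + c) ^ q \<le> 2 ^ q * ((a + b) ^ q + c ^ q)" by (rule add_power_le_ennreal)
  also have "\<dots> \<le> 2 ^ q * (2 ^ q * (a ^ q + b ^ q) + 2 ^ q * c ^ q)"
  proof (intro mult_left_mono add_mono add_power_le_ennreal)
    have "1 \<le> (2::ennreal) ^ q" by (rule one_le_power) simp
    then show "c ^ q \<le> 2 ^ q * c ^ q" using mult_right_mono[of 1 "2 ^ q" "c ^ q"] by simp
  qed auto
  also have "\<dots> = (2 * 2) ^ q * (a ^ q + b ^ q + c ^ q)"
    unfolding power_mult_distrib by (simp add: distrib_left mult.assoc)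
  finally show ?thesis by simp
qed

section \<open>Moments of convolutions and the weighted Gronwall argument\<close>

context prob_space begin

text \<open>Jensen in time for each outcome, then Tonelli: the moment of a convolution is controlled
  by the convolution of the moments.\<close>

lemma convolution_moment_le:
  fixes k :: "real \<Rightarrow> ennreal" and H :: "real \<Rightarrow> 'a \<Rightarrow> ennreal"
  assumes k[measurable]: "k \<in> borel_measurable borel" and fin: "(\<integral>\<^sup>+s\<in>{0..T}. k s \<partial>lborel) < \<top>"
    and H[measurable]: "(\<lambda>(s, \<omega>). H s \<omega>) \<in> borel_measurable (borel \<Otimes>\<^sub>M M)" and t: "t \<le> T"
  shows "(\<integral>\<^sup>+\<omega>. (\<integral>\<^sup>+s\<in>{0..t}. k (t - s) * H s \<omega> \<partial>lborel) ^ Suc p \<partial>M) \<le>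
     (\<integral>\<^sup>+s\<in>{0..T}. k s \<partial>lborel) ^ p * (\<integral>\<^sup>+s\<in>{0..t}. k (t - s) * (\<integral>\<^sup>+\<omega>. H s \<omega> ^ Suc p \<partial>M) \<partial>lborel)"
proof -
  let ?A = "\<integral>\<^sup>+s\<in>{0..T}. k s \<partial>lborel"
  have A: "(\<integral>\<^sup>+s\<in>{0..t}. k (t - s) \<partial>lborel) \<le> ?A"
    using convolution_le[OF k t, of "\<lambda>_. 1" 1] by simp
  have Hm[measurable]: "(\<lambda>s. H s \<omega>) \<in> borel_measurable borel" if "\<omega> \<in> space M" for \<omega>
    by (rule section_measurable[OF H that])
  have "(\<integral>\<^sup>+\<omega>. (\<integral>\<^sup>+s\<in>{0..t}. k (t - s) * H s \<omega> \<partial>lborel) ^ Suc p \<partial>M) \<le>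
     (\<integral>\<^sup>+\<omega>. ?A ^ p * (\<integral>\<^sup>+s. (k (t - s) * indicator {0..t} s) * H s \<omega> ^ Suc p \<partial>lborel) \<partial>M)"
  proof (rule nn_integral_mono)
    fix \<omega> assume [measurable]: "\<omega> \<in> space M"
    have "(\<integral>\<^sup>+s\<in>{0..t}. k (t - s) * H s \<omega> \<partial>lborel) ^ Suc p = (\<integral>\<^sup>+s. (k (t - s) * indicator {0..t} s) * H s \<omega> \<partial>lborel) ^ Suc p"
      by (simp add: ac_simps)
    also have "\<dots> \<le> (\<integral>\<^sup>+s\<in>{0..t}. k (t - s) \<partial>lborel) ^ p * (\<integral>\<^sup>+s. (k (t - s) * indicator {0..t} s) * H s \<omega> ^ Suc p \<partial>lborel)"
      by (rule nn_integral_jensen_power) (use A fin in \<open>auto intro: le_less_trans\<close>)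
    also have "\<dots> \<le> ?A ^ p * (\<integral>\<^sup>+s. (k (t - s) * indicator {0..t} s) * H s \<omega> ^ Suc p \<partial>lborel)"
      by (intro mult_right_mono power_mono A) auto
    finally show "(\<integral>\<^sup>+s\<in>{0..t}. k (t - s) * H s \<omega> \<partial>lborel) ^ Suc p \<le> \<dots>" .
  qed
  also have "\<dots> = ?A ^ p * (\<integral>\<^sup>+\<omega>. (\<integral>\<^sup>+s. (k (t - s) * indicator {0..t} s) * H s \<omega> ^ Suc p \<partial>lborel) \<partial>M)"
    by (rule nn_integral_cmult) (intro lborel.borel_measurable_nn_integral; measurable)
  also have "(\<integral>\<^sup>+\<omega>. (\<integral>\<^sup>+s. (k (t - s) * indicator {0..t} s) * H s \<omega> ^ Suc p \<partial>lborel) \<partial>M) =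
     (\<integral>\<^sup>+s. (\<integral>\<^sup>+\<omega>. (k (t - s) * indicator {0..t} s) * H s \<omega> ^ Suc p \<partial>M) \<partial>lborel)"
  proof -
    interpret L: pair_sigma_finite lborel M ..
    show ?thesis by (rule L.Fubini') measurable
  qed
  also have "\<dots> = (\<integral>\<^sup>+s\<in>{0..t}. k (t - s) * (\<integral>\<^sup>+\<omega>. H s \<omega> ^ Suc p \<partial>M) \<partial>lborel)"
    by (intro nn_integral_cong, subst nn_integral_cmult) (auto simp: ac_simps)
  finally show ?thesis .
qed

text \<open>Since the kernels may be singular, Gronwall's argument is run with the weighted norm
  \<open>sup\<^sub>t e\<^sup>-\<^sup>l\<^sup>t E[R t ^ (2 * N)]\<close>, in which the Volterra operator is a contraction for large \<open>l\<close>.\<close>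

definition gronwall_constant ::
    "real \<Rightarrow> (real \<Rightarrow> ennreal) \<Rightarrow> (real \<Rightarrow> ennreal) \<Rightarrow> (real \<Rightarrow> ennreal) \<Rightarrow> real \<Rightarrow> real \<Rightarrow> nat \<Rightarrow> ennreal \<Rightarrow> bool" where
  "gronwall_constant T ka kb kc K C' N C \<longleftrightarrow> C < \<top> \<and> (\<forall>(R :: real \<Rightarrow> 'a \<Rightarrow> ennreal) J Z n.
    (\<lambda>(s, \<omega>). R s \<omega>) \<in> borel_measurable (borel \<Otimes>\<^sub>M M) \<longrightarrow>
    (\<lambda>(s, \<omega>). J s \<omega>) \<in> borel_measurable (borel \<Otimes>\<^sub>M M) \<longrightarrow>
    Z \<in> borel_measurable M \<longrightarrow>
    (\<forall>t\<in>{0..T}. AE \<omega> in M. R t \<omega> \<le> ennreal n) \<longrightarrow>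
    (\<forall>t\<in>{0..T}. AE \<omega> in M. R t \<omega> \<le> Z \<omega> + (\<integral>\<^sup>+\<tau>\<in>{0..t}. ka (t - \<tau>) *
       (ennreal K * R \<tau> \<omega> + ennreal K * (\<integral>\<^sup>+s\<in>{0..\<tau>}. kb (\<tau> - s) * R s \<omega> \<partial>lborel) + J \<tau> \<omega>) \<partial>lborel)) \<longrightarrow>
    (\<forall>\<tau>\<in>{0<..T}. (\<integral>\<^sup>+\<omega>. J \<tau> \<omega> ^ (2 * N) \<partial>M) \<le>
       ennreal C' * (\<integral>\<^sup>+\<omega>. (\<integral>\<^sup>+s\<in>{0..\<tau>}. kc (\<tau> - s) * (R s \<omega>)\<^sup>2 \<partial>lborel) ^ N \<partial>M)) \<longrightarrow>
    (\<forall>t\<in>{0..T}. (\<integral>\<^sup>+\<omega>. R t \<omega> ^ (2 * N) \<partial>M) \<le> C * (\<integral>\<^sup>+\<omega>. Z \<omega> ^ (2 * N) \<partial>M)) \<and>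
    (\<forall>\<tau>\<in>{0<..T}. (\<integral>\<^sup>+\<omega>. (ennreal K * R \<tau> \<omega> + ennreal K * (\<integral>\<^sup>+s\<in>{0..\<tau>}. kb (\<tau> - s) * R s \<omega> \<partial>lborel) + J \<tau> \<omega>) ^ (2 * N) \<partial>M)
       \<le> C * (\<integral>\<^sup>+\<omega>. Z \<omega> ^ (2 * N) \<partial>M)))"

text \<open>Moments of the bracket under the outer kernel are bounded by the weighted norm of
  \<open>R\<close>; inserting this in the Volterra inequality returns at most half of that norm. The
  bound for the bracket is kept as a second conclusion, because suprema over time are later derived
  from it.\<close>

lemma volterra_moment_bound:
  fixes ka kb kc :: "real \<Rightarrow> ennreal" and K C' :: real
  assumes k[measurable]: "ka \<in> borel_measurable borel" "kb \<in> borel_measurable borel" "kc \<in> borel_measurable borel"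
    and fin: "(\<integral>\<^sup>+s\<in>{0..T}. ka s \<partial>lborel) < \<top>" "(\<integral>\<^sup>+s\<in>{0..T}. kb s \<partial>lborel) < \<top>" "(\<integral>\<^sup>+s\<in>{0..T}. kc s \<partial>lborel) < \<top>"
    and N: "N \<ge> 1"
  shows "\<exists>C. gronwall_constant T ka kb kc K C' N C"
proof -
  define q where "q = 2 * N"
  obtain p m where p: "q = Suc p" and m: "N = Suc m" using N by (metis q_def Suc_le_D One_nat_def mult_2 add_Suc)
  define Aa Ab Ac where "Aa = (\<integral>\<^sup>+s\<in>{0..T}. ka s \<partial>lborel)" and "Ab = (\<integral>\<^sup>+s\<in>{0..T}. kb s \<partial>lborel)"
    and "Ac = (\<integral>\<^sup>+s\<in>{0..T}. kc s \<partial>lborel)"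
  \<comment> \<open>The three summands of the bracket in order: \<open>R\<close> itself, its inner
    convolution, and \<open>J\<close>. The factor 4^q comes from the power of a sum of three
    terms.\<close>
  define C1 where "C1 = 4 ^ q * (ennreal K ^ q + ennreal K ^ q * Ab ^ q + ennreal C' * Ac ^ N)"
  define C2 where "C2 = 2 ^ q * (Aa ^ p * C1)"
  have C1: "C1 < \<top>" using fin by (auto simp: C1_def Ab_def Ac_def ennreal_mult_less_top power_less_top_ennreal)
  then have C2: "C2 < \<top>" using fin by (auto simp: C2_def Aa_def ennreal_mult_less_top power_less_top_ennreal)
  \<comment> \<open>Makes C2 * e at most 1/2; adding 1 keeps the quotient meaningful when C2 is
    0.\<close>
  define e where "e = 1 / (2 * (C2 + 1))"
  have "2 * (C2 + 1) < \<top>" using C2 by (simp add: ennreal_mult_less_top)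
  then have e0: "0 < e" by (simp add: e_def ennreal_zero_less_divide)
  have e1: "C2 * e \<le> 1 / 2"
  proof -
    obtain c where c: "C2 = ennreal c" "0 \<le> c" using C2 by (cases C2) auto
    have "e = ennreal (1 / (2 * (c + 1)))"
    proof -
      have "2 * (C2 + 1) = ennreal (2 * (c + 1))"
        using c by (simp add: ennreal_mult)
      then show ?thesis using c divide_ennreal[of 1 "2 * (c + 1)"] by (simp add: e_def)
    qed
    then have "C2 * e = ennreal (c * (1 / (2 * (c + 1))))"
      using c by (simp only: ennreal_mult[symmetric] divide_nonneg_nonneg) (subst ennreal_mult; simp)
    also have "\<dots> \<le> ennreal (1 / 2)" using c by (intro ennreal_leI) (simp add: field_simps)
    also have "\<dots> = 1 / 2" using divide_ennreal[of 1 2] by simp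
    finally show ?thesis .
  qed
  obtain l where l: "0 < l" "(\<integral>\<^sup>+s\<in>{0..T}. ka s * ennreal (exp (- l * s)) \<partial>lborel) < e"
    using laplace_kernel_small[OF k(1) fin(1) e0] by auto
  \<comment> \<open>2 * 2^q results from absorbing half of the weighted norm, the exponential
    removes the weight, and 1 + C1 covers both conclusions.\<close>
  define C where "C = (1 + C1) * (2 * 2 ^ q) * ennreal (exp (l * T))"
  have "C < \<top>" using C1 by (auto simp: C_def ennreal_mult_less_top power_less_top_ennreal)
  moreover {
    fix R J :: "real \<Rightarrow> 'a \<Rightarrow> ennreal" and Z :: "'a \<Rightarrow> ennreal" and n
    assume R[measurable]: "(\<lambda>(s, \<omega>). R s \<omega>) \<in> borel_measurable (borel \<Otimes>\<^sub>M M)"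
      and J[measurable]: "(\<lambda>(s, \<omega>). J s \<omega>) \<in> borel_measurable (borel \<Otimes>\<^sub>M M)"
      and Z[measurable]: "Z \<in> borel_measurable M"
      and bdd: "\<forall>t\<in>{0..T}. AE \<omega> in M. R t \<omega> \<le> ennreal n"
    define G where "G \<tau> \<omega> = ennreal K * R \<tau> \<omega> + ennreal K * (\<integral>\<^sup>+s\<in>{0..\<tau>}. kb (\<tau> - s) * R s \<omega> \<partial>lborel) + J \<tau> \<omega>" for \<tau> \<omega>
    assume vol: "\<forall>t\<in>{0..T}. AE \<omega> in M. R t \<omega> \<le> Z \<omega> + (\<integral>\<^sup>+\<tau>\<in>{0..t}. ka (t - \<tau>) * G \<tau> \<omega> \<partial>lborel)"
      and mom: "\<forall>\<tau>\<in>{0<..T}. (\<integral>\<^sup>+\<omega>. J \<tau> \<omega> ^ (2 * N) \<partial>M) \<le>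
       ennreal C' * (\<integral>\<^sup>+\<omega>. (\<integral>\<^sup>+s\<in>{0..\<tau>}. kc (\<tau> - s) * (R s \<omega>)\<^sup>2 \<partial>lborel) ^ N \<partial>M)"
    have Rt[measurable]: "R t \<in> borel_measurable M" "J t \<in> borel_measurable M" for t
      using measurable_Pair2[OF R, of t] measurable_Pair2[OF J, of t] by auto
    have conv_m: "(\<lambda>(\<tau>, \<omega>). \<integral>\<^sup>+s\<in>{0..\<tau>}. kb (\<tau> - s) * R s \<omega> \<partial>lborel) \<in> borel_measurable (borel \<Otimes>\<^sub>M M)"
    proof -
      have eq: "indicator {0..\<tau>} s = (if 0 \<le> s \<and> s \<le> \<tau> then 1 else 0 :: ennreal)" for \<tau> s :: real
        by (auto simp: indicator_def)
      show ?thesis unfolding eq split_beta' by (intro lborel.borel_measurable_nn_integral) measurable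
    qed
    have Gm[measurable]: "(\<lambda>(s, \<omega>). G s \<omega>) \<in> borel_measurable (borel \<Otimes>\<^sub>M M)"
      unfolding G_def using conv_m R J by (simp add: split_beta')
    have conv_t[measurable]: "(\<lambda>\<omega>. \<integral>\<^sup>+s\<in>{0..\<tau>}. kb (\<tau> - s) * R s \<omega> \<partial>lborel) \<in> borel_measurable M" for \<tau>
      using measurable_Pair2[OF conv_m, of \<tau>] by simp
    define EZ where "EZ = (\<integral>\<^sup>+\<omega>. Z \<omega> ^ q \<partial>M)"
    define \<Phi> where "\<Phi> = (SUP t\<in>{0..T}. ennreal (exp (- l * t)) * (\<integral>\<^sup>+\<omega>. R t \<omega> ^ q \<partial>M))"
    have RP: "(\<integral>\<^sup>+\<omega>. R s \<omega> ^ q \<partial>M) \<le> \<Phi> * ennreal (exp (l * t))" if "0 \<le> s" "s \<le> t" "t \<le> T" for s t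
    proof -
      have "(\<integral>\<^sup>+\<omega>. R s \<omega> ^ q \<partial>M) = (ennreal (exp (- l * s)) * ennreal (exp (l * s))) * (\<integral>\<^sup>+\<omega>. R s \<omega> ^ q \<partial>M)"
        by (simp add: ennreal_mult[symmetric] exp_add[symmetric])
      also have "\<dots> = ennreal (exp (- l * s)) * (\<integral>\<^sup>+\<omega>. R s \<omega> ^ q \<partial>M) * ennreal (exp (l * s))"
        by (simp only: ac_simps)
      also have "\<dots> \<le> \<Phi> * ennreal (exp (l * t))"
        unfolding \<Phi>_def using that l(1) by (intro mult_mono SUP_upper ennreal_leI) auto
      finally show ?thesis .
    qed
    have GP: "(\<integral>\<^sup>+\<omega>. G \<tau> \<omega> ^ q \<partial>M) \<le> C1 * (\<Phi> * ennreal (exp (l * \<tau>)))" if \<tau>: "0 < \<tau>" "\<tau> \<le> T" for \<tau>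
    proof -
      let ?P = "\<Phi> * ennreal (exp (l * \<tau>))"
      have 1: "(\<integral>\<^sup>+\<omega>. (\<integral>\<^sup>+s\<in>{0..\<tau>}. kb (\<tau> - s) * R s \<omega> \<partial>lborel) ^ q \<partial>M) \<le> Ab ^ q * ?P"
      proof -
        have "(\<integral>\<^sup>+\<omega>. (\<integral>\<^sup>+s\<in>{0..\<tau>}. kb (\<tau> - s) * R s \<omega> \<partial>lborel) ^ q \<partial>M) \<le>
          Ab ^ p * (\<integral>\<^sup>+s\<in>{0..\<tau>}. kb (\<tau> - s) * (\<integral>\<^sup>+\<omega>. R s \<omega> ^ q \<partial>M) \<partial>lborel)"
          unfolding p Ab_def by (rule convolution_moment_le[OF k(2) fin(2) R \<tau>(2)])
        also have "\<dots> \<le> Ab ^ p * (Ab * ?P)"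
          unfolding Ab_def by (intro mult_left_mono convolution_le k \<tau> RP) (use \<tau> in auto)
        finally show ?thesis by (simp add: p ac_simps)
      qed
      have 2: "(\<integral>\<^sup>+\<omega>. J \<tau> \<omega> ^ q \<partial>M) \<le> ennreal C' * (Ac ^ N * ?P)"
      proof -
        have "(\<integral>\<^sup>+\<omega>. (\<integral>\<^sup>+s\<in>{0..\<tau>}. kc (\<tau> - s) * (R s \<omega>)\<^sup>2 \<partial>lborel) ^ N \<partial>M) \<le>
          Ac ^ m * (\<integral>\<^sup>+s\<in>{0..\<tau>}. kc (\<tau> - s) * (\<integral>\<^sup>+\<omega>. ((R s \<omega>)\<^sup>2) ^ N \<partial>M) \<partial>lborel)"
          unfolding m Ac_def by (rule convolution_moment_le[OF k(3) fin(3) _ \<tau>(2)]) measurable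
        also have "\<dots> \<le> Ac ^ m * (Ac * ?P)"
          unfolding Ac_def power_mult[symmetric] q_def[symmetric]
          by (intro mult_left_mono convolution_le k \<tau> RP) (use \<tau> in auto)
        also have "\<dots> = Ac ^ N * ?P" by (simp add: m ac_simps)
        finally have 3: "ennreal C' * (\<integral>\<^sup>+\<omega>. (\<integral>\<^sup>+s\<in>{0..\<tau>}. kc (\<tau> - s) * (R s \<omega>)\<^sup>2 \<partial>lborel) ^ N \<partial>M) \<le> ennreal C' * (Ac ^ N * ?P)"
          by (rule mult_left_mono) simp
        have "(\<integral>\<^sup>+\<omega>. J \<tau> \<omega> ^ q \<partial>M) \<le> ennreal C' * (\<integral>\<^sup>+\<omega>. (\<integral>\<^sup>+s\<in>{0..\<tau>}. kc (\<tau> - s) * (R s \<omega>)\<^sup>2 \<partial>lborel) ^ N \<partial>M)"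
          using mom \<tau> by (simp add: q_def)
        from order.trans[OF this 3] show ?thesis .
      qed
      have "(\<integral>\<^sup>+\<omega>. G \<tau> \<omega> ^ q \<partial>M) \<le> (\<integral>\<^sup>+\<omega>. 4 ^ q * ((ennreal K * R \<tau> \<omega>) ^ q +
        (ennreal K * (\<integral>\<^sup>+s\<in>{0..\<tau>}. kb (\<tau> - s) * R s \<omega> \<partial>lborel)) ^ q + J \<tau> \<omega> ^ q) \<partial>M)"
        unfolding G_def by (intro nn_integral_mono add3_power_le_ennreal)
      also have "\<dots> = 4 ^ q * (ennreal K ^ q * (\<integral>\<^sup>+\<omega>. R \<tau> \<omega> ^ q \<partial>M) +
        ennreal K ^ q * (\<integral>\<^sup>+\<omega>. (\<integral>\<^sup>+s\<in>{0..\<tau>}. kb (\<tau> - s) * R s \<omega> \<partial>lborel) ^ q \<partial>M) + (\<integral>\<^sup>+\<omega>. J \<tau> \<omega> ^ q \<partial>M))"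
        by (simp add: nn_integral_cmult nn_integral_add power_mult_distrib)
      also have "\<dots> \<le> 4 ^ q * (ennreal K ^ q * ?P + ennreal K ^ q * (Ab ^ q * ?P) + ennreal C' * (Ac ^ N * ?P))"
        using \<tau> by (intro mult_left_mono add_mono 1 2 RP) auto
      also have "\<dots> = C1 * ?P" by (simp add: C1_def algebra_simps)
      finally show ?thesis .
    qed
    have step: "ennreal (exp (- l * t)) * (\<integral>\<^sup>+\<omega>. R t \<omega> ^ q \<partial>M) \<le> 2 ^ q * EZ + \<Phi> / 2" if t: "0 \<le> t" "t \<le> T" for t
    proof -
      have I1: "(\<integral>\<^sup>+\<omega>. (\<integral>\<^sup>+\<tau>\<in>{0..t}. ka (t - \<tau>) * G \<tau> \<omega> \<partial>lborel) ^ q \<partial>M) \<le>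
        Aa ^ p * (\<integral>\<^sup>+\<tau>\<in>{0..t}. ka (t - \<tau>) * (\<integral>\<^sup>+\<omega>. G \<tau> \<omega> ^ q \<partial>M) \<partial>lborel)"
        unfolding p Aa_def by (rule convolution_moment_le[OF k(1) fin(1) Gm t(2)])
      have "(\<integral>\<^sup>+\<tau>\<in>{0..t}. ka (t - \<tau>) * (\<integral>\<^sup>+\<omega>. G \<tau> \<omega> ^ q \<partial>M) \<partial>lborel) \<le>
         (\<integral>\<^sup>+\<tau>\<in>{0..t}. ka (t - \<tau>) * (C1 * (\<Phi> * ennreal (exp (l * (t - (t - \<tau>)))))) \<partial>lborel)"
      \<comment> \<open>The time 0 is excluded because the moment bound for \<open>J\<close> is
        assumed for positive times only; it is a null set.\<close>
      proof (rule nn_integral_mono_AE)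
        have "AE \<tau> in lborel. \<tau> \<noteq> (0::real)" by (rule AE_lborel_singleton)
        then show "AE \<tau> in lborel. ka (t - \<tau>) * (\<integral>\<^sup>+\<omega>. G \<tau> \<omega> ^ q \<partial>M) * indicator {0..t} \<tau> \<le>
          ka (t - \<tau>) * (C1 * (\<Phi> * ennreal (exp (l * (t - (t - \<tau>)))))) * indicator {0..t} \<tau>"
        proof eventually_elim
          case (elim \<tau>)
          then show ?case using GP[of \<tau>] t by (auto simp: indicator_def intro!: mult_left_mono)
        qed
      qed
      \<comment> \<open>With u = t - \<tau> the exponential splits: exp (l * t) leaves the integral,
        and exp (- l * u) joins the kernel to form the small Laplace integral.\<close>
      also have "\<dots> = (\<integral>\<^sup>+u\<in>{0..t}. ka u * (C1 * (\<Phi> * ennreal (exp (l * (t - u))))) \<partial>lborel)"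
        by (rule nn_integral_reflect) measurable
      also have "\<dots> = (\<integral>\<^sup>+u. C1 * \<Phi> * ennreal (exp (l * t)) * (ka u * ennreal (exp (- l * u)) * indicator {0..t} u) \<partial>lborel)"
      proof (rule nn_integral_cong)
        fix u
        have "ennreal (exp (l * (t - u))) = ennreal (exp (l * t)) * ennreal (exp (- l * u))"
          by (simp add: ennreal_mult[symmetric] exp_add[symmetric] algebra_simps)
        then show "ka u * (C1 * (\<Phi> * ennreal (exp (l * (t - u))))) * indicator {0..t} u =
          C1 * \<Phi> * ennreal (exp (l * t)) * (ka u * ennreal (exp (- l * u)) * indicator {0..t} u)"
          by (simp only: ac_simps)
      qed
      also have "\<dots> = C1 * \<Phi> * ennreal (exp (l * t)) * (\<integral>\<^sup>+u\<in>{0..t}. ka u * ennreal (exp (- l * u)) \<partial>lborel)"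
        by (rule nn_integral_cmult) measurable
      also have "\<dots> \<le> C1 * \<Phi> * ennreal (exp (l * t)) * e"
      proof (rule mult_left_mono)
        have "(\<integral>\<^sup>+u\<in>{0..t}. ka u * ennreal (exp (- l * u)) \<partial>lborel) \<le> (\<integral>\<^sup>+u\<in>{0..T}. ka u * ennreal (exp (- l * u)) \<partial>lborel)"
          using t by (intro nn_integral_mono) (auto simp: indicator_def)
        then show "(\<integral>\<^sup>+u\<in>{0..t}. ka u * ennreal (exp (- l * u)) \<partial>lborel) \<le> e" using l by simp
      qed simp
      finally have I2: "(\<integral>\<^sup>+\<tau>\<in>{0..t}. ka (t - \<tau>) * (\<integral>\<^sup>+\<omega>. G \<tau> \<omega> ^ q \<partial>M) \<partial>lborel) \<le> C1 * \<Phi> * ennreal (exp (l * t)) * e" .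
      have "(\<integral>\<^sup>+\<omega>. R t \<omega> ^ q \<partial>M) \<le> (\<integral>\<^sup>+\<omega>. 2 ^ q * (Z \<omega> ^ q + (\<integral>\<^sup>+\<tau>\<in>{0..t}. ka (t - \<tau>) * G \<tau> \<omega> \<partial>lborel) ^ q) \<partial>M)"
      proof (rule nn_integral_mono_AE)
        show "AE \<omega> in M. R t \<omega> ^ q \<le> 2 ^ q * (Z \<omega> ^ q + (\<integral>\<^sup>+\<tau>\<in>{0..t}. ka (t - \<tau>) * G \<tau> \<omega> \<partial>lborel) ^ q)"
        proof -
          have "AE \<omega> in M. R t \<omega> \<le> Z \<omega> + (\<integral>\<^sup>+\<tau>\<in>{0..t}. ka (t - \<tau>) * G \<tau> \<omega> \<partial>lborel)"
            using vol t by simp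
          then show ?thesis
            by eventually_elim (rule order.trans[OF power_mono add_power_le_ennreal], auto)
        qed
      qed
      also have "\<dots> = 2 ^ q * (EZ + (\<integral>\<^sup>+\<omega>. (\<integral>\<^sup>+\<tau>\<in>{0..t}. ka (t - \<tau>) * G \<tau> \<omega> \<partial>lborel) ^ q \<partial>M))"
      proof -
        have [measurable]: "(\<lambda>\<omega>. \<integral>\<^sup>+\<tau>\<in>{0..t}. ka (t - \<tau>) * G \<tau> \<omega> \<partial>lborel) \<in> borel_measurable M"
          by (intro lborel.borel_measurable_nn_integral) measurable
        show ?thesis unfolding EZ_def by (simp add: nn_integral_cmult nn_integral_add)
      qed
      also have "\<dots> \<le> 2 ^ q * (EZ + Aa ^ p * (C1 * \<Phi> * ennreal (exp (l * t)) * e))"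
        by (intro mult_left_mono add_left_mono order.trans[OF I1] I2) auto
      finally have "(\<integral>\<^sup>+\<omega>. R t \<omega> ^ q \<partial>M) \<le> 2 ^ q * (EZ + Aa ^ p * (C1 * \<Phi> * ennreal (exp (l * t)) * e))" .
      also have "\<dots> = 2 ^ q * EZ + C2 * e * \<Phi> * ennreal (exp (l * t))"
        by (simp add: C2_def algebra_simps)
      also have "\<dots> \<le> 2 ^ q * EZ + 1 / 2 * \<Phi> * ennreal (exp (l * t))"
        by (intro add_left_mono mult_right_mono e1) auto
      finally have "ennreal (exp (- l * t)) * (\<integral>\<^sup>+\<omega>. R t \<omega> ^ q \<partial>M) \<le>
         ennreal (exp (- l * t)) * (2 ^ q * EZ + 1 / 2 * \<Phi> * ennreal (exp (l * t)))"
        by (rule mult_left_mono) simp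
      also have "\<dots> = ennreal (exp (- l * t)) * (2 ^ q * EZ) + 1 / 2 * \<Phi> * (ennreal (exp (- l * t)) * ennreal (exp (l * t)))"
        by (simp add: algebra_simps)
      also have "ennreal (exp (- l * t)) * ennreal (exp (l * t)) = 1"
        by (simp add: ennreal_mult[symmetric] exp_add[symmetric])
      also have "ennreal (exp (- l * t)) * (2 ^ q * EZ) + 1 / 2 * \<Phi> * 1 \<le> 1 * (2 ^ q * EZ) + 1 / 2 * \<Phi> * 1"
        using l t by (intro mult_right_mono add_right_mono) auto
      also have "\<dots> = 2 ^ q * EZ + \<Phi> / 2" by (simp add: divide_ennreal_def mult.commute)
      finally show ?thesis .
    qed
    have "\<Phi> \<le> 2 ^ q * EZ + \<Phi> / 2"
      unfolding \<Phi>_def by (rule SUP_least) (use step in \<open>auto simp: \<Phi>_def\<close>)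
    \<comment> \<open>The a priori bound \<open>n\<close> makes the weighted norm finite, so that
      half of it may be subtracted; \<open>n\<close> leaves no trace in the constant.\<close>
    moreover have "\<Phi> < \<top>"
    proof -
      have "\<Phi> \<le> ennreal n ^ q"
        unfolding \<Phi>_def
      proof (rule SUP_least)
        fix t assume t: "t \<in> {0..T}"
        have "(\<integral>\<^sup>+\<omega>. R t \<omega> ^ q \<partial>M) \<le> (\<integral>\<^sup>+\<omega>. ennreal n ^ q \<partial>M)"
        proof (rule nn_integral_mono_AE)
          have "AE \<omega> in M. R t \<omega> \<le> ennreal n" using bdd t by blast
          then show "AE \<omega> in M. R t \<omega> ^ q \<le> ennreal n ^ q" by eventually_elim (rule power_mono, auto)
        qed
        also have "\<dots> = ennreal n ^ q" by (simp add: emeasure_space_1)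
        finally have "ennreal (exp (- l * t)) * (\<integral>\<^sup>+\<omega>. R t \<omega> ^ q \<partial>M) \<le> 1 * ennreal n ^ q"
          using l t by (intro mult_mono) auto
        then show "ennreal (exp (- l * t)) * (\<integral>\<^sup>+\<omega>. R t \<omega> ^ q \<partial>M) \<le> ennreal n ^ q" by simp
      qed
      then show ?thesis by (rule le_less_trans) (simp add: power_less_top_ennreal)
    qed
    ultimately have \<Phi>: "\<Phi> \<le> 2 * (2 ^ q * EZ)"
    proof (cases "2 ^ q * EZ")
      case (real x)
      obtain y where y: "\<Phi> = ennreal y" "0 \<le> y" using \<open>\<Phi> < \<top>\<close> by (cases \<Phi>) auto
      have "\<Phi> / 2 = ennreal (y / 2)" using y divide_ennreal[of y 2] by simp
      then have "ennreal y \<le> ennreal (x + y / 2)"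
        using \<open>\<Phi> \<le> 2 ^ q * EZ + \<Phi> / 2\<close> real y by simp
      then have "y \<le> x + y / 2" using real y ennreal_le_iff[of "x + y / 2" y] by (simp del: ennreal_plus)
      then have "y \<le> 2 * x" by simp
      then have "ennreal y \<le> ennreal (2 * x)" by (rule ennreal_leI)
      then show ?thesis using y real by (simp add: ennreal_mult)
    qed (simp add: ennreal_mult_top)
    have Ple: "\<Phi> * ennreal (exp (l * t)) \<le> 2 * 2 ^ q * ennreal (exp (l * T)) * EZ" if "t \<le> T" for t
    proof -
      have "\<Phi> * ennreal (exp (l * t)) \<le> 2 * (2 ^ q * EZ) * ennreal (exp (l * T))"
        using l(1) that by (intro mult_mono \<Phi> ennreal_leI) auto
      then show ?thesis by (simp only: ac_simps)
    qed
    have "(\<integral>\<^sup>+\<omega>. R t \<omega> ^ q \<partial>M) \<le> C * EZ" if "t \<in> {0..T}" for t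
    proof -
      have "(\<integral>\<^sup>+\<omega>. R t \<omega> ^ q \<partial>M) \<le> 1 * (2 * 2 ^ q * ennreal (exp (l * T)) * EZ)"
        using RP[of t t] Ple[of t] that by (auto intro: order.trans)
      also have "\<dots> \<le> (1 + C1) * (2 * 2 ^ q * ennreal (exp (l * T)) * EZ)"
        by (intro mult_right_mono) auto
      finally show ?thesis by (simp only: C_def ac_simps)
    qed
    moreover have "(\<integral>\<^sup>+\<omega>. G \<tau> \<omega> ^ q \<partial>M) \<le> C * EZ" if "\<tau> \<in> {0<..T}" for \<tau>
    proof -
      have "(\<integral>\<^sup>+\<omega>. G \<tau> \<omega> ^ q \<partial>M) \<le> C1 * (2 * 2 ^ q * ennreal (exp (l * T)) * EZ)"
        using that by (intro order.trans[OF GP] mult_left_mono Ple) auto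
      also have "\<dots> \<le> (1 + C1) * (2 * 2 ^ q * ennreal (exp (l * T)) * EZ)"
        by (intro mult_right_mono) auto
      finally show ?thesis by (simp only: C_def ac_simps)
    qed
    ultimately have "(\<forall>t\<in>{0..T}. (\<integral>\<^sup>+\<omega>. R t \<omega> ^ (2 * N) \<partial>M) \<le> C * (\<integral>\<^sup>+\<omega>. Z \<omega> ^ (2 * N) \<partial>M)) \<and>
       (\<forall>\<tau>\<in>{0<..T}. (\<integral>\<^sup>+\<omega>. G \<tau> \<omega> ^ (2 * N) \<partial>M) \<le> C * (\<integral>\<^sup>+\<omega>. Z \<omega> ^ (2 * N) \<partial>M))"
      by (simp add: q_def EZ_def)
    note this[unfolded G_def] }
  ultimately show ?thesis unfolding gronwall_constant_def by (intro exI[of _ C] conjI allI impI) blast+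
qed

end

section \<open>Fractional kernels and stopping events\<close>

lemma powr_kernel_finite:
  assumes "a > -1"
  shows "(\<integral>\<^sup>+s\<in>{0..T}. ennreal (s powr a) \<partial>lborel) < \<top>"
proof (cases "0 \<le> T")
  case True
  then show ?thesis
    using nn_integral_has_integral_lebesgue'[OF _ has_integral_powr_from_0[OF assms True]] by simp
next
  case False
  then show ?thesis by simp
qed

lemma frac_integral_norm_le:
  assumes g: "frac_integrable \<alpha> t g" and \<alpha>: "0 < \<alpha>"
  shows "ennreal (norm (frac_integral \<alpha> t g)) \<le>
    (\<integral>\<^sup>+\<tau>\<in>{0..t}. ennreal ((t - \<tau>) powr (\<alpha> - 1) / Gamma \<alpha>) * ennreal (norm (g \<tau>)) \<partial>lborel)"
proof -
  have G: "0 < Gamma \<alpha>" using \<alpha> by (rule Gamma_real_pos)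
  let ?f = "\<lambda>\<tau>. indicator {0..t} \<tau> *\<^sub>R ((t - \<tau>) powr (\<alpha> - 1) *\<^sub>R g \<tau>)"
  have i: "integrable lborel ?f" using g by (simp add: frac_integrable_def set_integrable_def)
  have "ennreal (norm (frac_integral \<alpha> t g)) = ennreal (1 / Gamma \<alpha>) * ennreal (norm (integral\<^sup>L lborel ?f))"
    using G by (simp add: frac_integral_def set_lebesgue_integral_def ennreal_mult[symmetric])
  also have "\<dots> \<le> ennreal (1 / Gamma \<alpha>) * (\<integral>\<^sup>+\<tau>. ennreal (norm (?f \<tau>)) \<partial>lborel)"
    by (intro mult_left_mono integral_norm_bound_ennreal i) simp
  also have "\<dots> = (\<integral>\<^sup>+\<tau>. ennreal (1 / Gamma \<alpha>) * ennreal (norm (?f \<tau>)) \<partial>lborel)"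
    by (rule nn_integral_cmult[symmetric])
       (rule measurable_compose[OF borel_measurable_integrable[OF i]], measurable)
  also have "\<dots> = (\<integral>\<^sup>+\<tau>\<in>{0..t}. ennreal ((t - \<tau>) powr (\<alpha> - 1) / Gamma \<alpha>) * ennreal (norm (g \<tau>)) \<partial>lborel)"
    using G by (intro nn_integral_cong) (auto simp: indicator_def ennreal_mult[symmetric])
  finally show ?thesis .
qed

lemma frac_integral_add:
  assumes "frac_integrable \<alpha> t g" "frac_integrable \<alpha> t h"
  shows "frac_integrable \<alpha> t (\<lambda>\<tau>. g \<tau> + h \<tau>)"
    "frac_integral \<alpha> t (\<lambda>\<tau>. g \<tau> + h \<tau>) = frac_integral \<alpha> t g + frac_integral \<alpha> t h"
  using assms set_integral_add[of lborel "{0..t}" "\<lambda>\<tau>. (t - \<tau>) powr (\<alpha> - 1) *\<^sub>R g \<tau>" "\<lambda>\<tau>. (t - \<tau>) powr (\<alpha> - 1) *\<^sub>R h \<tau>"]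
  by (simp_all add: frac_integrable_def frac_integral_def scaleR_add_right)

lemma frac_integral_diff:
  assumes "frac_integrable \<alpha> t g" "frac_integrable \<alpha> t h"
  shows "frac_integrable \<alpha> t (\<lambda>\<tau>. g \<tau> - h \<tau>)"
    "frac_integral \<alpha> t (\<lambda>\<tau>. g \<tau> - h \<tau>) = frac_integral \<alpha> t g - frac_integral \<alpha> t h"
  using assms set_integral_diff[of lborel "{0..t}" "\<lambda>\<tau>. (t - \<tau>) powr (\<alpha> - 1) *\<^sub>R g \<tau>" "\<lambda>\<tau>. (t - \<tau>) powr (\<alpha> - 1) *\<^sub>R h \<tau>"]
  by (simp_all add: frac_integrable_def frac_integral_def scaleR_diff_right)

text \<open>This replaces Hoelder's inequality in the bound on the supremum of a fractional integral.\<close>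

lemma mult_le_powr_add_power:
  assumes "0 \<le> a" "p \<ge> 1"
  shows "ennreal a * b \<le> ennreal (a powr (1 + 1 / real p)) + b ^ Suc p"
proof (cases b)
  case top
  then show ?thesis by (simp add: top_power_ennreal del: power_Suc)
next
  case (real x)
  show ?thesis
  \<comment> \<open>If \<open>a\<close> is at most x^p, the product is at most x^(p+1); otherwise x
    is at most the p-th root of \<open>a\<close>. The exponent 1 + 1/p is conjugate to p +
    1.\<close>
  proof (cases "a \<le> x ^ p")
    case True
    then have "a * x \<le> x ^ Suc p" using real mult_right_mono[of a "x ^ p" x] by (simp add: mult.commute)
    then have "ennreal a * b \<le> b ^ Suc p"
      using real assms by (simp add: ennreal_mult[symmetric] ennreal_power ennreal_leI del: power_Suc)
    then show ?thesis by (rule add_increasing[rotated]) simp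
  next
    case False
    then have a: "0 < a" using real by (meson linorder_not_le order.strict_trans1 zero_le_power)
    have "x \<le> a powr (1 / real p)"
    proof (cases "x = 0")
      case False
      have "x = (x ^ p) powr (1 / real p)"
        using False real assms by (simp add: powr_realpow[symmetric] powr_powr)
      also have "\<dots> \<le> a powr (1 / real p)"
        using \<open>\<not> a \<le> x ^ p\<close> real by (intro powr_mono2) auto
      finally show ?thesis .
    qed simp
    then have "a * x \<le> a powr (1 + 1 / real p)"
      using a mult_left_mono[of x "a powr (1 / real p)" a] by (simp add: powr_add)
    then have "ennreal a * b \<le> ennreal (a powr (1 + 1 / real p))"
      using real assms by (simp add: ennreal_mult[symmetric] ennreal_leI)
    then show ?thesis by (rule add_increasing2[rotated]) simp
  qed
qed

text \<open>Rounding the time down to multiples of 1/(n+1) leaves countably many measurable pieces,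
  and path continuity gives the limit.\<close>

lemma jointly_measurable_continuous:
  fixes X :: "real \<Rightarrow> 'a \<Rightarrow> 'v :: {second_countable_topology, metric_space}"
  assumes X: "\<And>t. X t \<in> borel_measurable M" and c: "\<And>\<omega>. \<omega> \<in> space M \<Longrightarrow> continuous_on UNIV (\<lambda>t. X t \<omega>)"
  shows "(\<lambda>(t, \<omega>). X t \<omega>) \<in> borel_measurable (borel \<Otimes>\<^sub>M M)"
proof (rule borel_measurable_LIMSEQ_metric)
  let ?f = "\<lambda>n (t :: real). real_of_int \<lfloor>t * real (Suc n)\<rfloor> / real (Suc n)"
  show "(\<lambda>p. X (?f n (fst p)) (snd p)) \<in> borel_measurable (borel \<Otimes>\<^sub>M M)" for n
  proof (rule measurable_compose_countable[where f="\<lambda>i p. X (real_of_int i / real (Suc n)) (snd p)"])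
    show "(\<lambda>p. X (real_of_int i / real (Suc n)) (snd p)) \<in> borel_measurable (borel \<Otimes>\<^sub>M M)" for i
      by (rule measurable_compose[OF measurable_snd X])
  qed measurable
  fix p :: "real \<times> 'a" assume "p \<in> space (borel \<Otimes>\<^sub>M M)"
  then obtain t \<omega> where p: "p = (t, \<omega>)" and \<omega>: "\<omega> \<in> space M" by (auto simp: space_pair_measure)
  have "(\<lambda>n. ?f n t) \<longlonglongrightarrow> t"
  proof (rule tendsto_sandwich)
    show "(\<lambda>n. t - 1 / real (Suc n)) \<longlonglongrightarrow> t"
      using tendsto_diff[OF tendsto_const inverse_Suc_tendsto[of 1], of t] by simp
    show "\<forall>\<^sub>F n in sequentially. t - 1 / real (Suc n) \<le> ?f n t"
    proof (intro always_eventually allI)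
      fix n
      have "t * real (Suc n) - 1 \<le> real_of_int \<lfloor>t * real (Suc n)\<rfloor>" by linarith
      then have "(t * real (Suc n) - 1) / real (Suc n) \<le> ?f n t" by (rule divide_right_mono) simp
      then show "t - 1 / real (Suc n) \<le> ?f n t" by (simp add: diff_divide_distrib del: of_nat_Suc)
    qed
    show "\<forall>\<^sub>F n in sequentially. ?f n t \<le> t"
    proof (intro always_eventually allI)
      fix n
      have "?f n t \<le> t * real (Suc n) / real (Suc n)" by (intro divide_right_mono) auto
      then show "?f n t \<le> t" by (simp del: of_nat_Suc)
    qed
  qed simp
  then show "(\<lambda>n. X (?f n (fst p)) (snd p)) \<longlonglongrightarrow> (case p of (t, \<omega>) \<Rightarrow> X t \<omega>)"
    using continuous_on_tendsto_compose[OF c[OF \<omega>], of "\<lambda>n. ?f n t" t] by (simp add: p)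
qed

lemma jointly_measurable_extend:
  fixes f :: "real \<times> 'a \<Rightarrow> 'v :: {second_countable_topology, real_normed_vector}"
  assumes f: "f \<in> borel_measurable (restrict_space lborel S \<Otimes>\<^sub>M M)" and S: "S \<in> sets borel" "s \<in> S"
  shows "(\<lambda>(t, \<omega>). indicator S t *\<^sub>R f (t, \<omega>)) \<in> borel_measurable (borel \<Otimes>\<^sub>M M)"
proof -
  have [measurable]: "S \<in> sets borel" by fact
  \<comment> \<open>Times outside \<open>S\<close> are sent to the fixed point \<open>s\<close> of
    \<open>S\<close>, so that the composition stays in the restricted space; the indicator then
    erases their values.\<close>
  let ?\<phi> = "\<lambda>t. if t \<in> S then t else s"
  have "?\<phi> \<in> measurable borel (restrict_space lborel S)"
    by (rule measurable_restrict_space2) (use S in auto)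
  then have "(\<lambda>p. (?\<phi> (fst p), snd p)) \<in> measurable (borel \<Otimes>\<^sub>M M) (restrict_space lborel S \<Otimes>\<^sub>M M)"
    by (intro measurable_Pair measurable_compose[OF measurable_fst] measurable_snd)
  from measurable_compose[OF this f]
  have "(\<lambda>p. indicator S (fst p) *\<^sub>R f (?\<phi> (fst p), snd p)) \<in> borel_measurable (borel \<Otimes>\<^sub>M M)"
    by (rule borel_measurable_scaleR[rotated]) measurable
  moreover have "(\<lambda>p. indicator S (fst p) *\<^sub>R f (?\<phi> (fst p), snd p)) = (\<lambda>(t, \<omega>). indicator S t *\<^sub>R f (t, \<omega>))"
    by (auto simp: fun_eq_iff indicator_def)
  ultimately show ?thesis by simp
qed

section \<open>Stopping at the exit from a ball\<close>

context wiener_space begin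

text \<open>The event that two processes stay bounded by \<open>m\<close> until time \<open>t\<close>; restricting to rational
  times makes it measurable.\<close>

definition stop_event :: "'a set \<Rightarrow> (real \<Rightarrow> 'a \<Rightarrow> real ^ 'd) \<Rightarrow> (real \<Rightarrow> 'a \<Rightarrow> real ^ 'd) \<Rightarrow> real \<Rightarrow> real \<Rightarrow> real \<Rightarrow> 'a set" where
  "stop_event A y z T m t = {\<omega>\<in>A. \<forall>q\<in>\<rat> \<inter> {0..T}. q \<le> t \<longrightarrow> norm (y q \<omega>) \<le> m \<and> norm (z q \<omega>) \<le> m}"

text \<open>Each rational time contributes one condition, known by time \<open>t\<close> when it is
  active. Countably many such conditions give adaptedness, and the same argument with
  \<open>t\<close> as a variable gives joint measurability.\<close>

lemma stopping_family_stop_event: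
  assumes A: "A \<in> sets (F 0)" and y: "\<And>t. 0 \<le> t \<Longrightarrow> t \<le> T \<Longrightarrow> y t \<in> borel_measurable (F t)"
    and z: "\<And>t. 0 \<le> t \<Longrightarrow> t \<le> T \<Longrightarrow> z t \<in> borel_measurable (F t)"
  shows "stopping_family T (stop_event A y z T m)"
  unfolding stopping_family_def
proof (intro conjI allI impI)
  let ?Q = "\<rat> \<inter> {0..T}"
  have Q: "countable ?Q" using countable_rat by blast
  have Asp: "A \<subseteq> space M" using sets.sets_into_space[OF A] space_F[of 0] by simp
  have AM: "A \<in> sets M" using A sets_F[of 0] by auto
  show "stop_event A y z T m t \<subseteq> stop_event A y z T m s" if "0 \<le> s \<and> s \<le> t \<and> t \<le> T" for s t
    using that by (force simp: stop_event_def)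
  show "stop_event A y z T m t \<in> sets (F t)" if t: "0 \<le> t \<and> t \<le> T" for t
  proof -
    have At: "A \<in> sets (F t)" using A sets_F_mono[of 0 t] t by auto
    have "{\<omega>\<in>space (F t). \<forall>q\<in>?Q. q \<le> t \<longrightarrow> norm (y q \<omega>) \<le> m \<and> norm (z q \<omega>) \<le> m} \<in> sets (F t)"
    proof (rule sets.sets_Collect_countable_All'[OF _ Q])
      fix q assume q: "q \<in> ?Q"
      show "{\<omega> \<in> space (F t). q \<le> t \<longrightarrow> norm (y q \<omega>) \<le> m \<and> norm (z q \<omega>) \<le> m} \<in> sets (F t)"
      proof (cases "q \<le> t")
        case True
        have [measurable]: "y q \<in> borel_measurable (F t)" "z q \<in> borel_measurable (F t)"
          using q True t by (auto intro!: F_mono[OF _ True] y z)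
        show ?thesis by measurable
      qed simp
    qed
    moreover have "stop_event A y z T m t = A \<inter> {\<omega>\<in>space (F t). \<forall>q\<in>?Q. q \<le> t \<longrightarrow> norm (y q \<omega>) \<le> m \<and> norm (z q \<omega>) \<le> m}"
      using Asp space_F[of t] t by (auto simp: stop_event_def)
    ultimately show ?thesis using At by auto
  qed
  have [measurable]: "A \<in> sets M" by (rule AM)
  have "{p\<in>space (borel \<Otimes>\<^sub>M M). snd p \<in> A \<and> (\<forall>q\<in>?Q. q \<le> fst p \<longrightarrow> norm (y q (snd p)) \<le> m \<and> norm (z q (snd p)) \<le> m)} \<in> sets (borel \<Otimes>\<^sub>M M)"
  proof (intro sets.sets_Collect_conj sets.sets_Collect_countable_All'[OF _ Q])
    fix q assume q: "q \<in> ?Q"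
    then have [measurable]: "y q \<in> borel_measurable M" "z q \<in> borel_measurable M"
      using y[of q] z[of q] F_measurable[of q] by auto
    show "{p\<in>space (borel \<Otimes>\<^sub>M M). q \<le> fst p \<longrightarrow> norm (y q (snd p)) \<le> m \<and> norm (z q (snd p)) \<le> m} \<in> sets (borel \<Otimes>\<^sub>M M)"
      by measurable
  qed measurable
  then have "(\<lambda>p. indicator {p\<in>space (borel \<Otimes>\<^sub>M M). snd p \<in> A \<and> (\<forall>q\<in>?Q. q \<le> fst p \<longrightarrow> norm (y q (snd p)) \<le> m \<and> norm (z q (snd p)) \<le> m)} p :: ennreal) \<in> borel_measurable (borel \<Otimes>\<^sub>M M)"
    by (rule borel_measurable_indicator)
  then show "(\<lambda>(s, \<omega>). indicator (stop_event A y z T m s) \<omega> :: ennreal) \<in> borel_measurable (borel \<Otimes>\<^sub>M M)"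
  proof (rule measurable_cong[THEN iffD1, rotated])
    fix p :: "real \<times> 'a" assume p: "p \<in> space (borel \<Otimes>\<^sub>M M)"
    then have "p \<in> {p\<in>space (borel \<Otimes>\<^sub>M M). snd p \<in> A \<and> (\<forall>q\<in>?Q. q \<le> fst p \<longrightarrow> norm (y q (snd p)) \<le> m \<and> norm (z q (snd p)) \<le> m)}
        \<longleftrightarrow> snd p \<in> stop_event A y z T m (fst p)"
      unfolding stop_event_def mem_Collect_eq by blast
    then show "indicator {p\<in>space (borel \<Otimes>\<^sub>M M). snd p \<in> A \<and> (\<forall>q\<in>?Q. q \<le> fst p \<longrightarrow> norm (y q (snd p)) \<le> m \<and> norm (z q (snd p)) \<le> m)} p =
       (case p of (s, \<omega>) \<Rightarrow> (indicator (stop_event A y z T m s) \<omega> :: ennreal))"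
      unfolding indicator_def split_beta' by (simp only:)
  qed
qed

text \<open>Continuity carries the bound from rational times to all times. For t > 0, rationals
  strictly below \<open>t\<close> approach it and are already subject to the bound; 0 is itself
  rational.\<close>

lemma stop_event_bound:
  assumes \<omega>: "\<omega> \<in> stop_event A y z T m t" and t: "0 \<le> t" "t \<le> T"
    and c: "continuous_on {0..T} (\<lambda>t. y t \<omega>)" "continuous_on {0..T} (\<lambda>t. z t \<omega>)"
  shows "norm (y t \<omega>) \<le> m" "norm (z t \<omega>) \<le> m"
proof -
  have *: "norm (x t) \<le> m" if c: "continuous_on {0..T} x" and b: "\<And>q. q \<in> \<rat> \<inter> {0..T} \<Longrightarrow> q \<le> t \<Longrightarrow> norm (x q) \<le> m" for x :: "real \<Rightarrow> real ^ 'd"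
  proof (cases "t = 0")
    case True
    then show ?thesis using b[of 0] t by auto
  next
    case False
    show ?thesis
    proof (rule ccontr)
      assume "\<not> norm (x t) \<le> m"
      then have e: "0 < norm (x t) - m" by simp
      obtain d where d: "d > 0" "\<And>s. s \<in> {0..T} \<Longrightarrow> dist s t < d \<Longrightarrow> dist (x s) (x t) < norm (x t) - m"
        using c t e unfolding continuous_on_iff by (metis atLeastAtMost_iff)
      obtain q where q: "q \<in> \<rat>" "max 0 (t - d) < q" "q < t"
        using Rats_dense_in_real[of "max 0 (t - d)" t] False t d by auto
      have "dist (x q) (x t) < norm (x t) - m" using d(2)[of q] q t by (auto simp: dist_real_def)
      then have "norm (x t - x q) < norm (x t) - m" by (simp add: dist_norm norm_minus_commute)
      moreover have "norm (x q) \<le> m" using b[of q] q t by auto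
      ultimately show False using norm_triangle_ineq2[of "x t" "x q"] by linarith
    qed
  qed
  show "norm (y t \<omega>) \<le> m" by (rule *[OF c(1)]) (use \<omega> in \<open>auto simp: stop_event_def\<close>)
  show "norm (z t \<omega>) \<le> m" by (rule *[OF c(2)]) (use \<omega> in \<open>auto simp: stop_event_def\<close>)
qed

text \<open>Continuous paths are bounded on the compact interval, so a single level serves all
  times. It is used to remove the stopping by letting the level grow.\<close>

lemma stop_event_exhausts:
  assumes "\<omega> \<in> A" and c: "continuous_on {0..T} (\<lambda>t. y t \<omega>)" "continuous_on {0..T} (\<lambda>t. z t \<omega>)"
  shows "\<exists>n::nat. \<forall>m\<ge>n. \<omega> \<in> stop_event A y z T (real m) t"
proof -
  have "bounded ((\<lambda>t. y t \<omega>) ` {0..T})" "bounded ((\<lambda>t. z t \<omega>) ` {0..T})"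
    using c by (auto intro!: compact_imp_bounded compact_continuous_image)
  then have "\<exists>a. \<forall>t\<in>{0..T}. norm (y t \<omega>) \<le> a" "\<exists>b. \<forall>t\<in>{0..T}. norm (z t \<omega>) \<le> b"
    by (auto simp: bounded_iff)
  then obtain a b where a: "\<And>t. t \<in> {0..T} \<Longrightarrow> norm (y t \<omega>) \<le> a" and b: "\<And>t. t \<in> {0..T} \<Longrightarrow> norm (z t \<omega>) \<le> b"
    by (elim exE) (rule that, blast+)
  obtain n :: nat where n: "max a b \<le> real n" using real_arch_simple by blast
  have "\<omega> \<in> stop_event A y z T (real m) t" if "n \<le> m" for m
  proof -
    have "norm (y q \<omega>) \<le> real m \<and> norm (z q \<omega>) \<le> real m" if "q \<in> {0..T}" for q
      using a[OF that] b[OF that] n \<open>n \<le> m\<close> of_nat_mono[OF \<open>n \<le> m\<close>, where 'a=real] by linarith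
    then show ?thesis using \<open>\<omega> \<in> A\<close> by (auto simp: stop_event_def)
  qed
  then show ?thesis by blast
qed

text \<open>The quadratic variation sees the square of the singular kernel, which is integrable
  since \<beta> < 1/2. Before stopping, the difference of the integrands is at most K * \<rho>, so
  that K enters with the power 2 * N.\<close>

lemma weighted_ito_moment:
  fixes X1 X2 :: "'a \<Rightarrow> real ^ 'd" and g1 g2 :: "real \<Rightarrow> 'a \<Rightarrow> real ^ 'r ^ 'd"
  assumes moment: "simple_moment_constant TYPE('d) N C"
    and \<tau>: "0 < \<tau>" and B: "stopping_family \<tau> B" and \<beta>: "\<beta> < 1 / 2"
    and I1: "has_ito_integral M F W \<tau> (\<lambda>s \<omega>. (\<tau> - s) powr (- \<beta>) *\<^sub>R g1 s \<omega>) X1"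
    and I2: "has_ito_integral M F W \<tau> (\<lambda>s \<omega>. (\<tau> - s) powr (- \<beta>) *\<^sub>R g2 s \<omega>) X2"
    and h: "(\<lambda>(s, \<omega>). h1 s \<omega>) \<in> borel_measurable (borel \<Otimes>\<^sub>M M)" "(\<lambda>(s, \<omega>). h2 s \<omega>) \<in> borel_measurable (borel \<Otimes>\<^sub>M M)"
    and eq: "AE \<omega> in M. \<forall>s\<in>{0..\<tau>}. g1 s \<omega> = h1 s \<omega>" "AE \<omega> in M. \<forall>s\<in>{0..\<tau>}. g2 s \<omega> = h2 s \<omega>"
    and K: "0 \<le> K" and \<rho>: "(\<lambda>(s, \<omega>). \<rho> s \<omega> :: real) \<in> borel_measurable (borel \<Otimes>\<^sub>M M)" and \<rho>0: "\<And>s \<omega>. 0 \<le> \<rho> s \<omega>"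
    and dom: "AE \<omega> in M. \<forall>s\<in>{0..\<tau>}. \<omega> \<in> B s \<longrightarrow> norm (g1 s \<omega> - g2 s \<omega>) \<le> K * \<rho> s \<omega> \<and> \<rho> s \<omega> \<le> n"
  shows "(\<integral>\<^sup>+\<omega>. indicator (B \<tau>) \<omega> * ennreal (norm (X1 \<omega> - X2 \<omega>) ^ (2 * N)) \<partial>M) \<le>
     ennreal (C * 2 ^ N * K ^ (2 * N)) * (\<integral>\<^sup>+\<omega>. (\<integral>\<^sup>+s\<in>{0..\<tau>}. ennreal ((\<tau> - s) powr (- 2 * \<beta>)) * (ennreal (\<rho> s \<omega>) * indicator (B s) \<omega>)\<^sup>2 \<partial>lborel) ^ N \<partial>M)"
proof -
  have C: "0 \<le> C" using moment by (simp add: simple_moment_constant_def)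
  let ?k = "\<lambda>s. (\<tau> - s) powr (- \<beta>)"
  define V where "V \<omega> = (\<integral>\<^sup>+s\<in>{0..\<tau>}. ennreal ((norm (?k s *\<^sub>R h1 s \<omega> - ?k s *\<^sub>R h2 s \<omega>))\<^sup>2) * indicator (B s) \<omega> \<partial>lborel)" for \<omega>
  define U where "U \<omega> = (\<integral>\<^sup>+s\<in>{0..\<tau>}. ennreal ((\<tau> - s) powr (- 2 * \<beta>)) * (ennreal (\<rho> s \<omega>) * indicator (B s) \<omega>)\<^sup>2 \<partial>lborel)" for \<omega>
  \<comment> \<open>At \<open>s = \<tau>\<close> both sides are 0, because \<open>0 powr a\<close>
    is 0.\<close>
  have k2: "(?k s)\<^sup>2 = (\<tau> - s) powr (- 2 * \<beta>)" for s
    by (cases "s = \<tau>") (auto simp: power2_eq_square powr_add[symmetric])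
  have dom': "AE \<omega> in M. \<forall>s\<in>{0..\<tau>}. ennreal ((norm (?k s *\<^sub>R h1 s \<omega> - ?k s *\<^sub>R h2 s \<omega>))\<^sup>2) * indicator (B s) \<omega> \<le>
      ennreal (K\<^sup>2) * (ennreal ((\<tau> - s) powr (- 2 * \<beta>)) * (ennreal (\<rho> s \<omega>) * indicator (B s) \<omega>)\<^sup>2) \<and>
      (\<omega> \<in> B s \<longrightarrow> \<rho> s \<omega> \<le> n)"
    using dom eq
  proof eventually_elim
    case (elim \<omega>)
    show ?case
    proof (intro ballI conjI impI)
      fix s assume s: "s \<in> {0..\<tau>}"
      show "\<omega> \<in> B s \<Longrightarrow> \<rho> s \<omega> \<le> n" using elim s by blast
      show "ennreal ((norm (?k s *\<^sub>R h1 s \<omega> - ?k s *\<^sub>R h2 s \<omega>))\<^sup>2) * indicator (B s) \<omega> \<le>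
        ennreal (K\<^sup>2) * (ennreal ((\<tau> - s) powr (- 2 * \<beta>)) * (ennreal (\<rho> s \<omega>) * indicator (B s) \<omega>)\<^sup>2)"
      proof (cases "\<omega> \<in> B s")
        case True
        have "norm (h1 s \<omega> - h2 s \<omega>) \<le> K * \<rho> s \<omega>" using elim s True by force
        then have "(norm (h1 s \<omega> - h2 s \<omega>))\<^sup>2 \<le> (K * \<rho> s \<omega>)\<^sup>2" by (intro power_mono) auto
        then have "(?k s)\<^sup>2 * (norm (h1 s \<omega> - h2 s \<omega>))\<^sup>2 \<le> (?k s)\<^sup>2 * (K * \<rho> s \<omega>)\<^sup>2" by (intro mult_left_mono) auto
        moreover have "(norm (?k s *\<^sub>R h1 s \<omega> - ?k s *\<^sub>R h2 s \<omega>))\<^sup>2 = (?k s)\<^sup>2 * (norm (h1 s \<omega> - h2 s \<omega>))\<^sup>2"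
          by (simp add: scaleR_diff_right[symmetric] power_mult_distrib)
        ultimately have "(norm (?k s *\<^sub>R h1 s \<omega> - ?k s *\<^sub>R h2 s \<omega>))\<^sup>2 \<le> K\<^sup>2 * ((\<tau> - s) powr (- 2 * \<beta>) * (\<rho> s \<omega>)\<^sup>2)"
          unfolding k2 by (simp add: power_mult_distrib ac_simps)
        then show ?thesis using True \<rho>0[of s \<omega>]
          by (simp add: ennreal_mult[symmetric] ennreal_power ennreal_leI)
      qed simp
    qed
  qed
  note h[measurable] \<rho>[measurable]
  have Bjm[measurable]: "(\<lambda>(s, \<omega>). indicator (B s) \<omega> :: ennreal) \<in> borel_measurable (borel \<Otimes>\<^sub>M M)"
    using B by (simp add: stopping_family_def)
  have Um[measurable]: "U \<in> borel_measurable M"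
    unfolding U_def by (intro lborel.borel_measurable_nn_integral) measurable
  have Us: "(\<lambda>s. ennreal ((\<tau> - s) powr (- 2 * \<beta>)) * (ennreal (\<rho> s \<omega>) * indicator (B s) \<omega>)\<^sup>2 * indicator {0..\<tau>} s) \<in> borel_measurable borel" if "\<omega> \<in> space M" for \<omega>
  proof -
    have [measurable]: "(\<lambda>s. \<rho> s \<omega>) \<in> borel_measurable borel" "(\<lambda>s. indicator (B s) \<omega> :: ennreal) \<in> borel_measurable borel"
      by (rule section_measurable[OF _ that]; fact \<rho> Bjm)+
    show ?thesis by measurable
  qed
  have VU: "AE \<omega> in M. V \<omega> \<le> ennreal (K\<^sup>2) * U \<omega>"
    using dom' AE_space
  proof eventually_elim
    case (elim \<omega>)
    have "V \<omega> \<le> (\<integral>\<^sup>+s. ennreal (K\<^sup>2) * (ennreal ((\<tau> - s) powr (- 2 * \<beta>)) * (ennreal (\<rho> s \<omega>) * indicator (B s) \<omega>)\<^sup>2 * indicator {0..\<tau>} s) \<partial>lborel)"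
      unfolding V_def
    proof (rule nn_integral_mono)
      fix s
      show "ennreal ((norm (?k s *\<^sub>R h1 s \<omega> - ?k s *\<^sub>R h2 s \<omega>))\<^sup>2) * indicator (B s) \<omega> * indicator {0..\<tau>} s \<le>
         ennreal (K\<^sup>2) * (ennreal ((\<tau> - s) powr (- 2 * \<beta>)) * (ennreal (\<rho> s \<omega>) * indicator (B s) \<omega>)\<^sup>2 * indicator {0..\<tau>} s)"
        using elim(1) by (cases "s \<in> {0..\<tau>}") auto
    qed
    also have "\<dots> = ennreal (K\<^sup>2) * U \<omega>"
      unfolding U_def using Us[OF elim(2)] by (intro nn_integral_cmult) simp
    finally show ?case .
  qed
  let ?A = "\<integral>\<^sup>+s\<in>{0..\<tau>}. ennreal (s powr (- 2 * \<beta>)) \<partial>lborel"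
  have fin: "?A < \<top>"
    by (rule powr_kernel_finite) (use \<beta> in simp)
  have Ub: "AE \<omega> in M. U \<omega> \<le> ?A * ennreal (n\<^sup>2)"
    using dom'
  proof eventually_elim
    case (elim \<omega>)
    show ?case unfolding U_def
    proof (rule convolution_le)
      fix s assume s: "0 \<le> s" "s \<le> \<tau>"
      show "(ennreal (\<rho> s \<omega>) * indicator (B s) \<omega>)\<^sup>2 \<le> ennreal (n\<^sup>2)"
      proof (cases "\<omega> \<in> B s")
        case True
        then have "\<rho> s \<omega> \<le> n" using elim s by auto
        then show ?thesis using \<rho>0[of s \<omega>] True by (simp add: ennreal_power ennreal_leI power_mono)
      qed simp
    qed simp_all
  qed
  have RR: "ennreal (K\<^sup>2) * (?A * ennreal (n\<^sup>2)) < \<top>" using fin by (simp add: ennreal_mult_less_top)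
  \<comment> \<open>A finite energy level, as \<open>stopped_ito_moment\<close> demands; here alone
    the bound \<open>n\<close> on \<rho> is used, and the resulting estimate is free of it.\<close>
  define R where "R = enn2real (ennreal (K\<^sup>2) * (?A * ennreal (n\<^sup>2)))"
  have R: "0 \<le> R" "ennreal (K\<^sup>2) * (?A * ennreal (n\<^sup>2)) = ennreal R"
    using RR by (simp_all add: R_def)
  have VR: "AE \<omega> in M. V \<omega> \<le> ennreal R"
    using VU Ub
  proof eventually_elim
    case (elim \<omega>)
    have "V \<omega> \<le> ennreal (K\<^sup>2) * (?A * ennreal (n\<^sup>2))"
      by (rule order.trans[OF elim(1)]) (intro mult_left_mono elim, simp)
    then show ?case by (simp only: R)
  qed
  have "(\<integral>\<^sup>+\<omega>. indicator (B \<tau>) \<omega> * ennreal (norm (X1 \<omega> - X2 \<omega>) ^ (2 * N)) \<partial>M) \<le>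
     ennreal (C * 2 ^ N) * (\<integral>\<^sup>+\<omega>. V \<omega> ^ N \<partial>M)"
    unfolding V_def
  proof (rule stopped_ito_moment[OF moment \<tau> B I1 I2 _ _ _ _ R(1)])
    show "(\<lambda>(s, \<omega>). ?k s *\<^sub>R h1 s \<omega>) \<in> borel_measurable (borel \<Otimes>\<^sub>M M)" by measurable
    show "(\<lambda>(s, \<omega>). ?k s *\<^sub>R h2 s \<omega>) \<in> borel_measurable (borel \<Otimes>\<^sub>M M)" by measurable
    show "AE \<omega> in M. \<forall>s\<in>{0..\<tau>}. ?k s *\<^sub>R g1 s \<omega> = ?k s *\<^sub>R h1 s \<omega>" using eq(1) by eventually_elim simp
    show "AE \<omega> in M. \<forall>s\<in>{0..\<tau>}. ?k s *\<^sub>R g2 s \<omega> = ?k s *\<^sub>R h2 s \<omega>" using eq(2) by eventually_elim simp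
  qed (use VR in \<open>simp add: V_def\<close>)
  also have "(\<integral>\<^sup>+\<omega>. V \<omega> ^ N \<partial>M) \<le> (\<integral>\<^sup>+\<omega>. ennreal (K ^ (2 * N)) * U \<omega> ^ N \<partial>M)"
  proof (rule nn_integral_mono_AE)
    show "AE \<omega> in M. V \<omega> ^ N \<le> ennreal (K ^ (2 * N)) * U \<omega> ^ N"
      using VU
    proof eventually_elim
      case (elim \<omega>)
      have "V \<omega> ^ N \<le> (ennreal (K\<^sup>2) * U \<omega>) ^ N" by (intro power_mono elim) simp
      then show ?case by (simp add: power_mult_distrib ennreal_power power_mult)
    qed
  qed
  also have "\<dots> = ennreal (K ^ (2 * N)) * (\<integral>\<^sup>+\<omega>. U \<omega> ^ N \<partial>M)" by (rule nn_integral_cmult) measurable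
  finally show ?thesis
    using C K by (simp add: U_def ennreal_mult mult_left_mono mult.assoc)
qed

end

section \<open>Moment estimates for solutions\<close>

locale volterra_setting = wiener_space M F W
  for M :: "'a measure" and F :: "real \<Rightarrow> 'a measure" and W :: "real \<Rightarrow> 'a \<Rightarrow> real ^ 'r" +
  fixes T \<alpha> \<beta>\<^sub>1 \<beta>\<^sub>2 :: real
  assumes T: "0 < T" and \<alpha>: "0 < \<alpha>" and \<beta>\<^sub>1: "\<beta>\<^sub>1 < 1" and \<beta>\<^sub>2: "\<beta>\<^sub>2 < 1 / 2"
begin

text \<open>The almost sure clause of \<open>is_solution\<close> for a single outcome. Two such
  paths can be subtracted by linearity of the fractional integral, without any probability.\<close>

definition volterra_path ::
    "real \<Rightarrow> real ^ 'd \<Rightarrow> real ^ 'd \<Rightarrow> (real \<Rightarrow> real ^ 'd) \<Rightarrow> (real \<Rightarrow> real \<Rightarrow> real ^ 'd) \<Rightarrow> (real \<Rightarrow> real ^ 'd) \<Rightarrow> bool" where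
  "volterra_path t y y0 a0 a1 I \<longleftrightarrow>
     frac_integrable \<alpha> t a0 \<and>
     (AE \<tau> in lborel. \<tau> \<in> {0..t} \<longrightarrow> set_integrable lborel {0..\<tau>} (\<lambda>s. (\<tau> - s) powr (- \<beta>\<^sub>1) *\<^sub>R a1 \<tau> s)) \<and>
     frac_integrable \<alpha> t (\<lambda>\<tau>. LINT s:{0..\<tau>}|lborel. (\<tau> - s) powr (- \<beta>\<^sub>1) *\<^sub>R a1 \<tau> s) \<and>
     frac_integrable \<alpha> t I \<and>
     y = y0 + frac_integral \<alpha> t a0
       + frac_integral \<alpha> t (\<lambda>\<tau>. LINT s:{0..\<tau>}|lborel. (\<tau> - s) powr (- \<beta>\<^sub>1) *\<^sub>R a1 \<tau> s)
       + frac_integral \<alpha> t I"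

text \<open>A process represented by the integral equation with coefficients \<open>a\<^sub>0\<close>, \<open>a\<^sub>1\<close>, \<open>a\<^sub>2\<close> that are
  already evaluated along the solution. Solutions are of this form, and so is the zero process;
  growth bounds for one solution arise by comparing it with the latter.\<close>

definition volterra_rep ::
    "('a \<Rightarrow> real ^ 'd) \<Rightarrow> (real \<Rightarrow> 'a \<Rightarrow> real ^ 'd) \<Rightarrow> (real \<Rightarrow> 'a \<Rightarrow> real ^ 'd) \<Rightarrow>
     (real \<Rightarrow> real \<Rightarrow> 'a \<Rightarrow> real ^ 'd) \<Rightarrow> (real \<Rightarrow> real \<Rightarrow> 'a \<Rightarrow> real ^ 'r ^ 'd) \<Rightarrow> (real \<Rightarrow> 'a \<Rightarrow> real ^ 'd) \<Rightarrow> bool" where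
  "volterra_rep y0 y a0 a1 a2 I \<longleftrightarrow>
     y0 \<in> borel_measurable M \<and>
     (\<lambda>(\<tau>, \<omega>). I \<tau> \<omega>) \<in> borel_measurable (restrict_space lborel {0..T} \<Otimes>\<^sub>M M) \<and>
     (\<forall>\<tau>\<in>{0..T}. has_ito_integral M F W \<tau> (\<lambda>s \<omega>. (\<tau> - s) powr (- \<beta>\<^sub>2) *\<^sub>R a2 \<tau> s \<omega>) (I \<tau>)) \<and>
     (\<forall>\<tau>\<in>{0..T}. \<exists>h. (\<lambda>(s, \<omega>). h s \<omega>) \<in> borel_measurable (borel \<Otimes>\<^sub>M M) \<and>
        (AE \<omega> in M. \<forall>s\<in>{0..\<tau>}. a2 \<tau> s \<omega> = h s \<omega>)) \<and>
     (\<forall>t\<in>{0..T}. AE \<omega> in M. volterra_path t (y t \<omega>) (y0 \<omega>) (\<lambda>\<tau>. a0 \<tau> \<omega>) (\<lambda>\<tau> s. a1 \<tau> s \<omega>) (\<lambda>\<tau>. I \<tau> \<omega>))"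

text \<open>\<rho> is a jointly measurable substitute for \<kappa> + |y - y'|. With \<kappa> = 1 and
  y' = 0 the domination is linear growth, with \<kappa> = 0 it is the local Lipschitz condition, so
  both estimates are instances of one. The level \<open>n\<close> is only qualitative.\<close>

definition dominated_difference ::
    "real \<Rightarrow> real \<Rightarrow> real \<Rightarrow> (real \<Rightarrow> 'a set) \<Rightarrow> (real \<Rightarrow> 'a \<Rightarrow> real) \<Rightarrow>
     (real \<Rightarrow> 'a \<Rightarrow> real ^ 'd) \<Rightarrow> (real \<Rightarrow> 'a \<Rightarrow> real ^ 'd) \<Rightarrow> (real \<Rightarrow> real \<Rightarrow> 'a \<Rightarrow> real ^ 'd) \<Rightarrow> (real \<Rightarrow> real \<Rightarrow> 'a \<Rightarrow> real ^ 'r ^ 'd) \<Rightarrow>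
     (real \<Rightarrow> 'a \<Rightarrow> real ^ 'd) \<Rightarrow> (real \<Rightarrow> 'a \<Rightarrow> real ^ 'd) \<Rightarrow> (real \<Rightarrow> real \<Rightarrow> 'a \<Rightarrow> real ^ 'd) \<Rightarrow> (real \<Rightarrow> real \<Rightarrow> 'a \<Rightarrow> real ^ 'r ^ 'd) \<Rightarrow> bool" where
  "dominated_difference \<kappa> K n B \<rho> y a0 a1 a2 y' a0' a1' a2' \<longleftrightarrow>
     stopping_family T B \<and>
     (\<lambda>(s, \<omega>). \<rho> s \<omega>) \<in> borel_measurable (borel \<Otimes>\<^sub>M M) \<and> (\<forall>s \<omega>. 0 \<le> \<rho> s \<omega>) \<and>
     (\<forall>t\<in>{0..T}. AE \<omega> in M. \<rho> t \<omega> \<le> \<kappa> + norm (y t \<omega> - y' t \<omega>)) \<and>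
     (AE \<omega> in M. \<forall>s\<in>{0..T}. \<omega> \<in> B s \<longrightarrow> \<rho> s \<omega> \<le> n \<and> norm (a0 s \<omega> - a0' s \<omega>) \<le> K * \<rho> s \<omega> \<and>
        (\<forall>\<tau>\<in>{s..T}. norm (a1 \<tau> s \<omega> - a1' \<tau> s \<omega>) \<le> K * \<rho> s \<omega> \<and> norm (a2 \<tau> s \<omega> - a2' \<tau> s \<omega>) \<le> K * \<rho> s \<omega>))"

definition kernel_a :: "real \<Rightarrow> ennreal" where "kernel_a u = ennreal (u powr (\<alpha> - 1) / Gamma \<alpha>)"
definition kernel_b :: "real \<Rightarrow> ennreal" where "kernel_b u = ennreal (u powr (- \<beta>\<^sub>1))"
text \<open>The square of the stochastic kernel, as it appears in the quadratic variation.\<close>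

definition kernel_c :: "real \<Rightarrow> ennreal" where "kernel_c u = ennreal (u powr (- 2 * \<beta>\<^sub>2))"

lemma kernels_measurable [measurable]:
  "kernel_a \<in> borel_measurable borel" "kernel_b \<in> borel_measurable borel" "kernel_c \<in> borel_measurable borel"
  unfolding kernel_a_def[abs_def] kernel_b_def[abs_def] kernel_c_def[abs_def] by measurable

lemma kernels_finite:
  "(\<integral>\<^sup>+s\<in>{0..T}. kernel_a s \<partial>lborel) < \<top>" "(\<integral>\<^sup>+s\<in>{0..T}. kernel_b s \<partial>lborel) < \<top>"
  "(\<integral>\<^sup>+s\<in>{0..T}. kernel_c s \<partial>lborel) < \<top>"
proof -
  have "(\<integral>\<^sup>+s\<in>{0..T}. kernel_a s \<partial>lborel) = (\<integral>\<^sup>+s. ennreal (1 / Gamma \<alpha>) * (ennreal (s powr (\<alpha> - 1)) * indicator {0..T} s) \<partial>lborel)"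
    using Gamma_real_pos[OF \<alpha>] by (intro nn_integral_cong) (simp add: kernel_a_def ennreal_mult[symmetric] mult.assoc[symmetric])
  also have "\<dots> = ennreal (1 / Gamma \<alpha>) * (\<integral>\<^sup>+s\<in>{0..T}. ennreal (s powr (\<alpha> - 1)) \<partial>lborel)"
    by (rule nn_integral_cmult) measurable
  also have "\<dots> < \<top>"
    using powr_kernel_finite[of "\<alpha> - 1" T] \<alpha> by (simp add: ennreal_mult_less_top)
  finally show "(\<integral>\<^sup>+s\<in>{0..T}. kernel_a s \<partial>lborel) < \<top>" .
  show "(\<integral>\<^sup>+s\<in>{0..T}. kernel_b s \<partial>lborel) < \<top>"
    unfolding kernel_b_def by (rule powr_kernel_finite) (use \<beta>\<^sub>1 in simp)
  show "(\<integral>\<^sup>+s\<in>{0..T}. kernel_c s \<partial>lborel) < \<top>"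
    unfolding kernel_c_def by (rule powr_kernel_finite) (use \<beta>\<^sub>2 in simp)
qed

text \<open>The deterministic terms are dominated pathwise, the Ito integrals are kept as they are:
  for them only moments can be estimated.\<close>

lemma volterra_path_bound:
  fixes a0 a0' I I' :: "real \<Rightarrow> real ^ 'd" and a1 a1' :: "real \<Rightarrow> real \<Rightarrow> real ^ 'd"
  assumes path: "volterra_path t y y0 a0 a1 I" and path': "volterra_path t y' y0' a0' a1' I'"
    and K: "0 \<le> K" and r0: "\<And>s. 0 \<le> r s" and r: "r \<in> borel_measurable borel"
    and dom: "\<And>s. s \<in> {0..t} \<Longrightarrow> norm (a0 s - a0' s) \<le> K * r s"
      "\<And>s \<tau>. s \<in> {0..t} \<Longrightarrow> \<tau> \<in> {s..t} \<Longrightarrow> norm (a1 \<tau> s - a1' \<tau> s) \<le> K * r s"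
  shows "ennreal (norm (y - y')) \<le> ennreal (norm (y0 - y0')) +
     (\<integral>\<^sup>+\<tau>\<in>{0..t}. kernel_a (t - \<tau>) * (ennreal K * ennreal (r \<tau>) +
        ennreal K * (\<integral>\<^sup>+s\<in>{0..\<tau>}. kernel_b (\<tau> - s) * ennreal (r s) \<partial>lborel) + ennreal (norm (I \<tau> - I' \<tau>))) \<partial>lborel)"
proof -
  note int = path[unfolded volterra_path_def, THEN conjunct1] path[unfolded volterra_path_def, THEN conjunct2, THEN conjunct1]
    path[unfolded volterra_path_def, THEN conjunct2, THEN conjunct2, THEN conjunct1]
    path[unfolded volterra_path_def, THEN conjunct2, THEN conjunct2, THEN conjunct2, THEN conjunct1]
  note int' = path'[unfolded volterra_path_def, THEN conjunct1] path'[unfolded volterra_path_def, THEN conjunct2, THEN conjunct1]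
    path'[unfolded volterra_path_def, THEN conjunct2, THEN conjunct2, THEN conjunct1]
    path'[unfolded volterra_path_def, THEN conjunct2, THEN conjunct2, THEN conjunct2, THEN conjunct1]
  note y = path[unfolded volterra_path_def, THEN conjunct2, THEN conjunct2, THEN conjunct2, THEN conjunct2]
  note y' = path'[unfolded volterra_path_def, THEN conjunct2, THEN conjunct2, THEN conjunct2, THEN conjunct2]
  note r[measurable]
  let ?g = "\<lambda>\<tau>. LINT s:{0..\<tau>}|lborel. (\<tau> - s) powr (- \<beta>\<^sub>1) *\<^sub>R a1 \<tau> s"
  let ?g' = "\<lambda>\<tau>. LINT s:{0..\<tau>}|lborel. (\<tau> - s) powr (- \<beta>\<^sub>1) *\<^sub>R a1' \<tau> s"
  let ?D = "\<lambda>\<tau>. (a0 \<tau> - a0' \<tau>) + (?g \<tau> - ?g' \<tau>) + (I \<tau> - I' \<tau>)"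
  note d = frac_integral_diff[OF int(1) int'(1)] frac_integral_diff[OF int(3) int'(3)] frac_integral_diff[OF int(4) int'(4)]
  note s1 = frac_integral_add[OF d(1) d(3)]
  note s2 = frac_integral_add[OF s1(1) d(5)]
  have "y - y' = (y0 - y0') + frac_integral \<alpha> t ?D"
    unfolding s2(2) s1(2) d(2) d(4) d(6) y y' by simp
  then have "norm (y - y') \<le> norm (y0 - y0') + norm (frac_integral \<alpha> t ?D)"
    by (simp add: norm_triangle_ineq)
  then have le: "ennreal (norm (y - y')) \<le> ennreal (norm (y0 - y0')) + ennreal (norm (frac_integral \<alpha> t ?D))"
    by (simp add: ennreal_plus[symmetric] ennreal_leI del: ennreal_plus)
  have "ennreal (norm (frac_integral \<alpha> t ?D)) \<le> (\<integral>\<^sup>+\<tau>\<in>{0..t}. kernel_a (t - \<tau>) * ennreal (norm (?D \<tau>)) \<partial>lborel)"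
    unfolding kernel_a_def by (rule frac_integral_norm_le[OF s2(1) \<alpha>])
  also have "\<dots> \<le>
     (\<integral>\<^sup>+\<tau>\<in>{0..t}. kernel_a (t - \<tau>) * (ennreal K * ennreal (r \<tau>) +
        ennreal K * (\<integral>\<^sup>+s\<in>{0..\<tau>}. kernel_b (\<tau> - s) * ennreal (r s) \<partial>lborel) + ennreal (norm (I \<tau> - I' \<tau>))) \<partial>lborel)"
  proof (rule nn_integral_mono_AE)
    show "AE \<tau> in lborel. kernel_a (t - \<tau>) * ennreal (norm (?D \<tau>)) * indicator {0..t} \<tau> \<le>
      kernel_a (t - \<tau>) * (ennreal K * ennreal (r \<tau>) +
        ennreal K * (\<integral>\<^sup>+s\<in>{0..\<tau>}. kernel_b (\<tau> - s) * ennreal (r s) \<partial>lborel) + ennreal (norm (I \<tau> - I' \<tau>))) * indicator {0..t} \<tau>"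
      using int(2) int'(2)
    proof eventually_elim
      case (elim \<tau>)
      show ?case
      proof (cases "\<tau> \<in> {0..t}")
        case True
        have i1: "set_integrable lborel {0..\<tau>} (\<lambda>s. (\<tau> - s) powr (- \<beta>\<^sub>1) *\<^sub>R a1 \<tau> s)"
          and i2: "set_integrable lborel {0..\<tau>} (\<lambda>s. (\<tau> - s) powr (- \<beta>\<^sub>1) *\<^sub>R a1' \<tau> s)"
          using elim True by auto
        have "?g \<tau> - ?g' \<tau> = (LINT s:{0..\<tau>}|lborel. (\<tau> - s) powr (- \<beta>\<^sub>1) *\<^sub>R a1 \<tau> s - (\<tau> - s) powr (- \<beta>\<^sub>1) *\<^sub>R a1' \<tau> s)"
          using set_integral_diff(2)[OF i1 i2] by simp
        then have "ennreal (norm (?g \<tau> - ?g' \<tau>)) \<le> (\<integral>\<^sup>+s. ennreal (norm (indicator {0..\<tau>} s *\<^sub>R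
            ((\<tau> - s) powr (- \<beta>\<^sub>1) *\<^sub>R a1 \<tau> s - (\<tau> - s) powr (- \<beta>\<^sub>1) *\<^sub>R a1' \<tau> s))) \<partial>lborel)"
          using integral_norm_bound_ennreal[OF set_integral_diff(1)[OF i1 i2, unfolded set_integrable_def]]
          by (simp only: set_lebesgue_integral_def)
        also have "\<dots> \<le> (\<integral>\<^sup>+s. ennreal K * (kernel_b (\<tau> - s) * ennreal (r s) * indicator {0..\<tau>} s) \<partial>lborel)"
        proof (rule nn_integral_mono)
          fix s
          show "ennreal (norm (indicator {0..\<tau>} s *\<^sub>R ((\<tau> - s) powr (- \<beta>\<^sub>1) *\<^sub>R a1 \<tau> s - (\<tau> - s) powr (- \<beta>\<^sub>1) *\<^sub>R a1' \<tau> s))) \<le>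
            ennreal K * (kernel_b (\<tau> - s) * ennreal (r s) * indicator {0..\<tau>} s)"
          proof (cases "s \<in> {0..\<tau>}")
            case s: True
            have "norm ((\<tau> - s) powr (- \<beta>\<^sub>1) *\<^sub>R a1 \<tau> s - (\<tau> - s) powr (- \<beta>\<^sub>1) *\<^sub>R a1' \<tau> s) = (\<tau> - s) powr (- \<beta>\<^sub>1) * norm (a1 \<tau> s - a1' \<tau> s)"
              by (simp add: scaleR_diff_right[symmetric])
            also have "\<dots> \<le> (\<tau> - s) powr (- \<beta>\<^sub>1) * (K * r s)"
              using dom(2)[of s \<tau>] s True by (intro mult_left_mono) auto
            finally have "ennreal (norm ((\<tau> - s) powr (- \<beta>\<^sub>1) *\<^sub>R a1 \<tau> s - (\<tau> - s) powr (- \<beta>\<^sub>1) *\<^sub>R a1' \<tau> s)) \<le> ennreal ((\<tau> - s) powr (- \<beta>\<^sub>1) * (K * r s))"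
              by (rule ennreal_leI)
            then show ?thesis using s K r0[of s]
              by (simp add: kernel_b_def ennreal_mult mult.left_commute)
          qed simp
        qed
        also have "\<dots> = ennreal K * (\<integral>\<^sup>+s\<in>{0..\<tau>}. kernel_b (\<tau> - s) * ennreal (r s) \<partial>lborel)"
          by (rule nn_integral_cmult) measurable
        finally have g: "ennreal (norm (?g \<tau> - ?g' \<tau>)) \<le> ennreal K * (\<integral>\<^sup>+s\<in>{0..\<tau>}. kernel_b (\<tau> - s) * ennreal (r s) \<partial>lborel)" .
        have a: "ennreal (norm (a0 \<tau> - a0' \<tau>)) \<le> ennreal K * ennreal (r \<tau>)"
          using dom(1)[OF True] K r0[of \<tau>] by (simp add: ennreal_mult[symmetric] ennreal_leI)
        have "norm (?D \<tau>) \<le> norm (a0 \<tau> - a0' \<tau>) + norm (?g \<tau> - ?g' \<tau>) + norm (I \<tau> - I' \<tau>)"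
          by (intro order.trans[OF norm_triangle_ineq] add_mono norm_triangle_ineq order_refl)
        then have "ennreal (norm (?D \<tau>)) \<le> ennreal (norm (a0 \<tau> - a0' \<tau>)) + ennreal (norm (?g \<tau> - ?g' \<tau>)) + ennreal (norm (I \<tau> - I' \<tau>))"
          by (simp add: ennreal_plus[symmetric] ennreal_leI del: ennreal_plus)
        also have "\<dots> \<le> ennreal K * ennreal (r \<tau>) +
          ennreal K * (\<integral>\<^sup>+s\<in>{0..\<tau>}. kernel_b (\<tau> - s) * ennreal (r s) \<partial>lborel) + ennreal (norm (I \<tau> - I' \<tau>))"
          by (intro add_mono a g order_refl)
        finally show ?thesis by (intro mult_right_mono mult_left_mono) auto
      qed simp
    qed
  qed
  finally show ?thesis by (rule order.trans[OF le add_left_mono])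
qed

text \<open>The exponent equals 2N / (2N - 1), the conjugate of 2N. The singularity (1 - \<alpha>) *
  2N / (2N - 1) is below 1 exactly when \<alpha> * 2N > 1.\<close>

lemma kernel_a_powr_finite:
  assumes N: "N \<ge> 1" "1 < \<alpha> * real (2 * N)"
  shows "(\<integral>\<^sup>+u\<in>{0..T}. ennreal ((u powr (\<alpha> - 1) / Gamma \<alpha>) powr (1 + 1 / real (2 * N - 1))) \<partial>lborel) < \<top>"
proof -
  define r where "r = 1 + 1 / real (2 * N - 1)"
  have p: "0 < real (2 * N - 1)" using N by simp
  have r: "r = real (2 * N) / real (2 * N - 1)" using p by (simp add: r_def field_simps of_nat_diff)
  have G: "0 < Gamma \<alpha>" using \<alpha> by (rule Gamma_real_pos)
  have "(1 - \<alpha>) * real (2 * N) < real (2 * N - 1)" using N by (simp add: algebra_simps of_nat_diff)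
  then have "(1 - \<alpha>) * r < 1" unfolding r using p by (simp add: field_simps)
  then have a: "(\<alpha> - 1) * r > -1" by (simp add: algebra_simps)
  have "(\<integral>\<^sup>+u\<in>{0..T}. ennreal ((u powr (\<alpha> - 1) / Gamma \<alpha>) powr r) \<partial>lborel) =
     (\<integral>\<^sup>+u. ennreal (1 / Gamma \<alpha> powr r) * (ennreal (u powr ((\<alpha> - 1) * r)) * indicator {0..T} u) \<partial>lborel)"
    using G by (intro nn_integral_cong)
      (simp add: powr_divide powr_powr ennreal_mult[symmetric] mult.assoc[symmetric])
  also have "\<dots> = ennreal (1 / Gamma \<alpha> powr r) * (\<integral>\<^sup>+u\<in>{0..T}. ennreal (u powr ((\<alpha> - 1) * r)) \<partial>lborel)"
    by (rule nn_integral_cmult) measurable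
  also have "\<dots> < \<top>" using powr_kernel_finite[OF a, of T] by (simp add: ennreal_mult_less_top)
  finally show ?thesis by (simp add: r_def)
qed

text \<open>\<open>C\<close> is fixed before the stopping family and the level \<open>n\<close>, so
  it persists when the level tends to infinity. The supremum estimate contains a bare
  \<open>C\<close>, contributed by the Young-type inequality for the outer kernel, and serves only
  for tail probabilities.\<close>

definition volterra_moment_constant :: "'d :: finite itself \<Rightarrow> real \<Rightarrow> real \<Rightarrow> nat \<Rightarrow> ennreal \<Rightarrow> bool" where
  "volterra_moment_constant (_ :: 'd itself) \<kappa> K N C \<longleftrightarrow> C < \<top> \<and> (\<forall>B \<rho> n y0 (y :: real \<Rightarrow> 'a \<Rightarrow> real ^ 'd) a0 a1 a2 I y0' y' a0' a1' a2' I'.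
    volterra_rep y0 y a0 a1 a2 I \<longrightarrow> volterra_rep y0' y' a0' a1' a2' I' \<longrightarrow>
    dominated_difference \<kappa> K n B \<rho> y a0 a1 a2 y' a0' a1' a2' \<longrightarrow>
    (\<forall>t\<in>{0..T}. (\<integral>\<^sup>+\<omega>. (ennreal (\<rho> t \<omega>) * indicator (B t) \<omega>) ^ (2 * N) \<partial>M) \<le>
       C * (\<integral>\<^sup>+\<omega>. (ennreal (\<kappa> + norm (y0 \<omega> - y0' \<omega>)) * indicator (B 0) \<omega>) ^ (2 * N) \<partial>M)) \<and>
    (1 < \<alpha> * real (2 * N) \<longrightarrow>
       (\<integral>\<^sup>+\<omega>. indicator (B T) \<omega> * (SUP q\<in>\<rat> \<inter> {0..T}. ennreal (\<rho> q \<omega>)) \<partial>M) \<le>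
       (\<integral>\<^sup>+\<omega>. ennreal (\<kappa> + norm (y0 \<omega> - y0' \<omega>)) * indicator (B 0) \<omega> \<partial>M) + C +
       C * (\<integral>\<^sup>+\<omega>. (ennreal (\<kappa> + norm (y0 \<omega> - y0' \<omega>)) * indicator (B 0) \<omega>) ^ (2 * N) \<partial>M)))"

text \<open>The Gronwall constant is applied to \<rho> and the difference of the Ito integrals, both
  cut off by \<open>B\<close>; \<open>weighted_ito_moment\<close> supplies the hypothesis on
  \<open>J\<close>. For the supremum, the outer convolution is bounded by a quantity that no longer
  depends on its upper limit.\<close>

lemma volterra_rep_moment:
  fixes \<kappa> K :: real
  assumes N: "N \<ge> 1" and K: "0 \<le> K" and \<kappa>: "0 \<le> \<kappa>"
  shows "\<exists>C. volterra_moment_constant TYPE('d :: finite) \<kappa> K N C"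
proof -
  obtain C0 where moment: "simple_moment_constant TYPE('d) N C0" using simple_moment[OF N] by blast
  define C' where "C' = C0 * 2 ^ N * K ^ (2 * N)"
  define q where "q = 2 * N"
  define Cy where "Cy = (\<integral>\<^sup>+u\<in>{0..T}. ennreal ((u powr (\<alpha> - 1) / Gamma \<alpha>) powr (1 + 1 / real (2 * N - 1))) \<partial>lborel)"
  obtain C1 where volterra: "gronwall_constant T kernel_a kernel_b kernel_c K C' N C1"
    using volterra_moment_bound[OF kernels_measurable kernels_finite N, of K C'] by blast
  then have C1: "C1 < \<top>" by (simp add: gronwall_constant_def)
  \<comment> \<open>The first C1 serves the fixed-time moments. Cy and T * C1 serve the supremum:
    kernel integral and time integral of the moments of \<open>G\<close>. Finiteness of Cy is known
    only under the condition in the \<open>if\<close>.\<close>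
  define C where "C = C1 + (if 1 < \<alpha> * real (2 * N) then Cy else 0) + ennreal T * C1"
  have "C < \<top>"
    using C1 kernel_a_powr_finite[OF N] by (auto simp: C_def Cy_def ennreal_mult_less_top)
  moreover {
    fix B \<rho> n y0 a0 a1 a2 I y0' y' a0' a1' a2' I' and y :: "real \<Rightarrow> 'a \<Rightarrow> real ^ 'd"
    assume rep: "volterra_rep y0 y a0 a1 a2 I" and rep': "volterra_rep y0' y' a0' a1' a2' I'"
      and dom: "dominated_difference \<kappa> K n B \<rho> y a0 a1 a2 y' a0' a1' a2'"
    have sf: "stopping_family T B" and \<rho>m[measurable]: "(\<lambda>(s, \<omega>). \<rho> s \<omega>) \<in> borel_measurable (borel \<Otimes>\<^sub>M M)"
      and \<rho>0: "\<And>s \<omega>. 0 \<le> \<rho> s \<omega>" and \<rho>y: "\<forall>t\<in>{0..T}. AE \<omega> in M. \<rho> t \<omega> \<le> \<kappa> + norm (y t \<omega> - y' t \<omega>)"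
      and d: "AE \<omega> in M. \<forall>s\<in>{0..T}. \<omega> \<in> B s \<longrightarrow> \<rho> s \<omega> \<le> n \<and> norm (a0 s \<omega> - a0' s \<omega>) \<le> K * \<rho> s \<omega> \<and>
        (\<forall>\<tau>\<in>{s..T}. norm (a1 \<tau> s \<omega> - a1' \<tau> s \<omega>) \<le> K * \<rho> s \<omega> \<and> norm (a2 \<tau> s \<omega> - a2' \<tau> s \<omega>) \<le> K * \<rho> s \<omega>)"
      using dom by (auto simp: dominated_difference_def)
    have Bjm[measurable]: "(\<lambda>(s, \<omega>). indicator (B s) \<omega> :: ennreal) \<in> borel_measurable (borel \<Otimes>\<^sub>M M)"
      and Bmono: "\<And>s t. 0 \<le> s \<Longrightarrow> s \<le> t \<Longrightarrow> t \<le> T \<Longrightarrow> B t \<subseteq> B s"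
      using sf by (auto simp: stopping_family_def)
    have Bm[measurable]: "B t \<in> sets M" if "t \<in> {0..T}" for t
      using sf sets_F[of t] that by (auto simp: stopping_family_def)
    have y0m[measurable]: "y0 \<in> borel_measurable M" "y0' \<in> borel_measurable M"
      and Im: "(\<lambda>(\<tau>, \<omega>). I \<tau> \<omega>) \<in> borel_measurable (restrict_space lborel {0..T} \<Otimes>\<^sub>M M)"
        "(\<lambda>(\<tau>, \<omega>). I' \<tau> \<omega>) \<in> borel_measurable (restrict_space lborel {0..T} \<Otimes>\<^sub>M M)"
      using rep rep' by (auto simp: volterra_rep_def)
    define R where "R s \<omega> = ennreal (\<rho> s \<omega>) * indicator (B s) \<omega>" for s \<omega>
    define J where "J s \<omega> = ennreal (norm (indicator {0..T} s *\<^sub>R I s \<omega> - indicator {0..T} s *\<^sub>R I' s \<omega>)) * indicator (B s) \<omega>" for s \<omega>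
    define Z where "Z \<omega> = ennreal (\<kappa> + norm (y0 \<omega> - y0' \<omega>)) * indicator (B 0) \<omega>" for \<omega>
    define G where "G \<tau> \<omega> = ennreal K * R \<tau> \<omega> + ennreal K * (\<integral>\<^sup>+s\<in>{0..\<tau>}. kernel_b (\<tau> - s) * R s \<omega> \<partial>lborel) + J \<tau> \<omega>" for \<tau> \<omega>
    have B0: "B 0 \<in> sets M" using Bm[of 0] T by simp
    have Rm[measurable]: "(\<lambda>(s, \<omega>). R s \<omega>) \<in> borel_measurable (borel \<Otimes>\<^sub>M M)"
      unfolding R_def by measurable
    have [measurable]: "(\<lambda>(s, \<omega>). indicator {0..T} s *\<^sub>R I s \<omega>) \<in> borel_measurable (borel \<Otimes>\<^sub>M M)"
      "(\<lambda>(s, \<omega>). indicator {0..T} s *\<^sub>R I' s \<omega>) \<in> borel_measurable (borel \<Otimes>\<^sub>M M)"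
      using jointly_measurable_extend[OF Im(1), of 0] jointly_measurable_extend[OF Im(2), of 0] T by simp_all
    have Jm[measurable]: "(\<lambda>(s, \<omega>). J s \<omega>) \<in> borel_measurable (borel \<Otimes>\<^sub>M M)"
      unfolding J_def by measurable
    have Zm[measurable]: "Z \<in> borel_measurable M"
      unfolding Z_def using B0 by measurable
    have conv_m: "(\<lambda>(\<tau>, \<omega>). \<integral>\<^sup>+s\<in>{0..\<tau>}. kernel_b (\<tau> - s) * R s \<omega> \<partial>lborel) \<in> borel_measurable (borel \<Otimes>\<^sub>M M)"
    proof -
      have eq: "indicator {0..\<tau>} s = (if 0 \<le> s \<and> s \<le> \<tau> then 1 else 0 :: ennreal)" for \<tau> s :: real
        by (auto simp: indicator_def)
      show ?thesis unfolding eq split_beta' by (intro lborel.borel_measurable_nn_integral) measurable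
    qed
    have Gm[measurable]: "(\<lambda>(s, \<omega>). G s \<omega>) \<in> borel_measurable (borel \<Otimes>\<^sub>M M)"
      unfolding G_def using conv_m Rm Jm by (simp add: split_beta')
    have path: "AE \<omega> in M. \<omega> \<in> B t \<longrightarrow> ennreal (\<rho> t \<omega>) \<le> Z \<omega> + (\<integral>\<^sup>+\<tau>\<in>{0..t}. kernel_a (t - \<tau>) * G \<tau> \<omega> \<partial>lborel)"
      if t: "t \<in> {0..T}" for t
    proof -
      have 1: "AE \<omega> in M. volterra_path t (y t \<omega>) (y0 \<omega>) (\<lambda>\<tau>. a0 \<tau> \<omega>) (\<lambda>\<tau> s. a1 \<tau> s \<omega>) (\<lambda>\<tau>. I \<tau> \<omega>)"
        using rep t unfolding volterra_rep_def by blast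
      have 2: "AE \<omega> in M. volterra_path t (y' t \<omega>) (y0' \<omega>) (\<lambda>\<tau>. a0' \<tau> \<omega>) (\<lambda>\<tau> s. a1' \<tau> s \<omega>) (\<lambda>\<tau>. I' \<tau> \<omega>)"
        using rep' t unfolding volterra_rep_def by blast
      have 3: "AE \<omega> in M. \<rho> t \<omega> \<le> \<kappa> + norm (y t \<omega> - y' t \<omega>)" using \<rho>y t by blast
      show ?thesis
        using 1 2 3 d AE_space
      proof eventually_elim
        case (elim \<omega>)
        show ?case
        proof
          assume \<omega>: "\<omega> \<in> B t"
          \<comment> \<open>The events decrease in time, so on \<open>B t\<close> every earlier
            indicator equals 1 and may be placed inside the integrals.\<close>
          have \<omega>s: "\<omega> \<in> B s" if "0 \<le> s" "s \<le> t" for s using Bmono[OF that] t \<omega> by auto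
          have "ennreal (norm (y t \<omega> - y' t \<omega>)) \<le> ennreal (norm (y0 \<omega> - y0' \<omega>)) +
            (\<integral>\<^sup>+\<tau>\<in>{0..t}. kernel_a (t - \<tau>) * (ennreal K * ennreal (\<rho> \<tau> \<omega>) +
             ennreal K * (\<integral>\<^sup>+s\<in>{0..\<tau>}. kernel_b (\<tau> - s) * ennreal (\<rho> s \<omega>) \<partial>lborel) + ennreal (norm (I \<tau> \<omega> - I' \<tau> \<omega>))) \<partial>lborel)"
            by (rule volterra_path_bound[OF elim(1,2) K \<rho>0 section_measurable[OF \<rho>m elim(5)]])
               (use elim(4) \<omega>s t in auto)
          also have "(\<integral>\<^sup>+\<tau>\<in>{0..t}. kernel_a (t - \<tau>) * (ennreal K * ennreal (\<rho> \<tau> \<omega>) +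
             ennreal K * (\<integral>\<^sup>+s\<in>{0..\<tau>}. kernel_b (\<tau> - s) * ennreal (\<rho> s \<omega>) \<partial>lborel) + ennreal (norm (I \<tau> \<omega> - I' \<tau> \<omega>))) \<partial>lborel)
             = (\<integral>\<^sup>+\<tau>\<in>{0..t}. kernel_a (t - \<tau>) * G \<tau> \<omega> \<partial>lborel)"
          proof (rule nn_integral_cong)
            fix \<tau>
            show "kernel_a (t - \<tau>) * (ennreal K * ennreal (\<rho> \<tau> \<omega>) +
             ennreal K * (\<integral>\<^sup>+s\<in>{0..\<tau>}. kernel_b (\<tau> - s) * ennreal (\<rho> s \<omega>) \<partial>lborel) + ennreal (norm (I \<tau> \<omega> - I' \<tau> \<omega>))) * indicator {0..t} \<tau>
             = kernel_a (t - \<tau>) * G \<tau> \<omega> * indicator {0..t} \<tau>"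
            proof (cases "\<tau> \<in> {0..t}")
              case True
              have "(\<integral>\<^sup>+s\<in>{0..\<tau>}. kernel_b (\<tau> - s) * ennreal (\<rho> s \<omega>) \<partial>lborel) = (\<integral>\<^sup>+s\<in>{0..\<tau>}. kernel_b (\<tau> - s) * R s \<omega> \<partial>lborel)"
              proof (rule nn_integral_cong)
                fix s
                show "kernel_b (\<tau> - s) * ennreal (\<rho> s \<omega>) * indicator {0..\<tau>} s = kernel_b (\<tau> - s) * R s \<omega> * indicator {0..\<tau>} s"
                  using \<omega>s[of s] True by (cases "s \<in> {0..\<tau>}") (auto simp: R_def)
              qed
              then show ?thesis using \<omega>s[of \<tau>] True t by (simp add: G_def R_def J_def)
            qed simp
          qed
          finally have le: "ennreal (norm (y t \<omega> - y' t \<omega>)) \<le> ennreal (norm (y0 \<omega> - y0' \<omega>)) + (\<integral>\<^sup>+\<tau>\<in>{0..t}. kernel_a (t - \<tau>) * G \<tau> \<omega> \<partial>lborel)" .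
          have "ennreal (\<rho> t \<omega>) \<le> ennreal \<kappa> + ennreal (norm (y t \<omega> - y' t \<omega>))"
            using elim(3) \<kappa> by (simp add: ennreal_plus[symmetric] ennreal_leI del: ennreal_plus)
          also have "\<dots> \<le> ennreal \<kappa> + (ennreal (norm (y0 \<omega> - y0' \<omega>)) + (\<integral>\<^sup>+\<tau>\<in>{0..t}. kernel_a (t - \<tau>) * G \<tau> \<omega> \<partial>lborel))"
            by (intro add_left_mono le)
          also have "\<dots> = Z \<omega> + (\<integral>\<^sup>+\<tau>\<in>{0..t}. kernel_a (t - \<tau>) * G \<tau> \<omega> \<partial>lborel)"
            using \<omega>s[of 0] t \<kappa> by (simp add: Z_def add.assoc)
          finally show "ennreal (\<rho> t \<omega>) \<le> \<dots>" .
        qed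
      qed
    qed
    have V1: "\<forall>t\<in>{0..T}. AE \<omega> in M. R t \<omega> \<le> Z \<omega> + (\<integral>\<^sup>+\<tau>\<in>{0..t}. kernel_a (t - \<tau>) * G \<tau> \<omega> \<partial>lborel)"
    proof
      fix t assume "t \<in> {0..T}"
      from path[OF this] show "AE \<omega> in M. R t \<omega> \<le> Z \<omega> + (\<integral>\<^sup>+\<tau>\<in>{0..t}. kernel_a (t - \<tau>) * G \<tau> \<omega> \<partial>lborel)"
        by eventually_elim (auto simp: R_def indicator_def)
    qed
    have V2: "\<forall>t\<in>{0..T}. AE \<omega> in M. R t \<omega> \<le> ennreal n"
    proof
      fix t assume t: "t \<in> {0..T}"
      show "AE \<omega> in M. R t \<omega> \<le> ennreal n"
        using d by eventually_elim (use t in \<open>auto simp: R_def indicator_def intro: ennreal_leI\<close>)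
    qed
    have V3: "\<forall>\<tau>\<in>{0<..T}. (\<integral>\<^sup>+\<omega>. J \<tau> \<omega> ^ (2 * N) \<partial>M) \<le>
       ennreal C' * (\<integral>\<^sup>+\<omega>. (\<integral>\<^sup>+s\<in>{0..\<tau>}. kernel_c (\<tau> - s) * (R s \<omega>)\<^sup>2 \<partial>lborel) ^ N \<partial>M)"
    proof
      fix \<tau> assume \<tau>: "\<tau> \<in> {0<..T}"
      then have \<tau>': "\<tau> \<in> {0..T}" by auto
      obtain h where h: "(\<lambda>(s, \<omega>). h s \<omega>) \<in> borel_measurable (borel \<Otimes>\<^sub>M M)" "AE \<omega> in M. \<forall>s\<in>{0..\<tau>}. a2 \<tau> s \<omega> = h s \<omega>"
        using rep \<tau>' unfolding volterra_rep_def by blast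
      obtain h' where h': "(\<lambda>(s, \<omega>). h' s \<omega>) \<in> borel_measurable (borel \<Otimes>\<^sub>M M)" "AE \<omega> in M. \<forall>s\<in>{0..\<tau>}. a2' \<tau> s \<omega> = h' s \<omega>"
        using rep' \<tau>' unfolding volterra_rep_def by blast
      have ito: "has_ito_integral M F W \<tau> (\<lambda>s \<omega>. (\<tau> - s) powr (- \<beta>\<^sub>2) *\<^sub>R a2 \<tau> s \<omega>) (I \<tau>)"
        "has_ito_integral M F W \<tau> (\<lambda>s \<omega>. (\<tau> - s) powr (- \<beta>\<^sub>2) *\<^sub>R a2' \<tau> s \<omega>) (I' \<tau>)"
        using rep rep' \<tau>' unfolding volterra_rep_def by blast+
      have sf': "stopping_family \<tau> B" using sf \<tau> by (auto simp: stopping_family_def)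
      have "(\<integral>\<^sup>+\<omega>. J \<tau> \<omega> ^ (2 * N) \<partial>M) = (\<integral>\<^sup>+\<omega>. indicator (B \<tau>) \<omega> * ennreal (norm (I \<tau> \<omega> - I' \<tau> \<omega>) ^ (2 * N)) \<partial>M)"
        using \<tau> N by (intro nn_integral_cong) (auto simp: J_def indicator_def ennreal_power power_0_left)
      also have "\<dots> \<le> ennreal C' * (\<integral>\<^sup>+\<omega>. (\<integral>\<^sup>+s\<in>{0..\<tau>}. ennreal ((\<tau> - s) powr (- 2 * \<beta>\<^sub>2)) * (ennreal (\<rho> s \<omega>) * indicator (B s) \<omega>)\<^sup>2 \<partial>lborel) ^ N \<partial>M)"
        unfolding C'_def
      proof (rule weighted_ito_moment[OF moment _ sf' \<beta>\<^sub>2 ito h(1) h'(1) h(2) h'(2) K \<rho>m \<rho>0])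
        show "0 < \<tau>" using \<tau> by simp
        show "AE \<omega> in M. \<forall>s\<in>{0..\<tau>}. \<omega> \<in> B s \<longrightarrow> norm (a2 \<tau> s \<omega> - a2' \<tau> s \<omega>) \<le> K * \<rho> s \<omega> \<and> \<rho> s \<omega> \<le> n"
          using d by eventually_elim (use \<tau> in auto)
      qed
      finally show "(\<integral>\<^sup>+\<omega>. J \<tau> \<omega> ^ (2 * N) \<partial>M) \<le>
         ennreal C' * (\<integral>\<^sup>+\<omega>. (\<integral>\<^sup>+s\<in>{0..\<tau>}. kernel_c (\<tau> - s) * (R s \<omega>)\<^sup>2 \<partial>lborel) ^ N \<partial>M)"
        by (simp add: kernel_c_def R_def)
    qed
    from volterra[unfolded gronwall_constant_def, THEN conjunct2, rule_format, OF Rm Jm Zm V2[rule_format] V1[rule_format, unfolded G_def] V3[rule_format]]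
    have RZ: "\<forall>t\<in>{0..T}. (\<integral>\<^sup>+\<omega>. R t \<omega> ^ (2 * N) \<partial>M) \<le> C1 * (\<integral>\<^sup>+\<omega>. Z \<omega> ^ (2 * N) \<partial>M)"
      and GZ: "\<forall>\<tau>\<in>{0<..T}. (\<integral>\<^sup>+\<omega>. G \<tau> \<omega> ^ (2 * N) \<partial>M) \<le> C1 * (\<integral>\<^sup>+\<omega>. Z \<omega> ^ (2 * N) \<partial>M)"
      unfolding G_def by auto
    let ?EZ = "\<integral>\<^sup>+\<omega>. Z \<omega> ^ (2 * N) \<partial>M"
    have A: "(\<integral>\<^sup>+\<omega>. R t \<omega> ^ (2 * N) \<partial>M) \<le> C * ?EZ" if "t \<in> {0..T}" for t
    proof -
      have "C1 * ?EZ \<le> C * ?EZ"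
        unfolding C_def by (intro mult_right_mono) (auto simp: add.assoc)
      then show ?thesis using RZ that by (auto intro: order.trans)
    qed
    have S: "(\<integral>\<^sup>+\<omega>. indicator (B T) \<omega> * (SUP q\<in>\<rat> \<inter> {0..T}. ennreal (\<rho> q \<omega>)) \<partial>M) \<le> (\<integral>\<^sup>+\<omega>. Z \<omega> \<partial>M) + C + C * ?EZ"
      if big: "1 < \<alpha> * real (2 * N)"
    proof -
      have C: "C = C1 + Cy + ennreal T * C1" using big by (simp add: C_def)
      obtain p where p: "2 * N = Suc p" "p = 2 * N - 1" "p \<ge> 1" using N by (cases "2 * N") auto
      have Ga: "0 \<le> u powr (\<alpha> - 1) / Gamma \<alpha>" for u using Gamma_real_pos[OF \<alpha>] by simp
      \<comment> \<open>Separating kernel and \<open>G\<close> replaces the convolution by a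
        constant and an integral up to \<open>T\<close>, a bound that is uniform in
        \<open>t\<close>.\<close>
      have young: "(\<integral>\<^sup>+\<tau>\<in>{0..t}. kernel_a (t - \<tau>) * G \<tau> \<omega> \<partial>lborel) \<le> Cy + (\<integral>\<^sup>+\<tau>\<in>{0..T}. G \<tau> \<omega> ^ (2 * N) \<partial>lborel)"
        if t: "t \<in> {0..T}" and \<omega>: "\<omega> \<in> space M" for t \<omega>
      proof -
        let ?k = "\<lambda>u. ennreal ((u powr (\<alpha> - 1) / Gamma \<alpha>) powr (1 + 1 / real (2 * N - 1)))"
        have [measurable]: "(\<lambda>\<tau>. G \<tau> \<omega>) \<in> borel_measurable borel" by (rule section_measurable[OF Gm \<omega>])
        have "(\<integral>\<^sup>+\<tau>\<in>{0..t}. kernel_a (t - \<tau>) * G \<tau> \<omega> \<partial>lborel) \<le>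
          (\<integral>\<^sup>+\<tau>. ?k (t - \<tau>) * indicator {0..t} \<tau> + G \<tau> \<omega> ^ (2 * N) * indicator {0..T} \<tau> \<partial>lborel)"
        proof (rule nn_integral_mono)
          fix \<tau>
          show "kernel_a (t - \<tau>) * G \<tau> \<omega> * indicator {0..t} \<tau> \<le> ?k (t - \<tau>) * indicator {0..t} \<tau> + G \<tau> \<omega> ^ (2 * N) * indicator {0..T} \<tau>"
            using mult_le_powr_add_power[OF Ga p(3), of "t - \<tau>" "G \<tau> \<omega>"] t unfolding p(1) p(2)[symmetric] kernel_a_def
            by (auto simp: indicator_def simp del: power_Suc)
        qed
        also have "\<dots> = (\<integral>\<^sup>+\<tau>\<in>{0..t}. ?k (t - \<tau>) \<partial>lborel) + (\<integral>\<^sup>+\<tau>\<in>{0..T}. G \<tau> \<omega> ^ (2 * N) \<partial>lborel)"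
          by (rule nn_integral_add) measurable
        also have "\<dots> \<le> Cy + (\<integral>\<^sup>+\<tau>\<in>{0..T}. G \<tau> \<omega> ^ (2 * N) \<partial>lborel)"
          unfolding Cy_def using convolution_le[of ?k t T "\<lambda>_. 1" 1] t by (intro add_right_mono) simp
        finally show ?thesis .
      qed
      \<comment> \<open>The null set in \<open>path\<close> varies with the time; for rational times
        a countable union remains null.\<close>
      have "AE \<omega> in M. \<forall>q\<in>\<rat> \<inter> {0..T}. \<omega> \<in> B q \<longrightarrow> ennreal (\<rho> q \<omega>) \<le> Z \<omega> + (\<integral>\<^sup>+\<tau>\<in>{0..q}. kernel_a (q - \<tau>) * G \<tau> \<omega> \<partial>lborel)"
        by (subst AE_ball_countable) (use countable_rat path in \<open>auto intro: countable_subset\<close>)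
      then have "AE \<omega> in M. indicator (B T) \<omega> * (SUP q\<in>\<rat> \<inter> {0..T}. ennreal (\<rho> q \<omega>)) \<le>
          Z \<omega> + (Cy + (\<integral>\<^sup>+\<tau>\<in>{0..T}. G \<tau> \<omega> ^ (2 * N) \<partial>lborel))"
        using AE_space
      proof eventually_elim
        case (elim \<omega>)
        show ?case
        proof (cases "\<omega> \<in> B T")
          case True
          have "(SUP q\<in>\<rat> \<inter> {0..T}. ennreal (\<rho> q \<omega>)) \<le> Z \<omega> + (Cy + (\<integral>\<^sup>+\<tau>\<in>{0..T}. G \<tau> \<omega> ^ (2 * N) \<partial>lborel))"
          proof (rule SUP_least)
            fix q assume q: "q \<in> \<rat> \<inter> {0..T}"
            then have "\<omega> \<in> B q" using Bmono[of q T] True by auto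
            then have "ennreal (\<rho> q \<omega>) \<le> Z \<omega> + (\<integral>\<^sup>+\<tau>\<in>{0..q}. kernel_a (q - \<tau>) * G \<tau> \<omega> \<partial>lborel)" using elim q by blast
            also have "\<dots> \<le> Z \<omega> + (Cy + (\<integral>\<^sup>+\<tau>\<in>{0..T}. G \<tau> \<omega> ^ (2 * N) \<partial>lborel))"
              by (intro add_left_mono young) (use q elim in auto)
            finally show "ennreal (\<rho> q \<omega>) \<le> \<dots>" .
          qed
          then show ?thesis using True by simp
        qed simp
      qed
      then have le1: "(\<integral>\<^sup>+\<omega>. indicator (B T) \<omega> * (SUP q\<in>\<rat> \<inter> {0..T}. ennreal (\<rho> q \<omega>)) \<partial>M) \<le>
        (\<integral>\<^sup>+\<omega>. Z \<omega> + (Cy + (\<integral>\<^sup>+\<tau>\<in>{0..T}. G \<tau> \<omega> ^ (2 * N) \<partial>lborel)) \<partial>M)"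
        by (rule nn_integral_mono_AE)
      have eq1: "(\<integral>\<^sup>+\<omega>. Z \<omega> + (Cy + (\<integral>\<^sup>+\<tau>\<in>{0..T}. G \<tau> \<omega> ^ (2 * N) \<partial>lborel)) \<partial>M) = (\<integral>\<^sup>+\<omega>. Z \<omega> \<partial>M) + (Cy + (\<integral>\<^sup>+\<omega>. (\<integral>\<^sup>+\<tau>\<in>{0..T}. G \<tau> \<omega> ^ (2 * N) \<partial>lborel) \<partial>M))"
      proof -
        have [measurable]: "(\<lambda>\<omega>. \<integral>\<^sup>+\<tau>\<in>{0..T}. G \<tau> \<omega> ^ (2 * N) \<partial>lborel) \<in> borel_measurable M"
          by (intro lborel.borel_measurable_nn_integral) measurable
        show ?thesis by (simp add: nn_integral_add emeasure_space_1)
      qed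
      have "(\<integral>\<^sup>+\<omega>. (\<integral>\<^sup>+\<tau>\<in>{0..T}. G \<tau> \<omega> ^ (2 * N) \<partial>lborel) \<partial>M) = (\<integral>\<^sup>+\<tau>. (\<integral>\<^sup>+\<omega>. G \<tau> \<omega> ^ (2 * N) * indicator {0..T} \<tau> \<partial>M) \<partial>lborel)"
      proof -
        interpret L: pair_sigma_finite lborel M ..
        show ?thesis by (rule L.Fubini') measurable
      qed
      also have "\<dots> \<le> (\<integral>\<^sup>+\<tau>. C1 * ?EZ * indicator {0..T} \<tau> \<partial>lborel)"
      proof (rule nn_integral_mono_AE)
        have "AE \<tau> in lborel. \<tau> \<noteq> (0::real)" by (rule AE_lborel_singleton)
        then show "AE \<tau> in lborel. (\<integral>\<^sup>+\<omega>. G \<tau> \<omega> ^ (2 * N) * indicator {0..T} \<tau> \<partial>M) \<le> C1 * ?EZ * indicator {0..T} \<tau>"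
          by eventually_elim (use GZ in \<open>auto simp: indicator_def\<close>)
      qed
      also have "\<dots> = C1 * ?EZ * ennreal T" using T by (simp add: nn_integral_cmult)
      finally have "(\<integral>\<^sup>+\<omega>. indicator (B T) \<omega> * (SUP q\<in>\<rat> \<inter> {0..T}. ennreal (\<rho> q \<omega>)) \<partial>M) \<le>
         (\<integral>\<^sup>+\<omega>. Z \<omega> \<partial>M) + (Cy + C1 * ?EZ * ennreal T)"
        by (intro order.trans[OF le1[unfolded eq1]] add_left_mono)
      also have "\<dots> \<le> (\<integral>\<^sup>+\<omega>. Z \<omega> \<partial>M) + (C + C * ?EZ)"
      proof (intro add_left_mono add_mono)
        show "Cy \<le> C" unfolding C by (intro add_increasing2 add_increasing order_refl) auto
        have "C1 * ?EZ * ennreal T = ennreal T * C1 * ?EZ" by (simp only: ac_simps)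
        also have "\<dots> \<le> C * ?EZ" unfolding C by (intro mult_right_mono add_increasing order_refl) auto
        finally show "C1 * ?EZ * ennreal T \<le> C * ?EZ" .
      qed
      finally show ?thesis by (simp add: add.assoc)
    qed
    have "(\<forall>t\<in>{0..T}. (\<integral>\<^sup>+\<omega>. R t \<omega> ^ (2 * N) \<partial>M) \<le> C * ?EZ) \<and>
      (1 < \<alpha> * real (2 * N) \<longrightarrow> (\<integral>\<^sup>+\<omega>. indicator (B T) \<omega> * (SUP q\<in>\<rat> \<inter> {0..T}. ennreal (\<rho> q \<omega>)) \<partial>M) \<le> (\<integral>\<^sup>+\<omega>. Z \<omega> \<partial>M) + C + C * ?EZ)"
      using A S by blast
    note this[unfolded R_def Z_def] }
  ultimately show ?thesis unfolding volterra_moment_constant_def by (intro exI[of _ C] conjI allI impI) blast+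
qed

end

section \<open>Continuous dependence\<close>

context volterra_setting begin

lemma volterra_rep_zero:
  "volterra_rep (\<lambda>_. 0) (\<lambda>_ _. 0 :: real ^ 'd) (\<lambda>_ _. 0) (\<lambda>_ _ _. 0) (\<lambda>_ _ _. 0) (\<lambda>_ _. 0)"
proof -
  have "has_ito_integral M F W \<tau> (\<lambda>s \<omega>. 0 :: real ^ 'r ^ 'd) (\<lambda>_. 0)" if "0 \<le> \<tau>" for \<tau>
    unfolding has_ito_integral_def
  proof (intro conjI)
    show "ito_integrand M F \<tau> (\<lambda>s \<omega>. 0 :: real ^ 'r ^ 'd)" by (simp add: ito_integrand_def)
    let ?n = "\<lambda>_ :: nat. 0 :: nat" and ?u = "\<lambda>(_ :: nat) (_ :: nat). 0 :: real" and ?\<xi> = "\<lambda>(_ :: nat) (_ :: nat) (_ :: 'a). 0 :: real ^ 'r ^ 'd"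
    show "\<exists>n u \<xi>. (\<forall>k. simple_integrand M F \<tau> (n k) (u k) (\<xi> k :: nat \<Rightarrow> 'a \<Rightarrow> real ^ 'r ^ 'd)) \<and>
        (\<forall>e>0. (\<lambda>k. \<P>(\<omega> in M. ennreal e <
            (\<integral>\<^sup>+s\<in>{0..\<tau>}. ennreal ((norm (simple_process (n k) (u k) (\<xi> k) s \<omega> - 0))\<^sup>2) \<partial>lborel))) \<longlonglongrightarrow> 0) \<and>
        (\<forall>e>0. (\<lambda>k. \<P>(\<omega> in M. e < norm (simple_ito_integral W (n k) (u k) (\<xi> k) \<omega> - 0))) \<longlonglongrightarrow> 0)"
      by (rule exI[of _ ?n], rule exI[of _ ?u], rule exI[of _ ?\<xi>])
         (auto simp: simple_integrand_def simple_process_def simple_ito_integral_def that not_less)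
  qed simp
  then show ?thesis
    by (auto simp: volterra_rep_def volterra_path_def frac_integrable_def frac_integral_def set_integrable_def set_lebesgue_integral_def
        intro!: exI[of _ "\<lambda>_ _. 0"])
qed

end

section \<open>Solutions and their moments\<close>

locale volterra_equation = volterra_setting M F W T \<alpha> \<beta>\<^sub>1 \<beta>\<^sub>2
  for M :: "'a measure" and F :: "real \<Rightarrow> 'a measure" and W :: "real \<Rightarrow> 'a \<Rightarrow> real ^ 'r" and T \<alpha> \<beta>\<^sub>1 \<beta>\<^sub>2 :: real +
  fixes f\<^sub>0 :: "real \<Rightarrow> real ^ 'd \<Rightarrow> real ^ 'd"
    and f\<^sub>1 :: "real \<Rightarrow> real \<Rightarrow> real ^ 'd \<Rightarrow> real ^ 'd"
    and f\<^sub>2 :: "real \<Rightarrow> real \<Rightarrow> real ^ 'd \<Rightarrow> real ^ 'r ^ 'd"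
  assumes f2_measurable: "(\<lambda>(t, s, x). f\<^sub>2 t s x) \<in> borel_measurable (restrict_space borel ({0..T} \<times> {0..T} \<times> UNIV))"
    and local_lipschitz:
      "\<forall>m::nat. m \<ge> 1 \<longrightarrow> (\<exists>K>0. \<forall>t\<in>{0..T}. \<forall>s\<in>{0..T}. \<forall>x\<^sub>1 x\<^sub>2.
         max (norm x\<^sub>1) (norm x\<^sub>2) \<le> real m \<longrightarrow>
         norm (f\<^sub>0 s x\<^sub>1 - f\<^sub>0 s x\<^sub>2) \<le> K * norm (x\<^sub>1 - x\<^sub>2) \<and>
         norm (f\<^sub>1 t s x\<^sub>1 - f\<^sub>1 t s x\<^sub>2) \<le> K * norm (x\<^sub>1 - x\<^sub>2) \<and>
         norm (f\<^sub>2 t s x\<^sub>1 - f\<^sub>2 t s x\<^sub>2) \<le> K * norm (x\<^sub>1 - x\<^sub>2))"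
    and linear_growth:
      "\<exists>L>0. \<forall>t\<in>{0..T}. \<forall>s\<in>{0..T}. \<forall>x.
         norm (f\<^sub>0 s x) \<le> L * (1 + norm x) \<and>
         norm (f\<^sub>1 t s x) \<le> L * (1 + norm x) \<and>
         norm (f\<^sub>2 t s x) \<le> L * (1 + norm x)"
begin

definition solution :: "('a \<Rightarrow> real ^ 'd) \<Rightarrow> (real \<Rightarrow> 'a \<Rightarrow> real ^ 'd) \<Rightarrow> bool" where
  "solution z0 z \<longleftrightarrow> z0 \<in> borel_measurable (F 0) \<and> is_solution M F W T \<alpha> \<beta>\<^sub>1 \<beta>\<^sub>2 f\<^sub>0 f\<^sub>1 f\<^sub>2 z0 z"

text \<open>A version with all paths continuous on the whole line, which is jointly measurable.\<close>

definition continuous_version :: "(real \<Rightarrow> 'a \<Rightarrow> real ^ 'd) \<Rightarrow> real \<Rightarrow> 'a \<Rightarrow> real ^ 'd" where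
  "continuous_version z t \<omega> = (if continuous_on {0..T} (\<lambda>t. z t \<omega>) then z (max 0 (min T t)) \<omega> else 0)"

lemma solution_adapted: "solution z0 z \<Longrightarrow> 0 \<le> t \<Longrightarrow> t \<le> T \<Longrightarrow> z t \<in> borel_measurable (F t)"
  and solution_initial: "solution z0 z \<Longrightarrow> z0 \<in> borel_measurable (F 0)"
  and solution_continuous: "solution z0 z \<Longrightarrow> AE \<omega> in M. continuous_on {0..T} (\<lambda>t. z t \<omega>)"
  by (auto simp: solution_def is_solution_def)

lemma solution_measurable: "solution z0 z \<Longrightarrow> t \<in> {0..T} \<Longrightarrow> z t \<in> borel_measurable M"
  using solution_adapted[of z0 z t] F_measurable[of t] by auto

lemma solution_initial_measurable: "solution z0 z \<Longrightarrow> z0 \<in> borel_measurable M"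
  using solution_initial F_measurable[of 0] by auto

lemma continuous_version_eq:
  assumes "solution z0 z" shows "AE \<omega> in M. \<forall>t\<in>{0..T}. continuous_version z t \<omega> = z t \<omega>"
  using solution_continuous[OF assms] by eventually_elim (auto simp: continuous_version_def min_def max_def)

lemma continuous_version_measurable:
  assumes z: "solution z0 z"
  shows "(\<lambda>(t, \<omega>). continuous_version z t \<omega>) \<in> borel_measurable (borel \<Otimes>\<^sub>M M)"
proof (rule jointly_measurable_continuous)
  fix t
  have "z (max 0 (min T t)) \<in> borel_measurable M" using T by (intro solution_measurable[OF z]) auto
  then show "continuous_version z t \<in> borel_measurable M"
    by (rule measurable_AE_cong) (use solution_continuous[OF z] in eventually_elim, simp add: continuous_version_def)
next
  fix \<omega>
  show "continuous_on UNIV (\<lambda>t. continuous_version z t \<omega>)"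
  proof (cases "continuous_on {0..T} (\<lambda>t. z t \<omega>)")
    case True
    have "continuous_on UNIV (\<lambda>t. z (max 0 (min T t)) \<omega>)"
      by (rule continuous_on_compose2[OF True]) (use T in \<open>auto intro!: continuous_intros\<close>)
    then show ?thesis using True by (simp add: continuous_version_def)
  qed (simp add: continuous_version_def)
qed

lemma solution_rep:
  assumes z: "solution z0 z"
  shows "\<exists>I. volterra_rep z0 z (\<lambda>\<tau> \<omega>. f\<^sub>0 \<tau> (z \<tau> \<omega>)) (\<lambda>\<tau> s \<omega>. f\<^sub>1 \<tau> s (z s \<omega>)) (\<lambda>\<tau> s \<omega>. f\<^sub>2 \<tau> s (z s \<omega>)) I"
proof -
  have "is_solution M F W T \<alpha> \<beta>\<^sub>1 \<beta>\<^sub>2 f\<^sub>0 f\<^sub>1 f\<^sub>2 z0 z" using z by (simp add: solution_def)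
  then obtain I where I: "(\<lambda>(\<tau>, \<omega>). I \<tau> \<omega>) \<in> borel_measurable (restrict_space lborel {0..T} \<Otimes>\<^sub>M M)"
    "\<forall>\<tau>\<in>{0..T}. has_ito_integral M F W \<tau> (\<lambda>s \<omega>. (\<tau> - s) powr (-\<beta>\<^sub>2) *\<^sub>R f\<^sub>2 \<tau> s (z s \<omega>)) (I \<tau>)"
    "\<forall>t\<in>{0..T}. AE \<omega> in M. volterra_path t (z t \<omega>) (z0 \<omega>) (\<lambda>\<tau>. f\<^sub>0 \<tau> (z \<tau> \<omega>)) (\<lambda>\<tau> s. f\<^sub>1 \<tau> s (z s \<omega>)) (\<lambda>\<tau>. I \<tau> \<omega>)"
    unfolding is_solution_def Let_def volterra_path_def by (elim conjE exE) (rule that[unfolded volterra_path_def])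
  have h: "\<exists>h. (\<lambda>(s, \<omega>). h s \<omega>) \<in> borel_measurable (borel \<Otimes>\<^sub>M M) \<and>
        (AE \<omega> in M. \<forall>s\<in>{0..\<tau>}. f\<^sub>2 \<tau> s (z s \<omega>) = h s \<omega>)" if \<tau>: "\<tau> \<in> {0..T}" for \<tau>
  proof (intro exI conjI)
    \<comment> \<open>\<open>f\<^sub>2\<close> is measurable only for times in the square, so the
      time is clamped to {0..T}; together with the continuous version of \<open>z\<close> this gives
      a Borel version on the whole line.\<close>
    let ?h = "\<lambda>s \<omega>. f\<^sub>2 \<tau> (max 0 (min T s)) (continuous_version z s \<omega>)"
    have [measurable]: "(\<lambda>p. continuous_version z (fst p) (snd p)) \<in> borel_measurable (borel \<Otimes>\<^sub>M M)"
      using continuous_version_measurable[OF z] by (simp add: split_beta')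
    have "(\<lambda>p. (\<tau>, max 0 (min T (fst p)), continuous_version z (fst p) (snd p))) \<in> borel_measurable (borel \<Otimes>\<^sub>M M)"
      by measurable
    then have "(\<lambda>p. (\<tau>, max 0 (min T (fst p)), continuous_version z (fst p) (snd p))) \<in>
      measurable (borel \<Otimes>\<^sub>M M) (restrict_space borel ({0..T} \<times> {0..T} \<times> UNIV))"
      by (rule measurable_restrict_space2[rotated]) (use \<tau> T in auto)
    from measurable_compose[OF this f2_measurable]
    show "(\<lambda>(s, \<omega>). ?h s \<omega>) \<in> borel_measurable (borel \<Otimes>\<^sub>M M)" by (simp add: split_beta')
    show "AE \<omega> in M. \<forall>s\<in>{0..\<tau>}. f\<^sub>2 \<tau> s (z s \<omega>) = ?h s \<omega>"
      using continuous_version_eq[OF z]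
    proof eventually_elim
      case (elim \<omega>)
      show ?case
      proof
        fix s assume s: "s \<in> {0..\<tau>}"
        then have "max 0 (min T s) = s" "s \<in> {0..T}" using \<tau> by auto
        then show "f\<^sub>2 \<tau> s (z s \<omega>) = ?h s \<omega>" using elim by simp
      qed
    qed
  qed
  have "volterra_rep z0 z (\<lambda>\<tau> \<omega>. f\<^sub>0 \<tau> (z \<tau> \<omega>)) (\<lambda>\<tau> s \<omega>. f\<^sub>1 \<tau> s (z s \<omega>)) (\<lambda>\<tau> s \<omega>. f\<^sub>2 \<tau> s (z s \<omega>)) I"
    unfolding volterra_rep_def using solution_initial_measurable[OF z] I h by blast
  then show ?thesis by (rule exI[of _ I])
qed

text \<open>The indicator of the same \<open>F 0\<close>-event on both sides replaces conditioning
  on the initial value. The tail clause is Markov's inequality for the supremum, kept as a product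
  so that m = 0 needs no exception.\<close>

definition moment_constant :: "nat \<Rightarrow> real \<Rightarrow> bool" where
  "moment_constant N C \<longleftrightarrow> 0 \<le> C \<and> (\<forall>z0 z A. solution z0 z \<longrightarrow> A \<in> sets (F 0) \<longrightarrow>
    (\<forall>t\<in>{0..T}. (\<integral>\<^sup>+\<omega>. indicator A \<omega> * ennreal (norm (z t \<omega>)) ^ (2 * N) \<partial>M) \<le>
       ennreal C * (\<integral>\<^sup>+\<omega>. indicator A \<omega> * ennreal (1 + norm (z0 \<omega>)) ^ (2 * N) \<partial>M)) \<and>
    (1 < \<alpha> * real (2 * N) \<longrightarrow> (\<forall>m\<ge>0. ennreal m * emeasure M (A - stop_event A z z T m T) \<le>
       (\<integral>\<^sup>+\<omega>. indicator A \<omega> * ennreal (1 + norm (z0 \<omega>)) \<partial>M) + ennreal C +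
       ennreal C * (\<integral>\<^sup>+\<omega>. indicator A \<omega> * ennreal (1 + norm (z0 \<omega>)) ^ (2 * N) \<partial>M))))"

lemma moment_constant_moment:
  assumes "moment_constant N C" "solution z0 z" "A \<in> sets (F 0)" "t \<in> {0..T}"
  shows "(\<integral>\<^sup>+\<omega>. indicator A \<omega> * ennreal (norm (z t \<omega>)) ^ (2 * N) \<partial>M) \<le>
       ennreal C * (\<integral>\<^sup>+\<omega>. indicator A \<omega> * ennreal (1 + norm (z0 \<omega>)) ^ (2 * N) \<partial>M)"
  using assms(1)[unfolded moment_constant_def, THEN conjunct2, rule_format, OF assms(2,3), THEN conjunct1, rule_format, OF assms(4)] .

lemma moment_constant_tail:
  assumes "moment_constant N C" "solution z0 z" "A \<in> sets (F 0)" "1 < \<alpha> * real (2 * N)" "0 \<le> m"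
  shows "ennreal m * emeasure M (A - stop_event A z z T m T) \<le>
       (\<integral>\<^sup>+\<omega>. indicator A \<omega> * ennreal (1 + norm (z0 \<omega>)) \<partial>M) + ennreal C +
       ennreal C * (\<integral>\<^sup>+\<omega>. indicator A \<omega> * ennreal (1 + norm (z0 \<omega>)) ^ (2 * N) \<partial>M)"
  using assms(1)[unfolded moment_constant_def, THEN conjunct2, rule_format, OF assms(2,3), THEN conjunct2, rule_format, OF assms(4,5)] .

text \<open>Comparison with the zero process: linear growth is exactly domination by \<rho> = 1 +
  |z|. Stopping at level k gives bounds with a constant independent of k, and Fatou's lemma removes
  the stopping.\<close>

lemma solution_moment:
  assumes N: "N \<ge> 1"
  shows "\<exists>C. moment_constant N C"
proof -
  obtain L where L: "L > 0" and growth: "\<And>t s x. t \<in> {0..T} \<Longrightarrow> s \<in> {0..T} \<Longrightarrow>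
         norm (f\<^sub>0 s x) \<le> L * (1 + norm x) \<and> norm (f\<^sub>1 t s x) \<le> L * (1 + norm x) \<and> norm (f\<^sub>2 t s x) \<le> L * (1 + norm x)"
    using linear_growth by blast
  obtain C' where C': "volterra_moment_constant TYPE('d) 1 L N C'"
    using volterra_rep_moment[OF N less_imp_le[OF L] zero_le_one] by blast
  note main = C'[unfolded volterra_moment_constant_def, THEN conjunct2]
  define C where "C = enn2real C'"
  have C: "0 \<le> C" "C' = ennreal C" using C' by (auto simp: C_def volterra_moment_constant_def)
  {
    fix z0 z A assume z: "solution z0 z" and A: "A \<in> sets (F 0)"
    define \<rho> where "\<rho> s \<omega> = 1 + norm (continuous_version z s \<omega>)" for s \<omega>
    define B where "B k = stop_event A z z T (real k)" for k :: nat
    have AM[measurable]: "A \<in> sets M" using A sets_F[of 0] by auto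
    have [measurable]: "(\<lambda>(t, \<omega>). continuous_version z t \<omega>) \<in> borel_measurable (borel \<Otimes>\<^sub>M M)"
      by (rule continuous_version_measurable[OF z])
    have \<rho>m: "(\<lambda>(s, \<omega>). \<rho> s \<omega>) \<in> borel_measurable (borel \<Otimes>\<^sub>M M)" unfolding \<rho>_def by measurable
    have \<rho>t[measurable]: "\<rho> t \<in> borel_measurable M" for t using measurable_Pair2[OF \<rho>m, of t] by simp
    have sf: "stopping_family T (B k)" for k
      unfolding B_def by (intro stopping_family_stop_event A solution_adapted[OF z])
    have Bm[measurable]: "B k t \<in> sets M" if "t \<in> {0..T}" for k t
      using sf[of k] sets_F[of t] that by (auto simp: stopping_family_def)
    have BT[measurable]: "B k T \<in> sets M" for k using T by (intro Bm) auto
    have BA: "B k t \<subseteq> A" for k t by (auto simp: B_def stop_event_def)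
    obtain I where I: "volterra_rep z0 z (\<lambda>\<tau> \<omega>. f\<^sub>0 \<tau> (z \<tau> \<omega>)) (\<lambda>\<tau> s \<omega>. f\<^sub>1 \<tau> s (z s \<omega>)) (\<lambda>\<tau> s \<omega>. f\<^sub>2 \<tau> s (z s \<omega>)) I"
      using solution_rep[OF z] by blast
    have dom: "dominated_difference 1 L (1 + real k) (B k) \<rho> z (\<lambda>\<tau> \<omega>. f\<^sub>0 \<tau> (z \<tau> \<omega>)) (\<lambda>\<tau> s \<omega>. f\<^sub>1 \<tau> s (z s \<omega>)) (\<lambda>\<tau> s \<omega>. f\<^sub>2 \<tau> s (z s \<omega>))
       (\<lambda>_ _. 0) (\<lambda>_ _. 0) (\<lambda>_ _ _. 0) (\<lambda>_ _ _. 0)" for k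
      unfolding dominated_difference_def
    proof (intro conjI ballI sf \<rho>m)
      show "\<forall>s \<omega>. 0 \<le> \<rho> s \<omega>" by (simp add: \<rho>_def)
      fix t assume t: "t \<in> {0..T}"
      show "AE \<omega> in M. \<rho> t \<omega> \<le> 1 + norm (z t \<omega> - 0)"
        using continuous_version_eq[OF z] by eventually_elim (use t in \<open>simp add: \<rho>_def\<close>)
    next
      show "AE \<omega> in M. \<forall>s\<in>{0..T}. \<omega> \<in> B k s \<longrightarrow> \<rho> s \<omega> \<le> 1 + real k \<and> norm (f\<^sub>0 s (z s \<omega>) - 0) \<le> L * \<rho> s \<omega> \<and>
        (\<forall>\<tau>\<in>{s..T}. norm (f\<^sub>1 \<tau> s (z s \<omega>) - 0) \<le> L * \<rho> s \<omega> \<and> norm (f\<^sub>2 \<tau> s (z s \<omega>) - 0) \<le> L * \<rho> s \<omega>)"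
        using continuous_version_eq[OF z] solution_continuous[OF z]
      proof eventually_elim
        case (elim \<omega>)
        show ?case
        proof (intro ballI impI)
          fix s assume s: "s \<in> {0..T}" and \<omega>: "\<omega> \<in> B k s"
          have r: "\<rho> s \<omega> = 1 + norm (z s \<omega>)" using elim(1) s by (simp add: \<rho>_def)
          have "norm (z s \<omega>) \<le> real k"
            using stop_event_bound(1)[OF \<omega>[unfolded B_def] _ _ elim(2) elim(2)] s by simp
          moreover have "norm (f\<^sub>1 \<tau> s (z s \<omega>)) \<le> L * \<rho> s \<omega> \<and> norm (f\<^sub>2 \<tau> s (z s \<omega>)) \<le> L * \<rho> s \<omega>" if "\<tau> \<in> {s..T}" for \<tau>
            unfolding r using growth[of \<tau> s "z s \<omega>"] that s by auto
          moreover have "norm (f\<^sub>0 s (z s \<omega>)) \<le> L * \<rho> s \<omega>" unfolding r using growth[of s s "z s \<omega>"] s by auto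
          ultimately show "\<rho> s \<omega> \<le> 1 + real k \<and> norm (f\<^sub>0 s (z s \<omega>) - 0) \<le> L * \<rho> s \<omega> \<and>
            (\<forall>\<tau>\<in>{s..T}. norm (f\<^sub>1 \<tau> s (z s \<omega>) - 0) \<le> L * \<rho> s \<omega> \<and> norm (f\<^sub>2 \<tau> s (z s \<omega>) - 0) \<le> L * \<rho> s \<omega>)"
            by (simp add: r)
        qed
      qed
    qed
    let ?E = "\<integral>\<^sup>+\<omega>. indicator A \<omega> * ennreal (1 + norm (z0 \<omega>)) ^ (2 * N) \<partial>M"
    let ?E1 = "\<integral>\<^sup>+\<omega>. indicator A \<omega> * ennreal (1 + norm (z0 \<omega>)) \<partial>M"
    have leE: "(\<integral>\<^sup>+\<omega>. (ennreal (1 + norm (z0 \<omega> - 0)) * indicator (B k 0) \<omega>) ^ (2 * N) \<partial>M) \<le> ?E" for k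
      using BA[of k 0] N by (intro nn_integral_mono) (auto simp: indicator_def power_0_left)
    have leE1: "(\<integral>\<^sup>+\<omega>. ennreal (1 + norm (z0 \<omega> - 0)) * indicator (B k 0) \<omega> \<partial>M) \<le> ?E1" for k
      using BA[of k 0] by (intro nn_integral_mono) (auto simp: indicator_def)
    note m = main[rule_format, OF I volterra_rep_zero dom]
    have mom: "(\<integral>\<^sup>+\<omega>. (ennreal (\<rho> t \<omega>) * indicator (B k t) \<omega>) ^ (2 * N) \<partial>M) \<le> ennreal C * ?E" if "t \<in> {0..T}" for t k
      using m[of k, THEN conjunct1] that unfolding C(2) by (blast intro: order.trans mult_left_mono leE zero_le)
    have ev: "AE \<omega> in M. \<omega> \<in> A \<longrightarrow> (\<forall>t. \<forall>\<^sub>F k in sequentially. \<omega> \<in> B k t)"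
      using solution_continuous[OF z]
    proof eventually_elim
      case (elim \<omega>)
      show ?case
        unfolding B_def eventually_sequentially using stop_event_exhausts[where y=z and z=z and \<omega>=\<omega> and T=T and A=A, OF _ elim elim] by blast
    qed
    have P1: "(\<integral>\<^sup>+\<omega>. indicator A \<omega> * ennreal (norm (z t \<omega>)) ^ (2 * N) \<partial>M) \<le> ennreal C * ?E" if t: "t \<in> {0..T}" for t
    proof -
      have "AE \<omega> in M. indicator A \<omega> * ennreal (norm (z t \<omega>)) ^ (2 * N) \<le> liminf (\<lambda>k. (ennreal (\<rho> t \<omega>) * indicator (B k t) \<omega>) ^ (2 * N))"
        using ev continuous_version_eq[OF z]
      proof eventually_elim
        case (elim \<omega>)
        show ?case
        proof (cases "\<omega> \<in> A")
          case True
          then have "\<forall>\<^sub>F k in sequentially. \<omega> \<in> B k t" using elim by blast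
          then have "\<forall>\<^sub>F k in sequentially. ennreal (norm (z t \<omega>)) ^ (2 * N) \<le> (ennreal (\<rho> t \<omega>) * indicator (B k t) \<omega>) ^ (2 * N)"
            by eventually_elim (use elim t in \<open>auto simp: \<rho>_def intro!: power_mono ennreal_leI\<close>)
          then have "ennreal (norm (z t \<omega>)) ^ (2 * N) \<le> liminf (\<lambda>k. (ennreal (\<rho> t \<omega>) * indicator (B k t) \<omega>) ^ (2 * N))"
            by (rule Liminf_bounded)
          then show ?thesis using True by simp
        qed simp
      qed
      then have "(\<integral>\<^sup>+\<omega>. indicator A \<omega> * ennreal (norm (z t \<omega>)) ^ (2 * N) \<partial>M) \<le>
        (\<integral>\<^sup>+\<omega>. liminf (\<lambda>k. (ennreal (\<rho> t \<omega>) * indicator (B k t) \<omega>) ^ (2 * N)) \<partial>M)"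
        by (rule nn_integral_mono_AE)
      also have "\<dots> \<le> liminf (\<lambda>k. \<integral>\<^sup>+\<omega>. (ennreal (\<rho> t \<omega>) * indicator (B k t) \<omega>) ^ (2 * N) \<partial>M)"
      proof (rule nn_integral_liminf)
        have [measurable]: "B k t \<in> sets M" for k by (rule Bm[OF t])
        show "(\<lambda>\<omega>. (ennreal (\<rho> t \<omega>) * indicator (B k t) \<omega>) ^ (2 * N)) \<in> borel_measurable M" for k
          by measurable
      qed
      also have "\<dots> \<le> liminf (\<lambda>k. ennreal C * ?E)"
        by (intro Liminf_mono always_eventually allI mom t)
      also have "\<dots> = ennreal C * ?E" by (simp add: Liminf_const)
      finally show ?thesis .
    qed
    have P2: "ennreal m * emeasure M (A - stop_event A z z T m T) \<le> ?E1 + ennreal C + ennreal C * ?E"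
      if big: "1 < \<alpha> * real (2 * N)" and m0: "0 \<le> m" for m
    proof -
      let ?S = "\<lambda>\<omega>. SUP q\<in>\<rat> \<inter> {0..T}. ennreal (\<rho> q \<omega>)"
      have Sm: "?S \<in> borel_measurable M"
        using countable_rat by (intro borel_measurable_SUP) (auto intro: countable_subset)
      have "stopping_family T (stop_event A z z T m)"
        by (intro stopping_family_stop_event A solution_adapted[OF z])
      then have [measurable]: "stop_event A z z T m T \<in> sets M"
        using sets_F[of T] T by (auto simp: stopping_family_def)
      have k: "(\<integral>\<^sup>+\<omega>. indicator (B k T) \<omega> * ?S \<omega> \<partial>M) \<le> ?E1 + ennreal C + ennreal C * ?E" for k
        using m[of k, THEN conjunct2, rule_format, OF big] unfolding C(2)
        by (rule order.trans) (intro add_mono mult_left_mono leE leE1 order_refl zero_le)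
      have "ennreal m * emeasure M (A - stop_event A z z T m T) = (\<integral>\<^sup>+\<omega>. ennreal m * indicator (A - stop_event A z z T m T) \<omega> \<partial>M)"
        by (subst nn_integral_cmult_indicator) auto
      also have "\<dots> \<le> (\<integral>\<^sup>+\<omega>. liminf (\<lambda>k. indicator (B k T) \<omega> * ?S \<omega>) \<partial>M)"
      proof (rule nn_integral_mono_AE)
        show "AE \<omega> in M. ennreal m * indicator (A - stop_event A z z T m T) \<omega> \<le> liminf (\<lambda>k. indicator (B k T) \<omega> * ?S \<omega>)"
          using ev continuous_version_eq[OF z]
        proof eventually_elim
          case (elim \<omega>)
          show ?case
          proof (cases "\<omega> \<in> A - stop_event A z z T m T")
            case True
            \<comment> \<open>Outside the stopping event the path exceeds m at some rational time,
              hence m is at most the supremum of \<rho>: this is Markov's inequality.\<close>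
            then obtain q where q: "q \<in> \<rat> \<inter> {0..T}" "m < norm (z q \<omega>)" by (auto simp: stop_event_def not_le)
            have "m \<le> \<rho> q \<omega>" using q elim(2) by (auto simp: \<rho>_def)
            then have "ennreal m \<le> ennreal (\<rho> q \<omega>)" by (rule ennreal_leI)
            also have "\<dots> \<le> ?S \<omega>" using q(1) by (rule SUP_upper)
            finally have mS: "ennreal m \<le> ?S \<omega>" .
            have "\<forall>\<^sub>F k in sequentially. \<omega> \<in> B k T" using elim True by blast
            then have "\<forall>\<^sub>F k in sequentially. ennreal m \<le> indicator (B k T) \<omega> * ?S \<omega>"
              by eventually_elim (use mS in simp)
            then have "ennreal m \<le> liminf (\<lambda>k. indicator (B k T) \<omega> * ?S \<omega>)" by (rule Liminf_bounded)
            then show ?thesis using True by simp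
          qed simp
        qed
      qed
      also have "\<dots> \<le> liminf (\<lambda>k. \<integral>\<^sup>+\<omega>. indicator (B k T) \<omega> * ?S \<omega> \<partial>M)"
        by (intro nn_integral_liminf borel_measurable_times_ennreal Sm borel_measurable_indicator BT)
      also have "\<dots> \<le> liminf (\<lambda>k. ?E1 + ennreal C + ennreal C * ?E)"
        by (intro Liminf_mono always_eventually allI k)
      also have "\<dots> = ?E1 + ennreal C + ennreal C * ?E" by (simp add: Liminf_const)
      finally show ?thesis .
    qed
    note P1 P2 }
  then show ?thesis using C(1) unfolding moment_constant_def by (intro exI[of _ C] conjI allI impI ballI) blast+
qed

text \<open>While both paths remain in the ball of radius m, the coefficients are Lipschitz with one
  constant, so \<rho> = |y - z| satisfies the domination with \<kappa> = 0 and no inhomogeneous term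
  appears. The constant depends on m, but on neither solution.\<close>

lemma solution_difference:
  assumes m: "(m::nat) \<ge> 1"
  shows "\<exists>C\<ge>0. \<forall>y0 y z0 z. solution y0 y \<longrightarrow> solution z0 z \<longrightarrow>
    (\<forall>t\<in>{0..T}. (\<integral>\<^sup>+\<omega>. indicator (stop_event (space M) y z T (real m) t) \<omega> * ennreal (norm (y t \<omega> - z t \<omega>)) ^ 2 \<partial>M) \<le>
       ennreal C * (\<integral>\<^sup>+\<omega>. ennreal (norm (y0 \<omega> - z0 \<omega>)) ^ 2 \<partial>M))"
proof -
  obtain K where K: "K > 0" and lip: "\<And>t s x\<^sub>1 x\<^sub>2. t \<in> {0..T} \<Longrightarrow> s \<in> {0..T} \<Longrightarrow> norm x\<^sub>1 \<le> real m \<Longrightarrow> norm x\<^sub>2 \<le> real m \<Longrightarrow>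
         norm (f\<^sub>0 s x\<^sub>1 - f\<^sub>0 s x\<^sub>2) \<le> K * norm (x\<^sub>1 - x\<^sub>2) \<and>
         norm (f\<^sub>1 t s x\<^sub>1 - f\<^sub>1 t s x\<^sub>2) \<le> K * norm (x\<^sub>1 - x\<^sub>2) \<and>
         norm (f\<^sub>2 t s x\<^sub>1 - f\<^sub>2 t s x\<^sub>2) \<le> K * norm (x\<^sub>1 - x\<^sub>2)"
    using local_lipschitz m by (metis max.bounded_iff)
  obtain C' where C': "volterra_moment_constant TYPE('d) 0 K 1 C'"
    using volterra_rep_moment[OF order_refl less_imp_le[OF K] order_refl] by blast
  note main = C'[unfolded volterra_moment_constant_def, THEN conjunct2]
  define C where "C = enn2real C'"
  have C: "0 \<le> C" "C' = ennreal C" using C' by (auto simp: C_def volterra_moment_constant_def)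
  {
    fix y0 y z0 z t assume y: "solution y0 y" and z: "solution z0 z" and t: "t \<in> {0..T}"
    define \<rho> where "\<rho> s \<omega> = norm (continuous_version y s \<omega> - continuous_version z s \<omega>)" for s \<omega>
    define B where "B = stop_event (space M) y z T (real m)"
    have [measurable]: "(\<lambda>(t, \<omega>). continuous_version y t \<omega>) \<in> borel_measurable (borel \<Otimes>\<^sub>M M)"
      "(\<lambda>(t, \<omega>). continuous_version z t \<omega>) \<in> borel_measurable (borel \<Otimes>\<^sub>M M)"
      by (rule continuous_version_measurable[OF y] continuous_version_measurable[OF z])+
    have \<rho>m: "(\<lambda>(s, \<omega>). \<rho> s \<omega>) \<in> borel_measurable (borel \<Otimes>\<^sub>M M)" unfolding \<rho>_def by measurable
    have sf: "stopping_family T B"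
      unfolding B_def
      by (intro stopping_family_stop_event solution_adapted[OF y] solution_adapted[OF z])
         (use sets.top[of "F 0"] space_F[of 0] in auto)
    obtain I where I: "volterra_rep y0 y (\<lambda>\<tau> \<omega>. f\<^sub>0 \<tau> (y \<tau> \<omega>)) (\<lambda>\<tau> s \<omega>. f\<^sub>1 \<tau> s (y s \<omega>)) (\<lambda>\<tau> s \<omega>. f\<^sub>2 \<tau> s (y s \<omega>)) I"
      using solution_rep[OF y] by blast
    obtain I' where I': "volterra_rep z0 z (\<lambda>\<tau> \<omega>. f\<^sub>0 \<tau> (z \<tau> \<omega>)) (\<lambda>\<tau> s \<omega>. f\<^sub>1 \<tau> s (z s \<omega>)) (\<lambda>\<tau> s \<omega>. f\<^sub>2 \<tau> s (z s \<omega>)) I'"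
      using solution_rep[OF z] by blast
    have dom: "dominated_difference 0 K (2 * real m) B \<rho> y (\<lambda>\<tau> \<omega>. f\<^sub>0 \<tau> (y \<tau> \<omega>)) (\<lambda>\<tau> s \<omega>. f\<^sub>1 \<tau> s (y s \<omega>)) (\<lambda>\<tau> s \<omega>. f\<^sub>2 \<tau> s (y s \<omega>))
       z (\<lambda>\<tau> \<omega>. f\<^sub>0 \<tau> (z \<tau> \<omega>)) (\<lambda>\<tau> s \<omega>. f\<^sub>1 \<tau> s (z s \<omega>)) (\<lambda>\<tau> s \<omega>. f\<^sub>2 \<tau> s (z s \<omega>))"
      unfolding dominated_difference_def
    proof (intro conjI ballI sf \<rho>m)
      show "\<forall>s \<omega>. 0 \<le> \<rho> s \<omega>" by (simp add: \<rho>_def)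
      fix t assume t: "t \<in> {0..T}"
      show "AE \<omega> in M. \<rho> t \<omega> \<le> 0 + norm (y t \<omega> - z t \<omega>)"
        using continuous_version_eq[OF y] continuous_version_eq[OF z] by eventually_elim (use t in \<open>simp add: \<rho>_def\<close>)
    next
      show "AE \<omega> in M. \<forall>s\<in>{0..T}. \<omega> \<in> B s \<longrightarrow> \<rho> s \<omega> \<le> 2 * real m \<and> norm (f\<^sub>0 s (y s \<omega>) - f\<^sub>0 s (z s \<omega>)) \<le> K * \<rho> s \<omega> \<and>
        (\<forall>\<tau>\<in>{s..T}. norm (f\<^sub>1 \<tau> s (y s \<omega>) - f\<^sub>1 \<tau> s (z s \<omega>)) \<le> K * \<rho> s \<omega> \<and> norm (f\<^sub>2 \<tau> s (y s \<omega>) - f\<^sub>2 \<tau> s (z s \<omega>)) \<le> K * \<rho> s \<omega>)"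
        using continuous_version_eq[OF y] continuous_version_eq[OF z] solution_continuous[OF y] solution_continuous[OF z]
      proof eventually_elim
        case (elim \<omega>)
        show ?case
        proof (intro ballI impI)
          fix s assume s: "s \<in> {0..T}" and \<omega>: "\<omega> \<in> B s"
          have r: "\<rho> s \<omega> = norm (y s \<omega> - z s \<omega>)" using elim(1,2) s by (simp add: \<rho>_def)
          have b: "norm (y s \<omega>) \<le> real m" "norm (z s \<omega>) \<le> real m"
            using stop_event_bound[OF \<omega>[unfolded B_def] _ _ elim(3) elim(4)] s by simp_all
          then have "\<rho> s \<omega> \<le> 2 * real m" unfolding r using norm_triangle_ineq4[of "y s \<omega>" "z s \<omega>"] by linarith
          moreover have "norm (f\<^sub>1 \<tau> s (y s \<omega>) - f\<^sub>1 \<tau> s (z s \<omega>)) \<le> K * \<rho> s \<omega> \<and> norm (f\<^sub>2 \<tau> s (y s \<omega>) - f\<^sub>2 \<tau> s (z s \<omega>)) \<le> K * \<rho> s \<omega>"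
            if "\<tau> \<in> {s..T}" for \<tau>
            unfolding r using lip[of \<tau> s, OF _ _ b] that s by auto
          moreover have "norm (f\<^sub>0 s (y s \<omega>) - f\<^sub>0 s (z s \<omega>)) \<le> K * \<rho> s \<omega>" unfolding r using lip[of s s, OF _ _ b] s by auto
          ultimately show "\<rho> s \<omega> \<le> 2 * real m \<and> norm (f\<^sub>0 s (y s \<omega>) - f\<^sub>0 s (z s \<omega>)) \<le> K * \<rho> s \<omega> \<and>
            (\<forall>\<tau>\<in>{s..T}. norm (f\<^sub>1 \<tau> s (y s \<omega>) - f\<^sub>1 \<tau> s (z s \<omega>)) \<le> K * \<rho> s \<omega> \<and> norm (f\<^sub>2 \<tau> s (y s \<omega>) - f\<^sub>2 \<tau> s (z s \<omega>)) \<le> K * \<rho> s \<omega>)"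
            by blast
        qed
      qed
    qed
    have "(\<integral>\<^sup>+\<omega>. indicator (B t) \<omega> * ennreal (norm (y t \<omega> - z t \<omega>)) ^ 2 \<partial>M) = (\<integral>\<^sup>+\<omega>. (ennreal (\<rho> t \<omega>) * indicator (B t) \<omega>) ^ (2 * 1) \<partial>M)"
    proof (rule nn_integral_cong_AE)
      show "AE \<omega> in M. indicator (B t) \<omega> * ennreal (norm (y t \<omega> - z t \<omega>)) ^ 2 = (ennreal (\<rho> t \<omega>) * indicator (B t) \<omega>) ^ (2 * 1)"
        using continuous_version_eq[OF y] continuous_version_eq[OF z]
        by eventually_elim (use t in \<open>auto simp: \<rho>_def indicator_def\<close>)
    qed
    also have "\<dots> \<le> ennreal C * (\<integral>\<^sup>+\<omega>. (ennreal (0 + norm (y0 \<omega> - z0 \<omega>)) * indicator (B 0) \<omega>) ^ (2 * 1) \<partial>M)"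
      using main[rule_format, OF I I' dom] t unfolding C(2) by blast
    also have "\<dots> \<le> ennreal C * (\<integral>\<^sup>+\<omega>. ennreal (norm (y0 \<omega> - z0 \<omega>)) ^ 2 \<partial>M)"
      by (intro mult_left_mono nn_integral_mono) (auto simp: indicator_def)
    finally have "(\<integral>\<^sup>+\<omega>. indicator (B t) \<omega> * ennreal (norm (y t \<omega> - z t \<omega>)) ^ 2 \<partial>M) \<le>
       ennreal C * (\<integral>\<^sup>+\<omega>. ennreal (norm (y0 \<omega> - z0 \<omega>)) ^ 2 \<partial>M)" .
    note this[unfolded B_def] }
  then show ?thesis using C(1) by (intro exI[of _ C] conjI allI impI ballI) blast+
qed

text \<open>The i's stand for indicators: off the good event \<open>A\<close>, on the exit event
  \<open>U\<close>, on \<open>A\<close>, and on the event that neither path leaves the ball. On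
  \<open>U\<close> the square is traded for a small probability weighted by R and a fourth moment
  weighted by 1/R; 16 comes from the fourth power of a sum.\<close>

lemma second_moment_split:
  fixes x x' :: "real ^ 'd"
  assumes R: "0 < R" and "i\<^sub>1 = 1 \<or> i\<^sub>2 = 1 \<and> i\<^sub>3 = 1 \<or> i\<^sub>4 = (1::ennreal)"
  shows "ennreal (norm (x - x')) ^ 2 \<le> 4 * (i\<^sub>1 * ennreal (norm x) ^ 2 + i\<^sub>1 * ennreal (norm x') ^ 2) + ennreal R * i\<^sub>2 +
    ennreal (16 / R) * (i\<^sub>3 * ennreal (norm x) ^ 4 + i\<^sub>3 * ennreal (norm x') ^ 4) + i\<^sub>4 * ennreal (norm (x - x')) ^ 2"
proof -
  let ?e = "ennreal (norm (x - x'))" and ?a = "ennreal (norm x)" and ?b = "ennreal (norm x')"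
  have e: "?e \<le> ?a + ?b"
    using norm_triangle_ineq4[of x x'] by (simp add: ennreal_plus[symmetric] ennreal_leI del: ennreal_plus)
  have p: "?e ^ q \<le> 2 ^ q * (?a ^ q + ?b ^ q)" for q
    using power_mono[OF e, of q] add_power_le_ennreal[of ?a ?b q] by simp
  consider "i\<^sub>1 = 1" | "i\<^sub>2 = 1" "i\<^sub>3 = 1" | "i\<^sub>4 = 1" using assms(2) by blast
  then show ?thesis
  proof cases
    case 1
    then have "?e ^ 2 \<le> 4 * (i\<^sub>1 * ?a ^ 2 + i\<^sub>1 * ?b ^ 2)" using p[of 2] by simp
    then show ?thesis by (intro add_increasing2 zero_le)
  next
    case 2
    have "?e ^ 2 \<le> ennreal R + ennreal (1 / R) * ?e ^ 4"
    proof -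
      define v where "v = (norm (x - x'))\<^sup>2"
      have v: "0 \<le> v" "(norm (x - x')) ^ 4 = v\<^sup>2" by (simp_all add: v_def power_mult[symmetric])
      \<comment> \<open>Either v is at most R, or v / R exceeds 1 and multiplying by it only
        increases v. It stands in for the Cauchy-Schwarz inequality.\<close>
      have "v \<le> R + 1 / R * v\<^sup>2"
      proof (cases "v \<le> R")
        case True
        then show ?thesis using R by (simp add: add_increasing2)
      next
        case False
        then have "R * v \<le> v * v" using v by (intro mult_right_mono) auto
        then have "v \<le> 1 / R * v\<^sup>2" using R by (simp add: field_simps power2_eq_square)
        then show ?thesis using R by simp
      qed
      then have "ennreal v \<le> ennreal (R + 1 / R * v\<^sup>2)" by (rule ennreal_leI)
      also have "\<dots> = ennreal R + ennreal (1 / R) * ennreal (v\<^sup>2)"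
        using R by (subst ennreal_plus, simp, simp, subst ennreal_mult) auto
      also have "ennreal (v\<^sup>2) = ?e ^ 4" by (simp add: ennreal_power v(2))
      finally show ?thesis by (simp add: ennreal_power v_def)
    qed
    also have "\<dots> \<le> ennreal R + ennreal (1 / R) * (16 * (?a ^ 4 + ?b ^ 4))"
      using p[of 4] by (intro add_left_mono mult_left_mono) auto
    also have "\<dots> = ennreal R * i\<^sub>2 + ennreal (16 / R) * (i\<^sub>3 * ?a ^ 4 + i\<^sub>3 * ?b ^ 4)"
    proof -
      have "ennreal (16 / R) = ennreal (1 / R) * 16" using R ennreal_mult[of "1 / R" 16] by simp
      then show ?thesis using 2 by (simp add: mult.assoc)
    qed
    also have "\<dots> \<le> 4 * (i\<^sub>1 * ?a ^ 2 + i\<^sub>1 * ?b ^ 2) + ennreal R * i\<^sub>2 + ennreal (16 / R) * (i\<^sub>3 * ?a ^ 4 + i\<^sub>3 * ?b ^ 4) + i\<^sub>4 * ?e ^ 2"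
      by (rule add_increasing2[OF zero_le], rule add_right_mono, rule add_increasing[OF zero_le order_refl])
    finally show ?thesis .
  next
    case 3
    then show ?thesis by (simp add: add_increasing)
  qed
qed

text \<open>The parameters are chosen in the order k, R, m, \<zeta>. The Lipschitz constant may grow
  without control in m, but it multiplies only the initial distance, which is made small last. Four
  errors of at most \<epsilon>/8 add up to \<epsilon>/2, which leaves room for strictness.\<close>

theorem continuous_dependence:
  fixes \<epsilon> :: real
  assumes y: "solution y0 y" and y0: "(\<integral>\<^sup>+\<omega>. ennreal (norm (y0 \<omega>)) ^ 2 \<partial>M) < \<top>" and \<epsilon>: "0 < \<epsilon>"
  shows "\<exists>\<zeta>>0. \<forall>z0 z. solution z0 z \<longrightarrow> (\<integral>\<^sup>+\<omega>. ennreal (norm (y0 \<omega> - z0 \<omega>)) ^ 2 \<partial>M) < ennreal \<zeta> \<longrightarrow>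
    (\<forall>t\<in>{0..T}. (\<integral>\<^sup>+\<omega>. ennreal (norm (y t \<omega> - z t \<omega>)) ^ 2 \<partial>M) < ennreal \<epsilon>)"
proof -
  note y0m[measurable] = solution_initial_measurable[OF y]
  \<comment> \<open>The moment order 2 * N_0 then lies above 1 / \<alpha>, as the tail bound
    requires.\<close>
  obtain N\<^sub>0 :: nat where "1 / \<alpha> < real N\<^sub>0" using reals_Archimedean2 by blast
  then have N0: "1 < \<alpha> * real N\<^sub>0" using \<alpha> by (simp add: field_simps)
  then have N01: "N\<^sub>0 \<ge> 1" by (cases N\<^sub>0) auto
  have N02: "1 < \<alpha> * real (2 * N\<^sub>0)" using N0 \<alpha> by simp
  obtain c\<^sub>1 where mc1: "moment_constant 1 c\<^sub>1" using solution_moment[of 1] by auto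
  obtain c\<^sub>2 where mc2: "moment_constant 2 c\<^sub>2" using solution_moment[of 2] by auto
  obtain c\<^sub>3 where mc3: "moment_constant N\<^sub>0 c\<^sub>3" using solution_moment[OF N01] by auto
  have c1: "0 \<le> c\<^sub>1" and c2: "0 \<le> c\<^sub>2" and c3: "0 \<le> c\<^sub>3"
    using mc1 mc2 mc3 unfolding moment_constant_def by blast+
  note mom1 = moment_constant_moment[OF mc1] and mom2 = moment_constant_moment[OF mc2]
  note tail = moment_constant_tail[OF mc3 _ _ N02]
  \<comment> \<open>The tail of the second moment of the fixed initial value; it vanishes as k grows
    by dominated convergence, and this is the only smallness not due to the distance of the initial
    values on the complement of \<open>A\<close>.\<close>
  define tl where "tl k = (\<integral>\<^sup>+\<omega>. indicator {\<omega>\<in>space M. real k < norm (y0 \<omega>)} \<omega> * ennreal (1 + norm (y0 \<omega>)) ^ 2 \<partial>M)" for k :: nat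
  have "tl \<longlonglongrightarrow> (\<integral>\<^sup>+\<omega>. 0 \<partial>M)"
    unfolding tl_def
  proof (rule nn_integral_dominated_convergence)
    have "(\<integral>\<^sup>+\<omega>. ennreal (1 + norm (y0 \<omega>)) ^ 2 \<partial>M) \<le> (\<integral>\<^sup>+\<omega>. 4 * (1 + ennreal (norm (y0 \<omega>)) ^ 2) \<partial>M)"
    proof (rule nn_integral_mono)
      fix \<omega>
      show "ennreal (1 + norm (y0 \<omega>)) ^ 2 \<le> 4 * (1 + ennreal (norm (y0 \<omega>)) ^ 2)"
        using add_power_le_ennreal[of 1 "ennreal (norm (y0 \<omega>))" 2] by simp
    qed
    also have "\<dots> = 4 * (1 + (\<integral>\<^sup>+\<omega>. ennreal (norm (y0 \<omega>)) ^ 2 \<partial>M))"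
      by (simp add: nn_integral_cmult nn_integral_add emeasure_space_1)
    also have "\<dots> < \<infinity>" using y0 by (simp add: ennreal_mult_less_top)
    finally show "(\<integral>\<^sup>+\<omega>. ennreal (1 + norm (y0 \<omega>)) ^ 2 \<partial>M) < \<infinity>" .
    show "AE \<omega> in M. (\<lambda>k. indicator {\<omega>\<in>space M. real k < norm (y0 \<omega>)} \<omega> * ennreal (1 + norm (y0 \<omega>)) ^ 2) \<longlonglongrightarrow> 0"
    proof (rule AE_I2)
      fix \<omega>
      obtain K :: nat where "norm (y0 \<omega>) \<le> real K" using real_arch_simple by blast
      then have "\<forall>\<^sub>F k in sequentially. indicator {\<omega>\<in>space M. real k < norm (y0 \<omega>)} \<omega> * ennreal (1 + norm (y0 \<omega>)) ^ 2 = 0"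
        by (auto simp: eventually_sequentially indicator_def intro!: exI[of _ K])
      then show "(\<lambda>k. indicator {\<omega>\<in>space M. real k < norm (y0 \<omega>)} \<omega> * ennreal (1 + norm (y0 \<omega>)) ^ 2) \<longlonglongrightarrow> 0"
        by (rule tendsto_eventually)
    qed
  qed (auto simp: indicator_def)
  \<comment> \<open>The factor 20 is 4 * 5: 4 from the square of a difference, 5 because the part of
    \<open>z\<close> off \<open>A\<close> is at most four times that of \<open>y\<close> up to the
    initial distance.\<close>
  moreover define \<eta> where "\<eta> = \<epsilon> / (8 * (20 * c\<^sub>1 + 1))"
  moreover have \<eta>0: "0 < \<eta>" using \<epsilon> c1 by (simp add: \<eta>_def)
  ultimately have "\<forall>\<^sub>F k in sequentially. tl k < ennreal \<eta>"
    using order_tendstoD(2)[of tl 0 sequentially "ennreal \<eta>"] by simp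
  then obtain k where k: "tl k < ennreal \<eta>" by (auto simp: eventually_sequentially)
  \<comment> \<open>The right side of the tail bound on \<open>A\<close>, where 1 plus the norm of
    either initial value is at most 2 + k.\<close>
  define D where "D = (2 + real k) + c\<^sub>3 + c\<^sub>3 * (2 + real k) ^ (2 * N\<^sub>0)"
  have D0: "0 \<le> D" using c3 by (simp add: D_def)
  \<comment> \<open>Large enough that the fourth moments on \<open>A\<close>, weighted by 16 / R and
    counted for both solutions, contribute at most \<epsilon>/8.\<close>
  define R where "R = 8 * (32 * c\<^sub>2 * (2 + real k) ^ 4 + 1) / \<epsilon>"
  have R0: "0 < R" using c2 \<epsilon> by (auto simp: R_def intro!: divide_pos_pos add_nonneg_pos)
  \<comment> \<open>Each path leaves the ball with probability at most D / m on \<open>A\<close>, so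
    m makes R * (2 * D / m) at most \<epsilon>/8; the added 1 ensures that m is positive.\<close>
  obtain m :: nat where m: "16 * R * D / \<epsilon> + 1 \<le> real m" using real_arch_simple by blast
  have m0: "0 \<le> 16 * R * D / \<epsilon>" using R0 D0 \<epsilon> by simp
  have m1: "m \<ge> 1" using m m0 by linarith
  obtain c\<^sub>4 where c4: "0 \<le> c\<^sub>4" and diff: "\<forall>y0 y z0 z. solution y0 y \<longrightarrow> solution z0 z \<longrightarrow> (\<forall>t\<in>{0..T}.
    (\<integral>\<^sup>+\<omega>. indicator (stop_event (space M) y z T (real m) t) \<omega> * ennreal (norm (y t \<omega> - z t \<omega>)) ^ 2 \<partial>M) \<le>
       ennreal c\<^sub>4 * (\<integral>\<^sup>+\<omega>. ennreal (norm (y0 \<omega> - z0 \<omega>)) ^ 2 \<partial>M))"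
    using solution_difference[OF m1] by (elim exE conjE) (rule that)
  \<comment> \<open>Collects all coefficients of the initial distance: from the two terms off
    \<open>A\<close> and from the Lipschitz estimate.\<close>
  define c\<^sub>5 where "c\<^sub>5 = 4 * c\<^sub>1 * (5 * (1 + real k)\<^sup>2 + 4) + c\<^sub>4"
  have c5: "0 \<le> c\<^sub>5" using c1 c4 by (simp add: c\<^sub>5_def)
  define \<zeta> where "\<zeta> = \<epsilon> / (8 * (c\<^sub>5 + 1))"
  have "0 < \<zeta>" using \<epsilon> c5 by (simp add: \<zeta>_def)
  moreover have "(\<integral>\<^sup>+\<omega>. ennreal (norm (y t \<omega> - z t \<omega>)) ^ 2 \<partial>M) < ennreal \<epsilon>"
    if z: "solution z0 z" and close: "(\<integral>\<^sup>+\<omega>. ennreal (norm (y0 \<omega> - z0 \<omega>)) ^ 2 \<partial>M) < ennreal \<zeta>" and t: "t \<in> {0..T}" for z0 z t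
  proof -
    note z0m[measurable] = solution_initial_measurable[OF z]
    have ytm[measurable]: "y t \<in> borel_measurable M" and ztm[measurable]: "z t \<in> borel_measurable M"
      by (rule solution_measurable[OF y t] solution_measurable[OF z t])+
    let ?\<delta> = "\<integral>\<^sup>+\<omega>. ennreal (norm (y0 \<omega> - z0 \<omega>)) ^ 2 \<partial>M"
    \<comment> \<open>This event depends on \<open>z0\<close>, but every constant was fixed before:
      on it both initial values are bounded by 1 + k, whatever \<open>z0\<close> is.\<close>
    define A where "A = {\<omega>\<in>space M. norm (y0 \<omega>) \<le> real k \<and> norm (y0 \<omega> - z0 \<omega>) \<le> 1}"
    have A: "A \<in> sets (F 0)"
    proof -
      have [measurable]: "y0 \<in> borel_measurable (F 0)" "z0 \<in> borel_measurable (F 0)"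
        by (rule solution_initial[OF y] solution_initial[OF z])+
      have "{\<omega>\<in>space (F 0). norm (y0 \<omega>) \<le> real k \<and> norm (y0 \<omega> - z0 \<omega>) \<le> 1} \<in> sets (F 0)" by measurable
      then show ?thesis using space_F[of 0] by (simp add: A_def)
    qed
    have Ac: "space M - A \<in> sets (F 0)" using sets.compl_sets[OF A] space_F[of 0] by simp
    define S where "S t = stop_event (space M) y z T (real m) t" for t
    have AM[measurable]: "A \<in> sets M" using A sets_F[of 0] by auto
    have stm: "stop_event A' y' z' T (real m) T \<in> sets M"
      if "A' \<in> sets (F 0)" "solution y0' y'" "solution z0' z'" for A' y' z' y0' z0'
      using stopping_family_stop_event[where A=A' and y=y' and z=z' and T=T and m="real m"] that
        solution_adapted[OF that(2)] solution_adapted[OF that(3)] T sets_F[of T]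
      by (auto simp: stopping_family_def)
    have [measurable]: "S T \<in> sets M" unfolding S_def
      by (rule stm[OF _ y z]) (use sets.top[of "F 0"] space_F[of 0] in auto)
    have stAm[measurable]: "stop_event A y y T (real m) T \<in> sets M" "stop_event A z z T (real m) T \<in> sets M"
      by (rule stm[OF A y y] stm[OF A z z])+
    define U where "U = A - S T"
    have [measurable]: "U \<in> sets M" by (simp add: U_def)
    have on_A: "norm (y0 \<omega>) \<le> 1 + real k" "norm (z0 \<omega>) \<le> 1 + real k" if "\<omega> \<in> A" for \<omega>
    proof -
      have "norm (y0 \<omega>) \<le> real k" "norm (y0 \<omega> - z0 \<omega>) \<le> 1" using that by (auto simp: A_def)
      then show "norm (y0 \<omega>) \<le> 1 + real k" "norm (z0 \<omega>) \<le> 1 + real k"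
        using norm_triangle_sub[of "z0 \<omega>" "y0 \<omega>"] norm_minus_commute[of "z0 \<omega>" "y0 \<omega>"] by linarith+
    qed
    have A_mom: "(\<integral>\<^sup>+\<omega>. indicator A \<omega> * ennreal (1 + norm (x \<omega>)) ^ q \<partial>M) \<le> ennreal ((2 + real k) ^ q)"
      if x: "\<And>\<omega>. \<omega> \<in> A \<Longrightarrow> norm (x \<omega>) \<le> 1 + real k" for q and x :: "'a \<Rightarrow> real ^ 'd"
    proof -
      have "(\<integral>\<^sup>+\<omega>. indicator A \<omega> * ennreal (1 + norm (x \<omega>)) ^ q \<partial>M) \<le> (\<integral>\<^sup>+\<omega>. ennreal ((2 + real k) ^ q) \<partial>M)"
      proof (rule nn_integral_mono)
        fix \<omega>
        show "indicator A \<omega> * ennreal (1 + norm (x \<omega>)) ^ q \<le> ennreal ((2 + real k) ^ q)"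
        proof (cases "\<omega> \<in> A")
          case True
          have "(1 + norm (x \<omega>)) ^ q \<le> (2 + real k) ^ q" using x[OF True] by (intro power_mono) auto
          then have "ennreal ((1 + norm (x \<omega>)) ^ q) \<le> ennreal ((2 + real k) ^ q)" by (rule ennreal_leI)
          then show ?thesis using True by (simp add: ennreal_power del: ennreal_plus)
        qed simp
      qed
      then show ?thesis by (simp add: emeasure_space_1)
    qed
    have P: "emeasure M (A - stop_event A x x T (real m) T) \<le> ennreal (D / real m)"
      if x: "solution x0 x" and x0: "\<And>\<omega>. \<omega> \<in> A \<Longrightarrow> norm (x0 \<omega>) \<le> 1 + real k" for x0 x
    proof -
      have "ennreal (real m) * emeasure M (A - stop_event A x x T (real m) T) \<le>
        ennreal (2 + real k) + ennreal c\<^sub>3 + ennreal c\<^sub>3 * ennreal ((2 + real k) ^ (2 * N\<^sub>0))"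
        using A_mom[of x0 1, OF x0] A_mom[of x0 "2 * N\<^sub>0", OF x0]
        by (intro order.trans[OF tail[OF x A]] add_mono mult_left_mono) auto
      also have "\<dots> = ennreal D" using c3 by (simp add: D_def ennreal_mult)
      finally have "ennreal (1 / real m) * (ennreal (real m) * emeasure M (A - stop_event A x x T (real m) T)) \<le> ennreal (1 / real m) * ennreal D"
        by (rule mult_left_mono) simp
      moreover have "ennreal (1 / real m) * ennreal (real m) = 1"
        using m1 by (subst ennreal_mult[symmetric]) auto
      ultimately show ?thesis using D0 by (simp add: mult.assoc[symmetric] ennreal_mult[symmetric] del: ennreal_1)
    qed
    have U: "emeasure M U \<le> ennreal (2 * D / real m)"
    proof -
      \<comment> \<open>If neither path leaves the ball separately, both remain in it jointly; so
        the two exit events cover \<open>U\<close>.\<close>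
      have "U \<subseteq> (A - stop_event A y y T (real m) T) \<union> (A - stop_event A z z T (real m) T)"
        by (auto simp: U_def S_def stop_event_def A_def)
      then have "emeasure M U \<le> emeasure M ((A - stop_event A y y T (real m) T) \<union> (A - stop_event A z z T (real m) T))"
        by (rule emeasure_mono) measurable
      also have "\<dots> \<le> emeasure M (A - stop_event A y y T (real m) T) + emeasure M (A - stop_event A z z T (real m) T)"
        by (rule emeasure_subadditive) auto
      also have "\<dots> \<le> ennreal (D / real m) + ennreal (D / real m)"
        by (intro add_mono P[OF y] P[OF z] on_A)
      also have "\<dots> = ennreal (2 * D / real m)" using D0 by (simp add: ennreal_plus[symmetric] del: ennreal_plus)
      finally show ?thesis .
    qed
    let ?Y = "\<integral>\<^sup>+\<omega>. indicator (space M - A) \<omega> * ennreal (1 + norm (y0 \<omega>)) ^ 2 \<partial>M"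
    let ?Z = "\<integral>\<^sup>+\<omega>. indicator (space M - A) \<omega> * ennreal (1 + norm (z0 \<omega>)) ^ 2 \<partial>M"
    \<comment> \<open>Off \<open>A\<close> either |y_0| exceeds k, which is counted in
      \<open>tl k\<close>, or |y_0| is at most k and |y_0 - z_0| exceeds 1; then 1 + |y_0| is at
      most (1 + k) * |y_0 - z_0|.\<close>
    have Y: "?Y \<le> tl k + ennreal ((1 + real k)\<^sup>2) * ?\<delta>"
    proof -
      have "?Y \<le> (\<integral>\<^sup>+\<omega>. indicator {\<omega>\<in>space M. real k < norm (y0 \<omega>)} \<omega> * ennreal (1 + norm (y0 \<omega>)) ^ 2 +
         ennreal ((1 + real k)\<^sup>2) * ennreal (norm (y0 \<omega> - z0 \<omega>)) ^ 2 \<partial>M)"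
      proof (rule nn_integral_mono)
        fix \<omega> assume \<omega>: "\<omega> \<in> space M"
        show "indicator (space M - A) \<omega> * ennreal (1 + norm (y0 \<omega>)) ^ 2 \<le> indicator {\<omega>\<in>space M. real k < norm (y0 \<omega>)} \<omega> * ennreal (1 + norm (y0 \<omega>)) ^ 2 +
         ennreal ((1 + real k)\<^sup>2) * ennreal (norm (y0 \<omega> - z0 \<omega>)) ^ 2"
        proof (cases "\<omega> \<in> A \<or> real k < norm (y0 \<omega>)")
          case True
          then show ?thesis using \<omega> by (auto simp: indicator_def)
        next
          case False
          then have b: "norm (y0 \<omega>) \<le> real k" "1 \<le> norm (y0 \<omega> - z0 \<omega>)" using \<omega> by (auto simp: A_def)
          have "1 + norm (y0 \<omega>) \<le> (1 + real k) * norm (y0 \<omega> - z0 \<omega>)"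
            using b mult_mono[of "1 + norm (y0 \<omega>)" "1 + real k" 1 "norm (y0 \<omega> - z0 \<omega>)"] by simp
          then have "(1 + norm (y0 \<omega>))\<^sup>2 \<le> ((1 + real k) * norm (y0 \<omega> - z0 \<omega>))\<^sup>2" by (intro power_mono) auto
          then have "ennreal ((1 + norm (y0 \<omega>))\<^sup>2) \<le> ennreal ((1 + real k)\<^sup>2 * (norm (y0 \<omega> - z0 \<omega>))\<^sup>2)"
            by (intro ennreal_leI) (simp add: power_mult_distrib)
          then show ?thesis using False \<omega> by (simp add: ennreal_power ennreal_mult indicator_def del: ennreal_plus)
        qed
      qed
      also have "\<dots> = tl k + ennreal ((1 + real k)\<^sup>2) * ?\<delta>"
        unfolding tl_def by (subst nn_integral_add) (auto simp: nn_integral_cmult)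
      finally show ?thesis .
    qed
    have Z: "?Z \<le> 4 * (?Y + ?\<delta>)"
    proof -
      have "?Z \<le> (\<integral>\<^sup>+\<omega>. 4 * (indicator (space M - A) \<omega> * ennreal (1 + norm (y0 \<omega>)) ^ 2 + ennreal (norm (y0 \<omega> - z0 \<omega>)) ^ 2) \<partial>M)"
      proof (rule nn_integral_mono)
        fix \<omega>
        have "1 + norm (z0 \<omega>) \<le> (1 + norm (y0 \<omega>)) + norm (y0 \<omega> - z0 \<omega>)"
          using norm_triangle_sub[of "z0 \<omega>" "y0 \<omega>"] norm_minus_commute[of "z0 \<omega>" "y0 \<omega>"] by linarith
        then have "ennreal (1 + norm (z0 \<omega>)) \<le> ennreal ((1 + norm (y0 \<omega>)) + norm (y0 \<omega> - z0 \<omega>))" by (rule ennreal_leI)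
        also have "\<dots> = ennreal (1 + norm (y0 \<omega>)) + ennreal (norm (y0 \<omega> - z0 \<omega>))" by (rule ennreal_plus) auto
        finally have "ennreal (1 + norm (z0 \<omega>)) ^ 2 \<le> 4 * (ennreal (1 + norm (y0 \<omega>)) ^ 2 + ennreal (norm (y0 \<omega> - z0 \<omega>)) ^ 2)"
          using add_power_le_ennreal[of "ennreal (1 + norm (y0 \<omega>))" "ennreal (norm (y0 \<omega> - z0 \<omega>))" 2]
          by (simp del: ennreal_plus) (meson order.trans power_mono zero_le)
        then show "indicator (space M - A) \<omega> * ennreal (1 + norm (z0 \<omega>)) ^ 2 \<le>
          4 * (indicator (space M - A) \<omega> * ennreal (1 + norm (y0 \<omega>)) ^ 2 + ennreal (norm (y0 \<omega> - z0 \<omega>)) ^ 2)"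
          by (cases "\<omega> \<in> space M - A") (simp_all del: ennreal_plus)
      qed
      also have "\<dots> = 4 * (?Y + ?\<delta>)"
        by (subst nn_integral_cmult, measurable) (subst nn_integral_add, measurable)
      finally show ?thesis .
    qed
    have "(\<integral>\<^sup>+\<omega>. ennreal (norm (y t \<omega> - z t \<omega>)) ^ 2 \<partial>M) \<le>
      (\<integral>\<^sup>+\<omega>. 4 * (indicator (space M - A) \<omega> * ennreal (norm (y t \<omega>)) ^ 2 + indicator (space M - A) \<omega> * ennreal (norm (z t \<omega>)) ^ 2) +
        ennreal R * indicator U \<omega> +
        ennreal (16 / R) * (indicator A \<omega> * ennreal (norm (y t \<omega>)) ^ 4 + indicator A \<omega> * ennreal (norm (z t \<omega>)) ^ 4) +
        indicator (S T) \<omega> * ennreal (norm (y t \<omega> - z t \<omega>)) ^ 2 \<partial>M)"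
      by (intro nn_integral_mono second_moment_split R0) (auto simp: U_def indicator_def)
    also have "\<dots> = 4 * ((\<integral>\<^sup>+\<omega>. indicator (space M - A) \<omega> * ennreal (norm (y t \<omega>)) ^ 2 \<partial>M) +
         (\<integral>\<^sup>+\<omega>. indicator (space M - A) \<omega> * ennreal (norm (z t \<omega>)) ^ 2 \<partial>M)) +
        ennreal R * emeasure M U +
        ennreal (16 / R) * ((\<integral>\<^sup>+\<omega>. indicator A \<omega> * ennreal (norm (y t \<omega>)) ^ 4 \<partial>M) + (\<integral>\<^sup>+\<omega>. indicator A \<omega> * ennreal (norm (z t \<omega>)) ^ 4 \<partial>M)) +
        (\<integral>\<^sup>+\<omega>. indicator (S T) \<omega> * ennreal (norm (y t \<omega> - z t \<omega>)) ^ 2 \<partial>M)"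
      by (simp add: nn_integral_add nn_integral_cmult)
    also have "\<dots> \<le> 4 * (ennreal c\<^sub>1 * ?Y + ennreal c\<^sub>1 * ?Z) + ennreal R * ennreal (2 * D / real m) +
        ennreal (16 / R) * (ennreal c\<^sub>2 * ennreal ((2 + real k) ^ 4) + ennreal c\<^sub>2 * ennreal ((2 + real k) ^ 4)) + ennreal c\<^sub>4 * ?\<delta>"
    proof (intro add_mono mult_left_mono U)
      show "(\<integral>\<^sup>+\<omega>. indicator (space M - A) \<omega> * ennreal (norm (y t \<omega>)) ^ 2 \<partial>M) \<le> ennreal c\<^sub>1 * ?Y"
        using mom1[OF y Ac t] by simp
      show "(\<integral>\<^sup>+\<omega>. indicator (space M - A) \<omega> * ennreal (norm (z t \<omega>)) ^ 2 \<partial>M) \<le> ennreal c\<^sub>1 * ?Z"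
        using mom1[OF z Ac t] by simp
      show "(\<integral>\<^sup>+\<omega>. indicator A \<omega> * ennreal (norm (y t \<omega>)) ^ 4 \<partial>M) \<le> ennreal c\<^sub>2 * ennreal ((2 + real k) ^ 4)"
        using order.trans[OF mom2[OF y A t] mult_left_mono[OF A_mom[of y0 "2 * 2", OF on_A(1)]]] by simp
      show "(\<integral>\<^sup>+\<omega>. indicator A \<omega> * ennreal (norm (z t \<omega>)) ^ 4 \<partial>M) \<le> ennreal c\<^sub>2 * ennreal ((2 + real k) ^ 4)"
        using order.trans[OF mom2[OF z A t] mult_left_mono[OF A_mom[of z0 "2 * 2", OF on_A(2)]]] by simp
      have "S T \<subseteq> S t" using t by (auto simp: S_def stop_event_def)
      then have "(\<integral>\<^sup>+\<omega>. indicator (S T) \<omega> * ennreal (norm (y t \<omega> - z t \<omega>)) ^ 2 \<partial>M) \<le> (\<integral>\<^sup>+\<omega>. indicator (S t) \<omega> * ennreal (norm (y t \<omega> - z t \<omega>)) ^ 2 \<partial>M)"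
        by (intro nn_integral_mono) (auto simp: indicator_def)
      then show "(\<integral>\<^sup>+\<omega>. indicator (S T) \<omega> * ennreal (norm (y t \<omega> - z t \<omega>)) ^ 2 \<partial>M) \<le> ennreal c\<^sub>4 * ?\<delta>"
        using diff[rule_format, OF y z t] unfolding S_def by (rule order.trans)
    qed simp_all
    \<comment> \<open>All integrals are now known to be finite and are replaced by real numbers, so
      that the choice of the constants can be verified by linear arithmetic.\<close>
    also have "\<dots> \<le> ennreal (\<epsilon> / 2)"
    proof -
      obtain d where d: "?\<delta> = ennreal d" "0 \<le> d" "d < \<zeta>"
        using close by (cases ?\<delta>) (auto simp: ennreal_less_iff)
      obtain h where h: "tl k = ennreal h" "0 \<le> h" "h < \<eta>"
        using k by (cases "tl k") (auto simp: ennreal_less_iff)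
      have Y': "?Y \<le> ennreal (h + (1 + real k)\<^sup>2 * d)"
        using Y d h by (simp add: ennreal_mult)
      then obtain Yr where Yr: "?Y = ennreal Yr" "0 \<le> Yr" by (cases ?Y) (auto simp: top_unique)
      have Yr': "Yr \<le> h + (1 + real k)\<^sup>2 * d"
        using Y' Yr d h ennreal_le_iff[of "h + (1 + real k)\<^sup>2 * d" Yr] by (simp del: ennreal_plus)
      have Z': "?Z \<le> ennreal (4 * (Yr + d))"
        using Z Yr d by (simp add: ennreal_mult)
      then obtain Zr where Zr: "?Z = ennreal Zr" "0 \<le> Zr" by (cases ?Z) (auto simp: top_unique)
      have Zr': "Zr \<le> 4 * (Yr + d)"
        using Z' Zr Yr d ennreal_le_iff[of "4 * (Yr + d)" Zr] by (simp del: ennreal_plus)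
      have "4 * (c\<^sub>1 * Yr + c\<^sub>1 * Zr) + R * (2 * D / real m) + 16 / R * (c\<^sub>2 * (2 + real k) ^ 4 + c\<^sub>2 * (2 + real k) ^ 4) + c\<^sub>4 * d \<le> \<epsilon> / 2"
      proof -
        have t1: "4 * (c\<^sub>1 * Yr + c\<^sub>1 * Zr) + c\<^sub>4 * d \<le> 20 * c\<^sub>1 * h + c\<^sub>5 * d"
        proof -
          have "Yr + Zr \<le> 5 * h + (5 * (1 + real k)\<^sup>2 + 4) * d" using Yr' Zr' by (simp add: algebra_simps)
          then have "4 * c\<^sub>1 * (Yr + Zr) \<le> 4 * c\<^sub>1 * (5 * h + (5 * (1 + real k)\<^sup>2 + 4) * d)"
            using c1 by (intro mult_left_mono) auto
          then show ?thesis by (simp add: c\<^sub>5_def algebra_simps)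
        qed
        have cancel: "w * (\<epsilon> / (8 * w)) = \<epsilon> / 8" if "w \<noteq> 0" for w
          using that by simp
        have "20 * c\<^sub>1 * h \<le> (20 * c\<^sub>1 + 1) * \<eta>" using h c1 by (intro mult_mono) auto
        also have "\<dots> = \<epsilon> / 8" unfolding \<eta>_def by (rule cancel) (use c1 in linarith)
        finally have t2: "20 * c\<^sub>1 * h \<le> \<epsilon> / 8" .
        have "c\<^sub>5 * d \<le> (c\<^sub>5 + 1) * \<zeta>" using d c5 by (intro mult_mono) auto
        also have "\<dots> = \<epsilon> / 8" unfolding \<zeta>_def by (rule cancel) (use c5 in linarith)
        finally have t3: "c\<^sub>5 * d \<le> \<epsilon> / 8" .
        have "16 * R * D / \<epsilon> \<le> real m" using m by simp
        then have "16 * R * D \<le> real m * \<epsilon>" using \<epsilon> by (simp add: pos_divide_le_eq)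
        then have t4: "R * (2 * D / real m) \<le> \<epsilon> / 8" using m1 by (simp add: field_simps)
        have "0 \<le> c\<^sub>2 * (2 + real k) ^ 4" using c2 by simp
        then have t5: "16 / R * (c\<^sub>2 * (2 + real k) ^ 4 + c\<^sub>2 * (2 + real k) ^ 4) \<le> \<epsilon> / 8"
        proof -
          define w where "w = c\<^sub>2 * (2 + real k) ^ 4"
          have w: "0 \<le> w" "R = 8 * (32 * w + 1) / \<epsilon>" using c2 by (simp_all add: w_def R_def)
          have "16 / R * (w + w) = \<epsilon> / 8 * (32 * w / (32 * w + 1))"
            using w \<epsilon> by (simp add: w(2) field_simps)
          also have "\<dots> \<le> \<epsilon> / 8 * 1" using w(1) \<epsilon> by (intro mult_left_mono) auto
          finally show ?thesis by (simp add: w_def)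
        qed
        show ?thesis using t1 t2 t3 t4 t5 by linarith
      qed
      then have "ennreal (4 * (c\<^sub>1 * Yr + c\<^sub>1 * Zr) + R * (2 * D / real m) + 16 / R * (c\<^sub>2 * (2 + real k) ^ 4 + c\<^sub>2 * (2 + real k) ^ 4) + c\<^sub>4 * d) \<le> ennreal (\<epsilon> / 2)"
        by (rule ennreal_leI)
      moreover have "4 * (ennreal c\<^sub>1 * ennreal Yr + ennreal c\<^sub>1 * ennreal Zr) = ennreal (4 * (c\<^sub>1 * Yr + c\<^sub>1 * Zr))"
        using c1 Yr(2) Zr(2) by (simp add: ennreal_mult)
      moreover have "ennreal R * ennreal (2 * D / real m) = ennreal (R * (2 * D / real m))"
        using R0 D0 by (intro ennreal_mult[symmetric]) auto
      moreover have "ennreal (16 / R) * (ennreal c\<^sub>2 * ennreal ((2 + real k) ^ 4) + ennreal c\<^sub>2 * ennreal ((2 + real k) ^ 4)) =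
          ennreal (16 / R * (c\<^sub>2 * (2 + real k) ^ 4 + c\<^sub>2 * (2 + real k) ^ 4))"
      proof -
        define w where "w = c\<^sub>2 * (2 + real k) ^ 4"
        have w: "0 \<le> w" using c2 by (simp add: w_def)
        have "ennreal c\<^sub>2 * ennreal ((2 + real k) ^ 4) = ennreal w"
          unfolding w_def by (rule ennreal_mult[symmetric]) (use c2 in auto)
        moreover have "ennreal w + ennreal w = ennreal (w + w)"
          using w w by (rule ennreal_plus[symmetric])
        moreover have "ennreal (16 / R) * ennreal (w + w) = ennreal (16 / R * (w + w))"
          using w R0 by (intro ennreal_mult[symmetric]) auto
        ultimately show ?thesis unfolding w_def by (simp only:)
      qed
      moreover have "ennreal c\<^sub>4 * ennreal d = ennreal (c\<^sub>4 * d)"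
        using c4 d(2) by (intro ennreal_mult[symmetric])
      moreover have "0 \<le> 4 * (c\<^sub>1 * Yr + c\<^sub>1 * Zr)" "0 \<le> R * (2 * D / real m)"
        "0 \<le> 16 / R * (c\<^sub>2 * (2 + real k) ^ 4 + c\<^sub>2 * (2 + real k) ^ 4)" "0 \<le> c\<^sub>4 * d"
        using c1 c2 c4 Yr(2) Zr(2) d(2) R0 D0 by simp_all
      ultimately show ?thesis
        unfolding d(1) Yr(1) Zr(1) by (metis (no_types, lifting) add_nonneg_nonneg ennreal_plus)
    qed
    also have "\<dots> < ennreal \<epsilon>" using \<epsilon> by (simp add: ennreal_less_iff)
    finally show ?thesis .
  qed
  ultimately show ?thesis by blast
qed

end

section \<open>From extended to Bochner expectations\<close>

theorem theorem3p7:
  fixes M :: "'a measure" and F :: "real \<Rightarrow> 'a measure" and W :: "real \<Rightarrow> 'a \<Rightarrow> real ^ 'r"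
    and T \<alpha> \<beta>\<^sub>1 \<beta>\<^sub>2 :: real and p :: nat
    and f\<^sub>0 :: "real \<Rightarrow> real ^ 'd \<Rightarrow> real ^ 'd"
    and f\<^sub>1 :: "real \<Rightarrow> real \<Rightarrow> real ^ 'd \<Rightarrow> real ^ 'd"
    and f\<^sub>2 :: "real \<Rightarrow> real \<Rightarrow> real ^ 'd \<Rightarrow> real ^ 'r ^ 'd"
    and y\<^sub>0 :: "'a \<Rightarrow> real ^ 'd" and y :: "real \<Rightarrow> 'a \<Rightarrow> real ^ 'd"
  assumes "complete_filtered_prob_space M F" and "wiener_process M F W"
    and "T > 0" and "0 < \<alpha>" "\<alpha> \<le> 1" and "0 < \<beta>\<^sub>1" "\<beta>\<^sub>1 < 1" and "0 < \<beta>\<^sub>2" "\<beta>\<^sub>2 < 1 / 2"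
    and "p \<ge> 2"
    and "y\<^sub>0 \<in> borel_measurable (F 0)" and "integrable M (\<lambda>\<omega>. norm (y\<^sub>0 \<omega>) ^ p)"
    and "(\<lambda>(s, x). f\<^sub>0 s x) \<in> borel_measurable (restrict_space borel ({0..T} \<times> UNIV))"
    and "(\<lambda>(t, s, x). f\<^sub>1 t s x) \<in> borel_measurable (restrict_space borel ({0..T} \<times> {0..T} \<times> UNIV))"
    and "(\<lambda>(t, s, x). f\<^sub>2 t s x) \<in> borel_measurable (restrict_space borel ({0..T} \<times> {0..T} \<times> UNIV))"
    and time_lipschitz:
      "\<exists>L\<^sub>1>0. \<forall>t\<^sub>1\<in>{0..T}. \<forall>t\<^sub>2\<in>{0..T}. \<forall>s\<in>{0..T}. \<forall>x.
         norm (f\<^sub>1 t\<^sub>1 s x - f\<^sub>1 t\<^sub>2 s x) \<le> L\<^sub>1 * (1 + norm x) * \<bar>t\<^sub>1 - t\<^sub>2\<bar> \<and>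
         norm (f\<^sub>2 t\<^sub>1 s x - f\<^sub>2 t\<^sub>2 s x) \<le> L\<^sub>1 * (1 + norm x) * \<bar>t\<^sub>1 - t\<^sub>2\<bar>"
    and local_lipschitz:
      "\<forall>m::nat. m \<ge> 1 \<longrightarrow> (\<exists>K>0. \<forall>t\<in>{0..T}. \<forall>s\<in>{0..T}. \<forall>x\<^sub>1 x\<^sub>2.
         max (norm x\<^sub>1) (norm x\<^sub>2) \<le> real m \<longrightarrow>
         norm (f\<^sub>0 s x\<^sub>1 - f\<^sub>0 s x\<^sub>2) \<le> K * norm (x\<^sub>1 - x\<^sub>2) \<and>
         norm (f\<^sub>1 t s x\<^sub>1 - f\<^sub>1 t s x\<^sub>2) \<le> K * norm (x\<^sub>1 - x\<^sub>2) \<and>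
         norm (f\<^sub>2 t s x\<^sub>1 - f\<^sub>2 t s x\<^sub>2) \<le> K * norm (x\<^sub>1 - x\<^sub>2))"
    and linear_growth:
      "\<exists>L>0. \<forall>t\<in>{0..T}. \<forall>s\<in>{0..T}. \<forall>x.
         norm (f\<^sub>0 s x) \<le> L * (1 + norm x) \<and>
         norm (f\<^sub>1 t s x) \<le> L * (1 + norm x) \<and>
         norm (f\<^sub>2 t s x) \<le> L * (1 + norm x)"
    and "is_solution M F W T \<alpha> \<beta>\<^sub>1 \<beta>\<^sub>2 f\<^sub>0 f\<^sub>1 f\<^sub>2 y\<^sub>0 y"
  shows "\<forall>\<epsilon>>0. \<exists>\<zeta>>0. \<forall>(z\<^sub>0 :: 'a \<Rightarrow> real ^ 'd) (z :: real \<Rightarrow> 'a \<Rightarrow> real ^ 'd).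
           z\<^sub>0 \<in> borel_measurable (F 0) \<longrightarrow> integrable M (\<lambda>\<omega>. norm (z\<^sub>0 \<omega>) ^ p) \<longrightarrow>
           is_solution M F W T \<alpha> \<beta>\<^sub>1 \<beta>\<^sub>2 f\<^sub>0 f\<^sub>1 f\<^sub>2 z\<^sub>0 z \<longrightarrow>
           prob_space.expectation M (\<lambda>\<omega>. (norm (y\<^sub>0 \<omega> - z\<^sub>0 \<omega>))\<^sup>2) < \<zeta> \<longrightarrow>
           (\<forall>t\<in>{0..T}. integrable M (\<lambda>\<omega>. (norm (y t \<omega> - z t \<omega>))\<^sup>2) \<and>
              prob_space.expectation M (\<lambda>\<omega>. (norm (y t \<omega> - z t \<omega>))\<^sup>2) < \<epsilon>)"
proof -
  have psp: "prob_space M"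
    using \<open>complete_filtered_prob_space M F\<close> unfolding complete_filtered_prob_space_def by (elim conjE)
  interpret prob_space M by (rule psp)
  interpret volterra_equation M F W T \<alpha> \<beta>\<^sub>1 \<beta>\<^sub>2 f\<^sub>0 f\<^sub>1 f\<^sub>2
    by unfold_locales fact+
  have F0: "x \<in> borel_measurable M" if "x \<in> borel_measurable (F 0)" for x :: "'a \<Rightarrow> real ^ 'd"
    by (rule F_measurable[OF _ that]) simp
  have sq: "integrable M (\<lambda>\<omega>. (norm (x \<omega>))\<^sup>2)"
    if x: "x \<in> borel_measurable (F 0)" and int: "integrable M (\<lambda>\<omega>. norm (x \<omega>) ^ p)" for x :: "'a \<Rightarrow> real ^ 'd"
  proof (rule Bochner_Integration.integrable_bound)
    show "integrable M (\<lambda>\<omega>. 1 + norm (x \<omega>) ^ p)" using int by simp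
    have [measurable]: "x \<in> borel_measurable M" by (rule F0[OF x])
    show "(\<lambda>\<omega>. (norm (x \<omega>))\<^sup>2) \<in> borel_measurable M" by measurable
    have "(norm v)\<^sup>2 \<le> 1 + norm v ^ p" for v :: "real ^ 'd"
    proof (cases "norm v \<le> 1")
      case True
      then show ?thesis by (simp add: power_le_one add_increasing2)
    next
      case False
      then have "(norm v)\<^sup>2 \<le> norm v ^ p" using \<open>p \<ge> 2\<close> by (intro power_increasing) auto
      then show ?thesis by linarith
    qed
    then show "AE \<omega> in M. norm ((norm (x \<omega>))\<^sup>2) \<le> norm (1 + norm (x \<omega>) ^ p)" by simp
  qed
  have y: "solution y\<^sub>0 y" unfolding solution_def by (intro conjI) fact+
  have "(\<integral>\<^sup>+\<omega>. ennreal (norm (y\<^sub>0 \<omega>)) ^ 2 \<partial>M) < \<top>"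
    using sq[OF \<open>y\<^sub>0 \<in> borel_measurable (F 0)\<close> \<open>integrable M (\<lambda>\<omega>. norm (y\<^sub>0 \<omega>) ^ p)\<close>]
    by (simp add: integrable_iff_bounded ennreal_power)
  note dep = continuous_dependence[OF y this]
  show ?thesis
  proof (intro allI impI)
    fix \<epsilon> :: real assume \<epsilon>: "0 < \<epsilon>"
    obtain \<zeta> where \<zeta>: "0 < \<zeta>" and close: "\<forall>z0 z. solution z0 z \<longrightarrow> (\<integral>\<^sup>+\<omega>. ennreal (norm (y\<^sub>0 \<omega> - z0 \<omega>)) ^ 2 \<partial>M) < ennreal \<zeta> \<longrightarrow>
      (\<forall>t\<in>{0..T}. (\<integral>\<^sup>+\<omega>. ennreal (norm (y t \<omega> - z t \<omega>)) ^ 2 \<partial>M) < ennreal \<epsilon>)"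
      using dep[OF \<epsilon>] by (elim exE conjE) (rule that)
    show "\<exists>\<zeta>>0. \<forall>(z\<^sub>0 :: 'a \<Rightarrow> real ^ 'd) (z :: real \<Rightarrow> 'a \<Rightarrow> real ^ 'd).
           z\<^sub>0 \<in> borel_measurable (F 0) \<longrightarrow> integrable M (\<lambda>\<omega>. norm (z\<^sub>0 \<omega>) ^ p) \<longrightarrow>
           is_solution M F W T \<alpha> \<beta>\<^sub>1 \<beta>\<^sub>2 f\<^sub>0 f\<^sub>1 f\<^sub>2 z\<^sub>0 z \<longrightarrow>
           expectation (\<lambda>\<omega>. (norm (y\<^sub>0 \<omega> - z\<^sub>0 \<omega>))\<^sup>2) < \<zeta> \<longrightarrow>
           (\<forall>t\<in>{0..T}. integrable M (\<lambda>\<omega>. (norm (y t \<omega> - z t \<omega>))\<^sup>2) \<and>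
              expectation (\<lambda>\<omega>. (norm (y t \<omega> - z t \<omega>))\<^sup>2) < \<epsilon>)"
    proof (intro exI[of _ \<zeta>] conjI \<zeta> allI impI ballI)
      fix z\<^sub>0 :: "'a \<Rightarrow> real ^ 'd" and z :: "real \<Rightarrow> 'a \<Rightarrow> real ^ 'd" and t
      assume z0: "z\<^sub>0 \<in> borel_measurable (F 0)" and z0i: "integrable M (\<lambda>\<omega>. norm (z\<^sub>0 \<omega>) ^ p)"
        and zs: "is_solution M F W T \<alpha> \<beta>\<^sub>1 \<beta>\<^sub>2 f\<^sub>0 f\<^sub>1 f\<^sub>2 z\<^sub>0 z"
        and ex: "expectation (\<lambda>\<omega>. (norm (y\<^sub>0 \<omega> - z\<^sub>0 \<omega>))\<^sup>2) < \<zeta>" and t: "t \<in> {0..T}"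
      have z: "solution z\<^sub>0 z" using z0 zs by (simp add: solution_def)
      have [measurable]: "y\<^sub>0 \<in> borel_measurable M" "z\<^sub>0 \<in> borel_measurable M" "y t \<in> borel_measurable M" "z t \<in> borel_measurable M"
        by (rule solution_initial_measurable[OF y] solution_initial_measurable[OF z] solution_measurable[OF y t] solution_measurable[OF z t])+
      \<comment> \<open>The Bochner expectation of a non-integrable function is 0, so integrability
        has to be established before smallness of the expectation says anything about the extended
        integral.\<close>
      have i0: "integrable M (\<lambda>\<omega>. (norm (y\<^sub>0 \<omega> - z\<^sub>0 \<omega>))\<^sup>2)"
      proof (rule Bochner_Integration.integrable_bound)
        show "integrable M (\<lambda>\<omega>. 2 * (norm (y\<^sub>0 \<omega>))\<^sup>2 + 2 * (norm (z\<^sub>0 \<omega>))\<^sup>2)"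
          using sq[OF z0 z0i] sq[OF \<open>y\<^sub>0 \<in> borel_measurable (F 0)\<close> \<open>integrable M (\<lambda>\<omega>. norm (y\<^sub>0 \<omega>) ^ p)\<close>] by simp
        show "AE \<omega> in M. norm ((norm (y\<^sub>0 \<omega> - z\<^sub>0 \<omega>))\<^sup>2) \<le> norm (2 * (norm (y\<^sub>0 \<omega>))\<^sup>2 + 2 * (norm (z\<^sub>0 \<omega>))\<^sup>2)"
          using norm_sum_sq_le[of "y\<^sub>0 _" "- z\<^sub>0 _"] by simp
      qed measurable
      have "(\<integral>\<^sup>+\<omega>. ennreal (norm (y\<^sub>0 \<omega> - z\<^sub>0 \<omega>)) ^ 2 \<partial>M) = ennreal (expectation (\<lambda>\<omega>. (norm (y\<^sub>0 \<omega> - z\<^sub>0 \<omega>))\<^sup>2))"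
        unfolding ennreal_power[OF norm_ge_zero] by (rule nn_integral_eq_integral[OF i0]) simp
      also have "\<dots> < ennreal \<zeta>" using ex \<zeta> by (simp add: ennreal_lessI)
      finally have lt: "(\<integral>\<^sup>+\<omega>. ennreal ((norm (y t \<omega> - z t \<omega>))\<^sup>2) \<partial>M) < ennreal \<epsilon>"
        using close[rule_format, OF z _ t] by (simp add: ennreal_power)
      show i: "integrable M (\<lambda>\<omega>. (norm (y t \<omega> - z t \<omega>))\<^sup>2)"
        unfolding integrable_iff_bounded using lt by (auto intro: less_trans)
      have "ennreal (expectation (\<lambda>\<omega>. (norm (y t \<omega> - z t \<omega>))\<^sup>2)) < ennreal \<epsilon>"
        using lt by (subst (asm) nn_integral_eq_integral[OF i]) auto
      then show "expectation (\<lambda>\<omega>. (norm (y t \<omega> - z t \<omega>))\<^sup>2) < \<epsilon>"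
        by (simp add: ennreal_less_iff)
    qed
  qed
qed

end
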